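(* For every integer $n\ge3$, there is a proper holomorphic embedding $\gamma\colon\mathbb{C}\hookrightarrow\mathbb{C}^n$ whose image $A=\gamma(\mathbb{C})$ is a closed connected smooth complex curve such that the blow-up $\operatorname{Bl}_A\mathbb{C}^n$ is Brody volume hyperbolic and hence is not Oka.
   Context: For a complex manifold $X$ and a closed complex submanifold $A\subset X$, $\operatorname{Bl}_A X$ denotes the standard analytic blow-up of $X$ along $A$: it replaces each point of $A$ by the projective space of complex lines in the normal space of $A$ at that point. A continuous map $p\colon X\to Z$ is proper if $p^{-1}(K)$ is compact for every compact set $K\subset Z$. If $Y$ is an $n$-dimensional complex manifold, a holomorphic map $f\colon\mathbb{C}^n\to Y$ is nondegenerate when its differential $df$ has rank $n$ at some point. The $n$-dimensional complex manifold $Y$ is Brody volume hyperbolic if there is no nondegenerate holomorphic map $\mathbb{C}^n\to Y$. A map $f\colon K\to Y$ from a compact set $K\subset\mathbb{C}^m$ to a complex manifold $Y$ is called holomorphic (on $K$) if it extends to a holomorphic map from an open neighborhood of $K$ to $Y$. The manifold $Y$ is called Oka if, for every integer $m\ge1$, every nonempty compact convex set $K\subset\mathbb{C}^m$, and every map $f\colon K\to Y$ holomorphic on $K$, there are holomorphic maps $F_j\colon\mathbb{C}^m\to Y$ converging uniformly to $f$ on $K$ (with respect to any distance inducing the topology of $Y$; the choice does not matter). *)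

theory Defs
  imports "HOL-Complex_Analysis.Complex_Analysis" "Jordan_Normal_Form.DL_Rank"
begin

section \<open>Several complex variables\<close>

text \<open>
  The space \<open>\<complex>\<^sup>n\<close> is carried by the functions \<open>nat \<Rightarrow> complex\<close> vanishing from index \<open>n\<close> on, as in
  \<open>Euclidean_space\<close>, because \<open>n\<close> has to be a quantifiable number (the Oka property ranges over all
  source dimensions). On this set the product topology of \<open>nat \<Rightarrow> complex\<close> induces the Euclidean one.
\<close>

definition cspace :: "nat \<Rightarrow> (nat \<Rightarrow> complex) set" where
  "cspace n = {z. \<forall>i\<ge>n. z i = 0}"

definition cspace_top :: "nat \<Rightarrow> (nat \<Rightarrow> complex) topology" where
  "cspace_top n = top_of_set (cspace n)"

text \<open>Holomorphic: continuous and holomorphic in each variable. Meant for \<open>U\<close> open in \<open>\<complex>\<^sup>n\<close>.\<close>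

definition holo_on :: "nat \<Rightarrow> (nat \<Rightarrow> complex) set \<Rightarrow> ((nat \<Rightarrow> complex) \<Rightarrow> complex) \<Rightarrow> bool" where
  "holo_on n U f \<longleftrightarrow> continuous_on U f \<and>
     (\<forall>z\<in>U. \<forall>i<n. (\<lambda>t. f (z(i := t))) holomorphic_on {t. z(i := t) \<in> U})"

definition pderiv_at :: "nat \<Rightarrow> ((nat \<Rightarrow> complex) \<Rightarrow> complex) \<Rightarrow> (nat \<Rightarrow> complex) \<Rightarrow> complex" where
  "pderiv_at i f z = deriv (\<lambda>t. f (z(i := t))) (z i)"

definition differential ::
    "nat \<Rightarrow> ((nat \<Rightarrow> complex) \<Rightarrow> complex) \<Rightarrow> (nat \<Rightarrow> complex) \<Rightarrow> (nat \<Rightarrow> complex) \<Rightarrow> complex" where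
  "differential n f z v = (\<Sum>i<n. pderiv_at i f z * v i)"

definition jacobian ::
    "nat \<Rightarrow> ((nat \<Rightarrow> complex) \<Rightarrow> (nat \<Rightarrow> complex)) \<Rightarrow> (nat \<Rightarrow> complex) \<Rightarrow> complex mat" where
  "jacobian n F z = Matrix.mat n n (\<lambda>(j, i). pderiv_at i (\<lambda>w. F w j) z)"

definition local_coordinates ::
    "nat \<Rightarrow> (nat \<Rightarrow> complex) set \<Rightarrow> ((nat \<Rightarrow> complex) \<Rightarrow> (nat \<Rightarrow> complex)) \<Rightarrow> bool" where
  "local_coordinates n U \<phi> \<longleftrightarrow>
     openin (cspace_top n) U \<and> inj_on \<phi> U \<and> openin (cspace_top n) (\<phi> ` U) \<and>
     (\<forall>i. holo_on n U (\<lambda>z. \<phi> z i)) \<and>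
     (\<forall>i. holo_on n (\<phi> ` U) (\<lambda>w. inv_into U \<phi> w i))"


section \<open>Complex manifolds\<close>

text \<open>
  A manifold is given by its holomorphic atlas, a set of pairs (domain, coordinate map). The points
  are those lying in some chart domain, and the topology is the coarsest one in which the chart
  domains are open and the coordinate maps are continuous; openness of the sets
  \<open>\<phi> ` (U \<inter> V)\<close> makes the coordinate maps homeomorphisms onto open sets.
\<close>

type_synonym 'a chart = "'a set \<times> ('a \<Rightarrow> nat \<Rightarrow> complex)"

definition mfd_top :: "'a chart set \<Rightarrow> 'a topology" where
  "mfd_top Y = topology_generated_by
     {{p \<in> U. \<phi> p \<in> W} | U \<phi> W. (U, \<phi>) \<in> Y \<and> open W}"

definition complex_manifold :: "nat \<Rightarrow> 'a chart set \<Rightarrow> bool" where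
  "complex_manifold n Y \<longleftrightarrow>
     (\<forall>(U, \<phi>)\<in>Y. inj_on \<phi> U \<and> openin (cspace_top n) (\<phi> ` U)) \<and>
     (\<forall>(U, \<phi>)\<in>Y. \<forall>(V, \<psi>)\<in>Y. openin (cspace_top n) (\<phi> ` (U \<inter> V)) \<and>
        (\<forall>i. holo_on n (\<phi> ` (U \<inter> V)) (\<lambda>w. \<psi> (inv_into U \<phi> w) i))) \<and>
     Hausdorff_space (mfd_top Y) \<and> second_countable (mfd_top Y)"

text \<open>Holomorphic maps from an open subset \<open>W\<close> of \<open>\<complex>\<^sup>m\<close> to a manifold.\<close>

definition holo_map :: "nat \<Rightarrow> (nat \<Rightarrow> complex) set \<Rightarrow> 'a chart set \<Rightarrow> ((nat \<Rightarrow> complex) \<Rightarrow> 'a) \<Rightarrow> bool" where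
  "holo_map m W Y f \<longleftrightarrow> continuous_map (top_of_set W) (mfd_top Y) f \<and>
     (\<forall>(U, \<phi>)\<in>Y. \<forall>i. holo_on m (W \<inter> f -` U) (\<lambda>z. \<phi> (f z) i))"

definition nondegenerate :: "nat \<Rightarrow> 'a chart set \<Rightarrow> ((nat \<Rightarrow> complex) \<Rightarrow> 'a) \<Rightarrow> bool" where
  "nondegenerate n Y f \<longleftrightarrow>
     (\<exists>z\<in>cspace n. \<exists>(U, \<phi>)\<in>Y. f z \<in> U \<and> vec_space.rank n (jacobian n (\<phi> \<circ> f) z) = n)"

definition brody_volume_hyperbolic :: "nat \<Rightarrow> 'a chart set \<Rightarrow> bool" where
  "brody_volume_hyperbolic n Y \<longleftrightarrow> complex_manifold n Y \<and>
     \<not> (\<exists>f. holo_map n (cspace n) Y f \<and> nondegenerate n Y f)"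

definition cconvex :: "(nat \<Rightarrow> complex) set \<Rightarrow> bool" where
  "cconvex K \<longleftrightarrow> (\<forall>x\<in>K. \<forall>y\<in>K. \<forall>t::real. 0 \<le> t \<and> t \<le> 1 \<longrightarrow>
     (\<lambda>i. of_real (1 - t) * x i + of_real t * y i) \<in> K)"

definition holo_map_on_compact ::
    "nat \<Rightarrow> (nat \<Rightarrow> complex) set \<Rightarrow> 'a chart set \<Rightarrow> ((nat \<Rightarrow> complex) \<Rightarrow> 'a) \<Rightarrow> bool" where
  "holo_map_on_compact m K Y f \<longleftrightarrow>
     (\<exists>W g. openin (cspace_top m) W \<and> K \<subseteq> W \<and> holo_map m W Y g \<and> (\<forall>z\<in>K. g z = f z))"

text \<open>
  The distance is quantified existentially: a manifold is metrizable and, \<open>f ` K\<close> being compact, the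
  choice does not matter. The negation thus says that approximation fails for every
  compatible distance. The manifold axioms are not part of the predicate, so that its negation cannot
  hold merely because they fail.
\<close>

definition oka :: "'a chart set \<Rightarrow> bool" where
  "oka Y \<longleftrightarrow> (\<exists>d. mtopology_of d = mfd_top Y \<and>
     (\<forall>m\<ge>1. \<forall>K f. K \<subseteq> cspace m \<and> K \<noteq> {} \<and> compact K \<and> cconvex K \<and>
        holo_map_on_compact m K Y f \<longrightarrow>
        (\<exists>F. (\<forall>j::nat. holo_map m (cspace m) Y (F j)) \<and>
             (\<forall>e>0. \<exists>N. \<forall>j\<ge>N. \<forall>z\<in>K. mdist d (F j z) (f z) < e))))"


section \<open>Submanifolds of affine space and their blow-ups\<close>

text \<open>Coordinates on \<open>U\<close> in which \<open>A\<close> is the vanishing set of the first \<open>k\<close> coordinates.\<close>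

definition adapted ::
    "nat \<Rightarrow> (nat \<Rightarrow> complex) set \<Rightarrow> nat \<Rightarrow> (nat \<Rightarrow> complex) set \<Rightarrow> ((nat \<Rightarrow> complex) \<Rightarrow> (nat \<Rightarrow> complex)) \<Rightarrow> bool"
  where
  "adapted n A k U \<phi> \<longleftrightarrow> local_coordinates n U \<phi> \<and> k \<le> n \<and> A \<inter> U = {z \<in> U. \<forall>i<k. \<phi> z i = 0}"

definition closed_submanifold :: "nat \<Rightarrow> nat \<Rightarrow> (nat \<Rightarrow> complex) set \<Rightarrow> bool" where
  "closed_submanifold n d A \<longleftrightarrow> closedin (cspace_top n) A \<and> d \<le> n \<and>
     (\<forall>a\<in>A. \<exists>U \<phi>. a \<in> U \<and> adapted n A (n - d) U \<phi>)"

text \<open>The tangent space at \<open>a\<close>: velocities of holomorphic discs in \<open>A\<close> centred at \<open>a\<close>.\<close>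

definition tangent_space :: "(nat \<Rightarrow> complex) set \<Rightarrow> (nat \<Rightarrow> complex) \<Rightarrow> (nat \<Rightarrow> complex) set" where
  "tangent_space A a = {v. \<exists>r>0. \<exists>c :: complex \<Rightarrow> nat \<Rightarrow> complex.
     (\<forall>i. (\<lambda>t. c t i) holomorphic_on ball 0 r) \<and> c ` ball 0 r \<subseteq> A \<and> c 0 = a \<and>
     (\<forall>i. deriv (\<lambda>t. c t i) 0 = v i)}"

text \<open>
  A complex line in the normal space \<open>\<complex>\<^sup>n / T\<^sub>aA\<close> is represented by its preimage in \<open>\<complex>\<^sup>n\<close>, a
  subspace containing \<open>T\<^sub>aA\<close> as a hyperplane.
\<close>

definition normal_lines :: "nat \<Rightarrow> (nat \<Rightarrow> complex) set \<Rightarrow> (nat \<Rightarrow> complex) \<Rightarrow> (nat \<Rightarrow> complex) set set" where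
  "normal_lines n A a = {L. \<exists>v \<in> cspace n - tangent_space A a.
     L = {(\<lambda>i. s i + c * v i) | s c. s \<in> tangent_space A a}}"

type_synonym blowup_point = "(nat \<Rightarrow> complex) + (nat \<Rightarrow> complex) \<times> (nat \<Rightarrow> complex) set"

text \<open>
  Points of the blow-up: \<open>Inl z\<close> for \<open>z\<close> off \<open>A\<close>, and \<open>Inr (a, L)\<close> for \<open>a\<close> in \<open>A\<close> and a line \<open>L\<close> in
  the normal space at \<open>a\<close>. In adapted coordinates the blow-up is the set of all \<open>(x, [u])\<close> with
  \<open>[u]\<close> in projective \<open>(k-1)\<close>-space and \<open>(x\<^sub>0, \<dots>, x\<^bsub>k-1\<^esub>)\<close> a multiple of \<open>u\<close>, where \<open>u\<close> is the
  direction of \<open>(d\<phi>\<^sub>0, \<dots>, d\<phi>\<^bsub>k-1\<^esub>)\<close> on \<open>L\<close> over points of \<open>A\<close>. The \<open>j\<close>-th affine chart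
  is \<open>u\<^sub>j \<noteq> 0\<close>, with coordinates \<open>u\<^sub>i / u\<^sub>j\<close> for \<open>i < k\<close>, \<open>i \<noteq> j\<close>, together with \<open>x\<^sub>j\<close> and the \<open>x\<^sub>i\<close>
  for \<open>i \<ge> k\<close>. Adapted coordinates with \<open>U\<close> disjoint from \<open>A\<close> yield the charts off \<open>A\<close>.
\<close>

definition blowup_domain ::
    "nat \<Rightarrow> (nat \<Rightarrow> complex) set \<Rightarrow> (nat \<Rightarrow> complex) set \<Rightarrow> ((nat \<Rightarrow> complex) \<Rightarrow> (nat \<Rightarrow> complex)) \<Rightarrow> nat \<Rightarrow>
     blowup_point set" where
  "blowup_domain n A U \<phi> j =
     Inl ` {z \<in> U - A. \<phi> z j \<noteq> 0} \<union>
     Inr ` {(a, L). a \<in> A \<inter> U \<and> L \<in> normal_lines n A a \<and>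
                    (\<exists>v\<in>L. differential n (\<lambda>z. \<phi> z j) a v \<noteq> 0)}"

definition blowup_coord ::
    "nat \<Rightarrow> nat \<Rightarrow> ((nat \<Rightarrow> complex) \<Rightarrow> (nat \<Rightarrow> complex)) \<Rightarrow> nat \<Rightarrow> blowup_point \<Rightarrow> nat \<Rightarrow> complex" where
  "blowup_coord n k \<phi> j p = (case p of
      Inl z \<Rightarrow> (\<lambda>i. if i < k \<and> i \<noteq> j then \<phi> z i / \<phi> z j else \<phi> z i)
    | Inr (a, L) \<Rightarrow>
        (let v = (SOME v. v \<in> L \<and> differential n (\<lambda>z. \<phi> z j) a v \<noteq> 0)
         in (\<lambda>i. if i < k \<and> i \<noteq> j
                 then differential n (\<lambda>z. \<phi> z i) a v / differential n (\<lambda>z. \<phi> z j) a v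
                 else \<phi> a i)))"

definition blowup :: "nat \<Rightarrow> (nat \<Rightarrow> complex) set \<Rightarrow> blowup_point chart set" where
  "blowup n A = {(blowup_domain n A U \<phi> j, blowup_coord n k \<phi> j) | U \<phi> k j.
     adapted n A k U \<phi> \<and> j < k}"


section \<open>Proper holomorphic embeddings of the line\<close>

definition holomorphic_embedding :: "nat \<Rightarrow> (complex \<Rightarrow> nat \<Rightarrow> complex) \<Rightarrow> bool" where
  "holomorphic_embedding n \<gamma> \<longleftrightarrow> range \<gamma> \<subseteq> cspace n \<and>
     (\<forall>i. (\<lambda>t. \<gamma> t i) holomorphic_on UNIV) \<and>
     (\<forall>t. \<exists>i. deriv (\<lambda>s. \<gamma> s i) t \<noteq> 0) \<and>
     embedding_map euclidean (cspace_top n) \<gamma>"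

definition proper_into_cspace :: "nat \<Rightarrow> (complex \<Rightarrow> nat \<Rightarrow> complex) \<Rightarrow> bool" where
  "proper_into_cspace n \<gamma> \<longleftrightarrow> continuous_map euclidean (cspace_top n) \<gamma> \<and>
     (\<forall>K. K \<subseteq> cspace n \<and> compact K \<longrightarrow> compact (\<gamma> -` K))"

end

theory Submission
  imports Defs "HOL-Computational_Algebra.Fundamental_Theorem_Algebra"
begin

text \<open>
  Why such a curve exists. A holomorphic map \<open>f\<close> from \<open>\<complex>\<^sup>n\<close> to the blow-up along \<open>A\<close> is a lift of the map
  \<open>F\<close> obtained by blowing down, and \<open>F\<close> is again nondegenerate if \<open>f\<close> is. A lift makes the \<open>n - 1\<close>
  normal coordinates of \<open>F\<close> along \<open>A\<close> divisible by one of them, so at a point where \<open>F\<close> meets \<open>A\<close>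
  their differentials are proportional; as \<open>n - 1 \<ge> 2\<close>, the Jacobian determinant of \<open>F\<close> vanishes there
  (\<open>lift_degenerate_over_centre\<close>). It therefore suffices to find a properly embedded curve that every
  nondegenerate entire map \<open>F\<close> meets at a point where \<open>F\<close> is locally invertible.

  Following Rosay and Rudin, there is a discrete set of points with this property, and it stays
  unavoidable when each point is moved within some tolerance (\<open>unavoidable_sequence\<close>). The set consists
  of fine finite nets in shells. If \<open>F\<close> has a large Jacobian at the origin and maps a polydisc into
  a large one, but not a slightly smaller polydisc into a smaller one, then a quantitative inverse
  function theorem (\<open>uniform_local_surjectivity\<close>) makes its image contain a ball of controlled
  size in the corresponding shell (\<open>escaping_map_covers\<close>), hence all points near some point of the
  net. A map missing the set thus obeys bounds that descend from shell to shell to a universal bound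
  on the unit polydisc, which contradicts Cauchy's estimate once \<open>F\<close> has been rescaled to make its
  Jacobian at the origin large enough.

  Because of the tolerance the curve need not pass through given points exactly. It is a limit of
  polynomial curves (\<open>proper_curve_near_sequence\<close>). Each step approaches one more point far out in the
  parameter plane: one of the first two coordinates is made large outside a disc, and all the others
  are switched to the coordinates of the new point inside this disc by a polynomial cut-off
  (\<open>polynomial_curve_hit\<close>). A generic linear perturbation of three coordinates keeps the
  curves injective and immersed, which is where \<open>n \<ge> 3\<close> enters a second time.

  That the blow-up is a complex manifold is proved for all its charts at once: a transition map is
  computed by dividing the new normal coordinates by the equation of the exceptional divisor
  (\<open>blowup_chart_pair\<close>, \<open>complex_manifold_blowup\<close>). Finally the Oka property would approximate the
  inclusion of a small polydisc off the curve by entire maps, and approximations of a local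
  biholomorphism are nondegenerate (\<open>volume_hyperbolic_blowup_not_oka\<close>).
\<close>

section \<open>Polydiscs and the topology of affine space\<close>

definition polydisc :: "nat \<Rightarrow> (nat \<Rightarrow> complex) \<Rightarrow> real \<Rightarrow> (nat \<Rightarrow> complex) set" where
  "polydisc n a r = {z \<in> cspace n. \<forall>i<n. cmod (z i - a i) < r}"

definition cpolydisc :: "nat \<Rightarrow> (nat \<Rightarrow> complex) \<Rightarrow> real \<Rightarrow> (nat \<Rightarrow> complex) set" where
  "cpolydisc n a r = {z \<in> cspace n. \<forall>i<n. cmod (z i - a i) \<le> r}"

lemma cspace_upd: "z \<in> cspace n \<Longrightarrow> i < n \<Longrightarrow> z(i := t) \<in> cspace n"
  by (auto simp: cspace_def)

lemma cspace_eqI: "z \<in> cspace n \<Longrightarrow> w \<in> cspace n \<Longrightarrow> (\<And>i. i < n \<Longrightarrow> z i = w i) \<Longrightarrow> z = w"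
  by (rule ext) (metis (mono_tags, lifting) cspace_def leI mem_Collect_eq)

lemma centre_in_polydisc: "a \<in> cspace n \<Longrightarrow> r > 0 \<Longrightarrow> a \<in> polydisc n a r"
  by (simp add: polydisc_def)

lemma line_in_cspace: "a \<in> cspace n \<Longrightarrow> v \<in> cspace n \<Longrightarrow> (\<lambda>i. a i + t * v i) \<in> cspace n"
  by (simp add: cspace_def)

lemma polydisc_subset_cspace: "polydisc n a r \<subseteq> cspace n"
  by (auto simp: polydisc_def)

lemma tendsto_fun_iff:
  fixes f :: "'a \<Rightarrow> nat \<Rightarrow> complex"
  shows "(f \<longlongrightarrow> l) F \<longleftrightarrow> (\<forall>i. ((\<lambda>x. f x i) \<longlongrightarrow> l i) F)"
  using limitin_componentwise[of "\<lambda>i. euclidean" UNIV f l F]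
  by (simp add: euclidean_product_topology)

lemma openin_polydisc: "openin (cspace_top n) (polydisc n a r)"
proof -
  have "open {w :: nat \<Rightarrow> complex. cmod (w i - a i) < r}" for i
    by (intro open_Collect_less continuous_intros continuous_on_product_then_coordinatewise)
  then have "open (\<Inter>i<n. {w :: nat \<Rightarrow> complex. cmod (w i - a i) < r})"
    by (intro open_INT) auto
  moreover have "polydisc n a r = cspace n \<inter> (\<Inter>i<n. {w. cmod (w i - a i) < r})"
    by (auto simp: polydisc_def)
  ultimately show ?thesis
    unfolding cspace_top_def openin_open by blast
qed

lemma openin_cspace_iff:
  "openin (cspace_top n) U \<longleftrightarrow> U \<subseteq> cspace n \<and> (\<forall>z\<in>U. \<exists>r>0. polydisc n z r \<subseteq> U)"
proof
  assume "openin (cspace_top n) U"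
  then obtain O' where O: "open O'" "U = cspace n \<inter> O'"
    unfolding cspace_top_def openin_open by blast
  have "\<exists>r>0. polydisc n z r \<subseteq> U" if "z \<in> U" for z
  proof (rule ccontr)
    assume neg: "\<not> ?thesis"
    have "\<exists>w. w \<in> polydisc n z (1 / real (Suc k)) \<and> w \<notin> U" for k
    proof -
      have "1 / real (Suc k) > 0" by simp
      with neg have "\<not> polydisc n z (1 / real (Suc k)) \<subseteq> U" by blast
      then show ?thesis by blast
    qed
    then obtain w where w: "\<And>k. w k \<in> polydisc n z (1 / real (Suc k))" "\<And>k. w k \<notin> U"
      by metis
    have "(\<lambda>k. w k i) \<longlonglongrightarrow> z i" for i
    proof (cases "i < n")
      case True
      have "\<forall>\<^sub>F k in sequentially. cmod (w k i - z i) \<le> 1 / real (Suc k)"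
        using w(1) True by (intro always_eventually) (auto simp: polydisc_def less_imp_le)
      then have "(\<lambda>k. w k i - z i) \<longlonglongrightarrow> 0"
        by (rule Lim_null_comparison) (use LIMSEQ_inverse_real_of_nat in \<open>simp add: inverse_eq_divide\<close>)
      then show ?thesis
        using LIM_zero_iff by blast
    next
      case False
      have "w k i = z i" for k
        using w(1)[of k] that O False by (auto simp: polydisc_def cspace_def)
      then show ?thesis by simp
    qed
    then have "w \<longlonglongrightarrow> z"
      by (simp add: tendsto_fun_iff)
    then have "\<forall>\<^sub>F k in sequentially. w k \<in> O'"
      using O that by (intro topological_tendstoD) auto
    then obtain k where "w k \<in> O'"
      by (meson eventually_sequentially order_refl)
    with w[of k] O show False
      by (auto simp: polydisc_def)
  qed
  with O show "U \<subseteq> cspace n \<and> (\<forall>z\<in>U. \<exists>r>0. polydisc n z r \<subseteq> U)"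
    by auto
next
  assume U: "U \<subseteq> cspace n \<and> (\<forall>z\<in>U. \<exists>r>0. polydisc n z r \<subseteq> U)"
  show "openin (cspace_top n) U"
  proof (subst openin_subopen, intro ballI)
    fix z assume "z \<in> U"
    with U obtain r where "r > 0" "polydisc n z r \<subseteq> U" by blast
    with U \<open>z \<in> U\<close> show "\<exists>T. openin (cspace_top n) T \<and> z \<in> T \<and> T \<subseteq> U"
      using openin_polydisc centre_in_polydisc by (metis subsetD)
  qed
qed

lemma openin_cspace_subset: "openin (cspace_top n) U \<Longrightarrow> U \<subseteq> cspace n"
  by (simp add: openin_cspace_iff)

lemma openin_cspace_whole: "openin (cspace_top n) (cspace n)"
  by (simp add: cspace_top_def)

lemma compact_cpolydisc: "compact (cpolydisc n a r)"
proof -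
  have "z \<in> cpolydisc n a r \<longleftrightarrow> z \<in> PiE UNIV (\<lambda>i. if i < n then cball (a i) r else {0})" for z
  proof -
    have "z \<in> cpolydisc n a r \<longleftrightarrow> (\<forall>i. z i \<in> (if i < n then cball (a i) r else {0}))"
      unfolding cpolydisc_def cspace_def mem_Collect_eq
      by (simp add: dist_norm norm_minus_commute not_le[symmetric]) blast
    then show ?thesis
      by (simp only: PiE_iff extensional_UNIV) simp
  qed
  then have "cpolydisc n a r = PiE UNIV (\<lambda>i. if i < n then cball (a i) r else {0})"
    by blast
  moreover have "compactin (product_topology (\<lambda>i. euclidean) UNIV)
      (PiE UNIV (\<lambda>i. if i < n then cball (a i) r else {0 :: complex}))"
    by (subst compactin_PiE) auto
  ultimately show ?thesis
    by (simp add: euclidean_product_topology)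
qed

lemma continuous_on_upd:
  fixes z :: "nat \<Rightarrow> complex"
  shows "continuous_on S (\<lambda>t. z(i := t))"
proof (rule continuous_on_coordinatewise_then_product)
  show "continuous_on S (\<lambda>t. (z(i := t)) j)" for j
    by (cases "j = i") (auto intro: continuous_on_id)
qed

lemma open_slice:
  assumes "openin (cspace_top n) U" "z \<in> cspace n" "i < n"
  shows "open {t. z(i := t) \<in> U}"
proof -
  obtain O' where O: "open O'" "U = cspace n \<inter> O'"
    using assms(1) unfolding cspace_top_def openin_open by blast
  have "open ((\<lambda>t. z(i := t)) -` O')"
    using continuous_on_open_vimage[of UNIV "\<lambda>t. z(i := t)"] continuous_on_upd[of UNIV z i] O by auto
  moreover have "{t. z(i := t) \<in> U} = (\<lambda>t. z(i := t)) -` O'"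
    using assms cspace_upd O by auto
  ultimately show ?thesis by simp
qed

lemma continuous_near:
  fixes m :: nat
  assumes "openin (cspace_top n) U" "z \<in> U" "\<And>i. i < m \<Longrightarrow> continuous_on U (g i)" "(e :: real) > 0"
  shows "\<exists>r>0. polydisc n z r \<subseteq> U \<and> (\<forall>i<m. \<forall>y\<in>polydisc n z r. cmod (g i y - g i z) < e)"
proof -
  have "\<exists>r>0. polydisc n z r \<subseteq> U \<and> (\<forall>y\<in>polydisc n z r. cmod (g i y - g i z) < e)" if "i < m" for i
  proof -
    have "openin (top_of_set U) (U \<inter> g i -` ball (g i z) e)"
      using assms(3)[OF that] by (intro continuous_openin_preimage_gen) auto
    then have "openin (cspace_top n) (U \<inter> g i -` ball (g i z) e)"
      using assms(1) unfolding cspace_top_def by (rule openin_trans)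
    moreover have "z \<in> U \<inter> g i -` ball (g i z) e"
      using assms by auto
    ultimately obtain r where "r > 0" "polydisc n z r \<subseteq> U \<inter> g i -` ball (g i z) e"
      unfolding openin_cspace_iff by blast
    then show ?thesis
      by (intro exI[of _ r]) (auto simp: dist_norm norm_minus_commute)
  qed
  then obtain r where r: "\<And>i. i < m \<Longrightarrow> r i > 0"
    "\<And>i y. i < m \<Longrightarrow> y \<in> polydisc n z (r i) \<Longrightarrow> cmod (g i y - g i z) < e" by metis
  obtain r0 where r0: "r0 > 0" "polydisc n z r0 \<subseteq> U"
    using assms openin_cspace_iff by blast
  define s where "s = Min (insert r0 (r ` {..<m}))"
  have s: "s > 0" "s \<le> r0" "\<And>i. i < m \<Longrightarrow> s \<le> r i"
    using r(1) r0 unfolding s_def by (auto simp: Min_le_iff)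
  have mono: "polydisc n z s \<subseteq> polydisc n z t" if "s \<le> t" for t
    using that by (force simp: polydisc_def)
  show ?thesis
  proof (intro exI[of _ s] conjI allI impI ballI)
    show "polydisc n z s \<subseteq> U"
      using mono[OF s(2)] r0 by blast
    show "cmod (g i y - g i z) < e" if "i < m" "y \<in> polydisc n z s" for i y
      using mono[OF s(3)[OF that(1)]] r that by blast
  qed (rule s)
qed


section \<open>Holomorphic functions of several variables\<close>

lemma holo_on_continuous: "holo_on n U f \<Longrightarrow> continuous_on U f"
  by (simp add: holo_on_def)

lemma holo_on_subset:
  assumes "holo_on n U f" "V \<subseteq> U"
  shows "holo_on n V f"
  unfolding holo_on_def
proof (intro conjI ballI allI impI)
  show "continuous_on V f"
    using assms continuous_on_subset holo_on_continuous by blast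
  fix z i assume "z \<in> V" "i < n"
  with assms have "(\<lambda>t. f (z(i := t))) holomorphic_on {t. z(i := t) \<in> U}"
    unfolding holo_on_def by blast
  then show "(\<lambda>t. f (z(i := t))) holomorphic_on {t. z(i := t) \<in> V}"
    by (rule holomorphic_on_subset) (use assms in auto)
qed

lemma holo_on_cong:
  assumes "holo_on n U f" "\<And>z. z \<in> U \<Longrightarrow> f z = g z"
  shows "holo_on n U g"
  unfolding holo_on_def
proof (intro conjI ballI allI impI)
  show "continuous_on U g"
    using holo_on_continuous[OF assms(1)] by (rule continuous_on_eq) (use assms(2) in auto)
  show "(\<lambda>t. g (z(i := t))) holomorphic_on {t. z(i := t) \<in> U}" if "z \<in> U" "i < n" for z i
  proof -
    have "(\<lambda>t. f (z(i := t))) holomorphic_on {t. z(i := t) \<in> U}"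
      using assms(1) that unfolding holo_on_def by blast
    then show ?thesis
      by (rule holomorphic_transform) (use assms(2) in auto)
  qed
qed

lemma holo_on_local:
  assumes "openin (cspace_top n) U"
    and "\<And>z. z \<in> U \<Longrightarrow> \<exists>V. openin (cspace_top n) V \<and> z \<in> V \<and> V \<subseteq> U \<and> holo_on n V f"
  shows "holo_on n U f"
  unfolding holo_on_def
proof (intro conjI ballI allI impI)
  show "continuous_on U f"
    unfolding continuous_on_eq_continuous_within
  proof
    fix z assume z: "z \<in> U"
    obtain V where V: "openin (cspace_top n) V" "z \<in> V" "V \<subseteq> U" "holo_on n V f"
      using assms(2)[OF z] by blast
    obtain O' where O: "open O'" "V = cspace n \<inter> O'"
      using V(1) unfolding cspace_top_def openin_open by blast
    have "at z within V = at z within U"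
      by (rule at_within_nhd[of z O']) (use O V openin_cspace_subset[OF assms(1)] in auto)
    moreover have "continuous (at z within V) f"
      using V holo_on_continuous continuous_on_eq_continuous_within by blast
    ultimately show "continuous (at z within U) f"
      by simp
  qed
next
  fix z i assume zi: "z \<in> U" "i < n"
  have zc: "z \<in> cspace n"
    using zi assms(1) openin_cspace_subset by blast
  have "\<exists>f'. ((\<lambda>t. f (z(i := t))) has_field_derivative f') (at t)" if t: "z(i := t) \<in> U" for t
  proof -
    obtain V where V: "openin (cspace_top n) V" "z(i := t) \<in> V" "V \<subseteq> U" "holo_on n V f"
      using assms(2)[OF t] by blast
    have "(\<lambda>s. f ((z(i := t))(i := s))) holomorphic_on {s. (z(i := t))(i := s) \<in> V}"
      using V zi unfolding holo_on_def by blast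
    moreover have "open {s. (z(i := t))(i := s) \<in> V}"
      using V zi zc by (intro open_slice) (auto intro: cspace_upd)
    ultimately show ?thesis
      using V by (simp add: holomorphic_on_open)
  qed
  moreover have "open {t. z(i := t) \<in> U}"
    using assms zi zc by (intro open_slice)
  ultimately show "(\<lambda>t. f (z(i := t))) holomorphic_on {t. z(i := t) \<in> U}"
    by (simp add: holomorphic_on_open)
qed


lemma holo_on_has_derivative:
  assumes "openin (cspace_top n) U" "holo_on n U f" "i < n" "z(i := t) \<in> U"
  shows "((\<lambda>s. f (z(i := s))) has_field_derivative pderiv_at i f (z(i := t))) (at t)"
proof -
  let ?y = "z(i := t)"
  have "(\<lambda>s. f (?y(i := s))) holomorphic_on {s. ?y(i := s) \<in> U}"
    using assms unfolding holo_on_def by blast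
  moreover have "open {s. ?y(i := s) \<in> U}"
    using assms openin_cspace_subset by (intro open_slice) auto
  ultimately have "((\<lambda>s. f (?y(i := s))) has_field_derivative deriv (\<lambda>s. f (?y(i := s))) t) (at t)"
    by (intro holomorphic_derivI[of _ "{s. ?y(i := s) \<in> U}"]) (use assms in auto)
  then show ?thesis
    by (simp add: pderiv_at_def)
qed

lemma pderiv_at_eqI:
  assumes "((\<lambda>s. f (z(i := s))) has_field_derivative d) (at (z i))"
  shows "pderiv_at i f z = d"
  unfolding pderiv_at_def using assms by (rule DERIV_imp_deriv)

lemma holo_on_slice_ball:
  assumes "openin (cspace_top n) U" "holo_on n U f" "i < n" "\<And>t. t \<in> S \<Longrightarrow> z(i := t) \<in> U"
  shows "(\<lambda>t. f (z(i := t))) holomorphic_on S"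
  unfolding holomorphic_on_def
proof
  fix t assume "t \<in> S"
  with holo_on_has_derivative[OF assms(1-3)] assms(4)
  show "(\<lambda>t. f (z(i := t))) field_differentiable at t within S"
    by (meson field_differentiable_at_within field_differentiable_def)
qed

lemma slice_in_polydisc:
  assumes "z \<in> polydisc n a r" "i < n" "cmod (t - z i) < s"
  shows "z(i := t) \<in> polydisc n a (r + s)"
proof -
  have "z(i := t) \<in> cspace n"
    using assms cspace_upd by (auto simp: polydisc_def)
  moreover have "cmod ((z(i := t)) l - a l) < r + s" if "l < n" for l
  proof (cases "l = i")
    case True
    have "cmod (t - a i) \<le> cmod (t - z i) + cmod (z i - a i)"
      using norm_triangle_ineq[of "t - z i" "z i - a i"] by simp
    moreover have "cmod (z i - a i) < r"
      using assms by (auto simp: polydisc_def)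
    ultimately show ?thesis using True assms by simp
  next
    case False
    have "0 < s"
      using assms(3) norm_ge_zero[of "t - z i"] by linarith
    moreover have "cmod (z l - a l) < r"
      using assms(1) that by (simp add: polydisc_def)
    ultimately show ?thesis
      using False by simp
  qed
  ultimately show ?thesis by (simp add: polydisc_def)
qed

lemma polydisc_mono: "r \<le> s \<Longrightarrow> polydisc n a r \<subseteq> polydisc n a s"
  by (force simp: polydisc_def)

text \<open>The factor 2 pays for applying Cauchy's inequality on the disc of half the radius, whose closure
  stays in the open polydisc where \<open>f\<close> is controlled.\<close>

lemma pderiv_bound:
  assumes U: "openin (cspace_top n) U" "holo_on n U f" and P: "polydisc n z r \<subseteq> U"
    and B: "\<And>y. y \<in> polydisc n z r \<Longrightarrow> cmod (f y) \<le> B"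
    and z: "z \<in> cspace n" and r: "r > 0" and i: "i < n"
  shows "cmod (pderiv_at i f z) \<le> 2 * B / r"
proof -
  have in_disc: "z(i := t) \<in> polydisc n z r" if "t \<in> cball (z i) (r/2)" for t
  proof -
    have "z(i := t) \<in> cspace n"
      using z i by (rule cspace_upd)
    moreover have "cmod (t - z i) < r"
      using that r by (simp add: dist_norm norm_minus_commute)
    ultimately show ?thesis
      using r by (simp add: polydisc_def)
  qed
  have hol: "(\<lambda>t. f (z(i := t))) holomorphic_on cball (z i) (r/2)"
    using in_disc P by (intro holo_on_slice_ball[OF U i]) blast
  have "cmod ((deriv ^^ 1) (\<lambda>t. f (z(i := t))) (z i)) \<le> fact 1 * B / (r/2) ^ 1"
  proof (rule Cauchy_inequality)
    show "(\<lambda>t. f (z(i := t))) holomorphic_on ball (z i) (r/2)"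
      using hol by (rule holomorphic_on_subset) auto
    show "continuous_on (cball (z i) (r/2)) (\<lambda>t. f (z(i := t)))"
      using hol by (rule holomorphic_on_imp_continuous_on)
    show "cmod (f (z(i := x))) \<le> B" if "cmod (z i - x) = r/2" for x
      using that by (intro B in_disc) (simp add: dist_norm)
  qed (use r in simp)
  then show ?thesis
    by (simp add: pderiv_at_def mult.commute)
qed

text \<open>A rate for the convergence of difference quotients that only depends on a bound for \<open>g\<close>, by Taylor's
  formula with Cauchy's estimate for the second derivative. It makes the convergence locally uniform in
  the remaining variables.\<close>

lemma difference_quotient_bound:
  fixes g :: "complex \<Rightarrow> complex"
  assumes g: "g holomorphic_on ball x r" and B: "\<And>y. y \<in> ball x r \<Longrightarrow> cmod (g y) \<le> B"
    and r: "r > 0" and h: "h \<noteq> 0" "cmod h \<le> r/4"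
  shows "cmod ((g (x + h) - g x) / h - deriv g x) \<le> 8 * B / r\<^sup>2 * cmod h"
proof -
  define F where "F = (\<lambda>i. (deriv ^^ i) g)"
  have "cmod (F 0 (x + h) - (\<Sum>i\<le>1. F i x * ((x + h) - x) ^ i / fact i))
      \<le> (8 * B / r\<^sup>2) * cmod ((x + h) - x) ^ Suc 1 / fact 1"
  proof (rule complex_Taylor[of "cball x (r/4)"])
    show "(F i has_field_derivative F (Suc i) y) (at y within cball x (r/4))"
      if "y \<in> cball x (r/4)" for i y
    proof -
      have "F i holomorphic_on ball x r"
        unfolding F_def using g by (intro holomorphic_higher_deriv) auto
      moreover have "y \<in> ball x r"
        using that r by auto
      ultimately have "(F i has_field_derivative deriv (F i) y) (at y)"
        using holomorphic_derivI[of "F i" "ball x r" y] by auto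
      then show ?thesis
        by (simp add: F_def has_field_derivative_at_within)
    qed
    show "cmod (F (Suc 1) y) \<le> 8 * B / r\<^sup>2" if y: "y \<in> cball x (r/4)" for y
    proof -
      have sub: "cball y (r/2) \<subseteq> ball x r"
        using y r by (subst cball_subset_ball_iff) (simp add: dist_commute)
      have "cmod ((deriv ^^ 2) g y) \<le> fact 2 * B / (r/2) ^ 2"
      proof (rule Cauchy_inequality)
        show "g holomorphic_on ball y (r/2)"
          using g by (rule holomorphic_on_subset) (use sub ball_subset_cball in blast)
        show "continuous_on (cball y (r/2)) g"
          using g sub holomorphic_on_imp_continuous_on continuous_on_subset by blast
        show "cmod (g u) \<le> B" if "cmod (y - u) = r/2" for u
          using that sub by (intro B) (auto simp: dist_norm subset_iff)
      qed (use r in simp)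
      then show ?thesis
        by (simp add: F_def power2_eq_square field_simps numeral_2_eq_2)
    qed
  qed (use h r in \<open>auto simp: dist_norm\<close>)
  then have *: "cmod (g (x + h) - g x - deriv g x * h) \<le> (8 * B / r\<^sup>2) * cmod h * cmod h"
    by (simp add: F_def power2_eq_square algebra_simps)
  have "(g (x + h) - g x) / h - deriv g x = (g (x + h) - g x - deriv g x * h) / h"
    using h by (simp add: field_simps)
  then have "cmod ((g (x + h) - g x) / h - deriv g x) = cmod (g (x + h) - g x - deriv g x * h) / cmod h"
    by (simp add: norm_divide)
  also have "\<dots> \<le> 8 * B / r\<^sup>2 * cmod h"
    using * h by (simp add: divide_le_eq)
  finally show ?thesis .
qed


lemma holo_on_locally_bounded:
  assumes "openin (cspace_top n) U" "holo_on n U f" "z \<in> U"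
  shows "\<exists>r>0. polydisc n z r \<subseteq> U \<and> (\<forall>y\<in>polydisc n z r. cmod (f y) \<le> cmod (f z) + 1)"
proof -
  obtain r where r: "r > 0" "polydisc n z r \<subseteq> U"
    "\<forall>y\<in>polydisc n z r. cmod (f y - f z) < 1"
    using continuous_near[OF assms(1,3), of 1 "\<lambda>_. f" 1] holo_on_continuous[OF assms(2)] by auto
  have "cmod (f y) \<le> cmod (f z) + 1" if "y \<in> polydisc n z r" for y
    using r(3) that norm_triangle_ineq[of "f y - f z" "f z"] by fastforce
  with r show ?thesis by blast
qed

lemma continuous_on_shift_coord:
  fixes h :: complex
  shows "continuous_on S (\<lambda>y. y(i := y i + h))"
proof (rule continuous_on_coordinatewise_then_product)
  show "continuous_on S (\<lambda>y. (y(i := y i + h)) j)" for j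
    using continuous_on_product_then_coordinatewise[OF continuous_on_id[of S], of j]
    by (cases "j = i") (simp_all add: continuous_on_add)
qed

text \<open>A partial derivative is locally the uniform limit of difference quotients, each of which is
  continuous and separately holomorphic.\<close>

lemma holo_on_pderiv:
  assumes U: "openin (cspace_top n) U" "holo_on n U f" and i: "i < n"
  shows "holo_on n U (pderiv_at i f)"
proof (rule holo_on_local[OF U(1)])
  fix z0 assume z0: "z0 \<in> U"
  obtain r0 where r0: "r0 > 0" "polydisc n z0 r0 \<subseteq> U"
    and B0: "\<And>y. y \<in> polydisc n z0 r0 \<Longrightarrow> cmod (f y) \<le> cmod (f z0) + 1"
    using holo_on_locally_bounded[OF U z0] by blast
  define r where "r = r0/2"
  define B where "B = cmod (f z0) + 1"
  define P where "P = polydisc n z0 r"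
  have r: "r > 0" "r + r = r0" using r0 by (auto simp: r_def)
  have PU: "P \<subseteq> U"
    unfolding P_def using r0(2) polydisc_mono[of r r0 n z0] r by (metis add_increasing2 less_imp_le order_refl subset_trans)
  define h where "h k = complex_of_real (r / 4 / real (Suc k))" for k
  have hnorm: "cmod (h k) = r / 4 / real (Suc k)" for k
    unfolding h_def norm_of_real using r(1) by simp
  have hle: "cmod (h k) \<le> r/4" for k
    unfolding hnorm using r(1) by (simp add: divide_le_eq mult_left_mono)
  have h0: "h k \<noteq> 0" for k
    using hnorm[of k] r(1) by (metis divide_eq_0_iff less_irrefl norm_zero of_nat_eq_0_iff nat.distinct(1) zero_neq_numeral)
  define q where "q k y = (f (y(i := y i + h k)) - f y) / h k" for k y
  have shift: "y(i := t) \<in> polydisc n z0 r0" if "y \<in> P" "cmod (t - y i) < r" for y t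
    using slice_in_polydisc[of y n z0 r i t r] that i r by (simp add: P_def)
  have shiftU: "y(i := t) \<in> U" if "y \<in> P" "cmod (t - y i) < r" for y t
    using shift[OF that] r0 by blast
  have hr: "cmod (h k) < r" for k
    using hle[of k] r by simp
  have est: "cmod (q k y - pderiv_at i f y) \<le> 8 * B / r\<^sup>2 * cmod (h k)" if y: "y \<in> P" for k y
  proof -
    have "cmod ((f (y(i := y i + h k)) - f (y(i := y i))) / h k - deriv (\<lambda>t. f (y(i := t))) (y i))
        \<le> 8 * B / r\<^sup>2 * cmod (h k)"
    proof (rule difference_quotient_bound[where g = "\<lambda>t. f (y(i := t))"])
      show "(\<lambda>t. f (y(i := t))) holomorphic_on ball (y i) r"
        using shiftU[OF y] by (intro holo_on_slice_ball[OF U i]) (auto simp: dist_norm norm_minus_commute)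
      show "cmod (f (y(i := t))) \<le> B" if "t \<in> ball (y i) r" for t
        unfolding B_def using that by (intro B0 shift[OF y]) (auto simp: dist_norm norm_minus_commute)
    qed (use r h0 hle in auto)
    then show ?thesis
      by (simp add: q_def pderiv_at_def)
  qed
  have lim: "uniform_limit P q (pderiv_at i f) sequentially"
  proof (rule uniform_limitI)
    fix e :: real assume e: "e > 0"
    have "(\<lambda>k. (8 * B / r\<^sup>2 * (r/4)) * inverse (real (Suc k))) \<longlonglongrightarrow> (8 * B / r\<^sup>2 * (r/4)) * 0"
      by (intro tendsto_mult_left LIMSEQ_inverse_real_of_nat)
    then have "(\<lambda>k. 8 * B / r\<^sup>2 * cmod (h k)) \<longlonglongrightarrow> 0"
      unfolding hnorm by (simp only: divide_inverse mult.assoc mult_zero_right)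
    then have "\<forall>\<^sub>F k in sequentially. 8 * B / r\<^sup>2 * cmod (h k) < e"
      using e by (rule order_tendstoD(2))
    then show "\<forall>\<^sub>F k in sequentially. \<forall>y\<in>P. dist (q k y) (pderiv_at i f y) < e"
    proof eventually_elim
      case (elim k)
      then show ?case
        unfolding dist_norm using est order_le_less_trans by blast
    qed
  qed
  have "holo_on n P (pderiv_at i f)"
    unfolding holo_on_def
  proof (intro conjI ballI allI impI)
    show "continuous_on P (pderiv_at i f)"
    proof (rule uniform_limit_theorem[OF _ lim])
      show "\<forall>\<^sub>F k in sequentially. continuous_on P (q k)"
      proof (intro always_eventually allI)
        fix k
        have "continuous_on P (\<lambda>y. f (y(i := y i + h k)))"
        proof (rule continuous_on_compose2[OF holo_on_continuous[OF U(2)] continuous_on_shift_coord])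
          show "(\<lambda>y. y(i := y i + h k)) ` P \<subseteq> U"
            using shiftU hr by auto
        qed
        moreover have "continuous_on P f"
          using PU U(2) continuous_on_subset holo_on_continuous by blast
        ultimately show "continuous_on P (q k)"
          unfolding q_def using h0 by (intro continuous_intros) auto
      qed
    qed simp
  next
    fix z l assume z: "z \<in> P" and l: "l < n"
    define S where "S = {t. z(l := t) \<in> P}"
    have opS: "open S"
      unfolding S_def P_def
      by (rule open_slice[OF openin_polydisc]) (use z l polydisc_subset_cspace in \<open>auto simp: P_def\<close>)
    have "(\<lambda>t. pderiv_at i f (z(l := t))) holomorphic_on S"
    proof (rule holomorphic_uniform_sequence[OF opS, where f = "\<lambda>k t. q k (z(l := t))"])
      show "(\<lambda>t. q k (z(l := t))) holomorphic_on S" for k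
      proof -
        have "(\<lambda>t. f ((z(l := t))(i := (z(l := t)) i + h k))) holomorphic_on S"
        proof (cases "l = i")
          case True
          have "(\<lambda>t. f (z(i := t))) \<circ> (\<lambda>t. t + h k) holomorphic_on S"
          proof (rule holomorphic_on_compose)
            show "(\<lambda>t. f (z(i := t))) holomorphic_on (\<lambda>t. t + h k) ` S"
            proof (rule holo_on_slice_ball[OF U i])
              fix t assume "t \<in> (\<lambda>t. t + h k) ` S"
              then obtain s where s: "t = s + h k" "z(i := s) \<in> P"
                using True by (auto simp: S_def)
              then show "z(i := t) \<in> U"
                using shiftU[OF s(2), of t] hr by simp
            qed
          qed (intro holomorphic_intros)
          with True show ?thesis by (simp add: comp_def)
        next
          case False
          have "(\<lambda>t. f ((z(i := z i + h k))(l := t))) holomorphic_on S"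
          proof (rule holo_on_slice_ball[OF U l])
            fix t assume "t \<in> S"
            then have "(z(l := t))(i := z i + h k) \<in> U"
              using shiftU[of "z(l := t)" "z i + h k"] False hr by (simp add: S_def)
            with False show "(z(i := z i + h k))(l := t) \<in> U"
              by (simp add: fun_upd_twist)
          qed
          with False show ?thesis
            by (simp add: fun_upd_twist)
        qed
        moreover have "(\<lambda>t. f (z(l := t))) holomorphic_on S"
          using PU by (intro holo_on_slice_ball[OF U l]) (auto simp: S_def)
        ultimately show ?thesis
          unfolding q_def by (intro holomorphic_intros) (use h0 in auto)
      qed
      fix x assume "x \<in> S"
      then obtain d where d: "d > 0" "cball x d \<subseteq> S"
        using opS open_contains_cball by blast
      have "uniform_limit (cball x d) (\<lambda>k t. q k (z(l := t))) (\<lambda>t. pderiv_at i f (z(l := t))) sequentially"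
      proof (rule uniform_limitI)
        fix e :: real assume "e > 0"
        from uniform_limitD[OF lim this]
        show "\<forall>\<^sub>F k in sequentially. \<forall>t\<in>cball x d. dist (q k (z(l := t))) (pderiv_at i f (z(l := t))) < e"
          by eventually_elim (use d in \<open>auto simp: S_def\<close>)
      qed
      with d show "\<exists>d>0. cball x d \<subseteq> S \<and>
          uniform_limit (cball x d) (\<lambda>k t. q k (z(l := t))) (\<lambda>t. pderiv_at i f (z(l := t))) sequentially"
        by blast
    qed
    then show "(\<lambda>t. pderiv_at i f (z(l := t))) holomorphic_on {t. z(l := t) \<in> P}"
      by (simp add: S_def)
  qed
  then show "\<exists>V. openin (cspace_top n) V \<and> z0 \<in> V \<and> V \<subseteq> U \<and> holo_on n V (pderiv_at i f)"
  proof (intro exI[of _ P] conjI)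
    show "openin (cspace_top n) P"
      unfolding P_def by (rule openin_polydisc)
    show "z0 \<in> P"
      unfolding P_def using z0 r(1) openin_cspace_subset[OF U(1)] by (intro centre_in_polydisc) auto
  qed (rule PU)
qed

text \<open>Changing one coordinate at a time reduces the several variable mean value inequality to the one
  variable one. With \<open>l = 0\<close> this is a Lipschitz bound, with \<open>l\<close> the gradient at a point it is
  strong differentiability there.\<close>

lemma polydisc_mean_value:
  assumes D: "\<And>y i. y \<in> polydisc n a r \<Longrightarrow> i < n \<Longrightarrow>
      ((\<lambda>t. f (y(i := t))) has_field_derivative D i y) (at (y i))"
    and bnd: "\<And>y i. y \<in> polydisc n a r \<Longrightarrow> i < n \<Longrightarrow> cmod (D i y - l i) \<le> e"
    and z: "z \<in> polydisc n a r" and w: "w \<in> polydisc n a r"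
  shows "cmod (f z - f w - (\<Sum>i<n. l i * (z i - w i))) \<le> e * (\<Sum>i<n. cmod (z i - w i))"
proof -
  define mix where "mix m = (\<lambda>i. if i < m then z i else w i)" for m :: nat
  have mixP: "mix m \<in> polydisc n a r" for m
    using z w by (auto simp: polydisc_def cspace_def mix_def)
  have "m \<le> n \<Longrightarrow> cmod (f (mix m) - f w - (\<Sum>i<m. l i * (z i - w i))) \<le> e * (\<Sum>i<m. cmod (z i - w i))"
    for m
  proof (induction m)
    case 0
    then show ?case by (simp add: mix_def)
  next
    case (Suc m)
    then have m: "m < n" by simp
    define \<phi> where "\<phi> t = f ((mix m)(m := t)) - l m * t" for t
    have upd: "(mix m)(m := t) \<in> polydisc n a r" if "t \<in> ball (a m) r" for t
      using that mixP[of m] m by (auto simp: polydisc_def cspace_def dist_norm norm_minus_commute)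
    have "cmod (\<phi> (z m) - \<phi> (w m)) \<le> e * cmod (z m - w m)"
    proof (rule field_differentiable_bound[of "ball (a m) r"])
      fix t assume t: "t \<in> ball (a m) r"
      have "((\<lambda>s. f ((mix m)(m := s))) has_field_derivative D m ((mix m)(m := t))) (at t)"
        using D[OF upd[OF t] m] by simp
      then have "((\<lambda>s. f ((mix m)(m := s)) - l m * s) has_field_derivative
          (D m ((mix m)(m := t)) - l m * 1)) (at t)"
        by (intro DERIV_diff DERIV_cmult DERIV_ident)
      then show "(\<phi> has_field_derivative (D m ((mix m)(m := t)) - l m)) (at t within ball (a m) r)"
        unfolding \<phi>_def mult_1_right by (rule has_field_derivative_at_within)
      show "cmod (D m ((mix m)(m := t)) - l m) \<le> e"
        using bnd[OF upd[OF t] m] .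
    qed (use z w m in \<open>auto simp: polydisc_def dist_norm norm_minus_commute\<close>)
    moreover have "(mix m)(m := z m) = mix (Suc m)" "(mix m)(m := w m) = mix m"
      by (auto simp: mix_def fun_eq_iff less_Suc_eq)
    ultimately have step: "cmod (f (mix (Suc m)) - f (mix m) - l m * (z m - w m)) \<le> e * cmod (z m - w m)"
      by (simp add: \<phi>_def algebra_simps)
    have "f (mix (Suc m)) - f w - (\<Sum>i<Suc m. l i * (z i - w i)) =
        (f (mix (Suc m)) - f (mix m) - l m * (z m - w m)) + (f (mix m) - f w - (\<Sum>i<m. l i * (z i - w i)))"
      by simp
    also have "cmod \<dots> \<le> e * cmod (z m - w m) + e * (\<Sum>i<m. cmod (z i - w i))"
      using step Suc by (intro norm_triangle_le add_mono) auto
    finally show ?case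
      by (simp add: algebra_simps)
  qed
  from this[of n] have "cmod (f (mix n) - f w - (\<Sum>i<n. l i * (z i - w i))) \<le> e * (\<Sum>i<n. cmod (z i - w i))"
    by simp
  moreover have "mix n = z"
    using z w by (auto simp: mix_def polydisc_def cspace_def fun_eq_iff)
  ultimately show ?thesis by simp
qed

lemma holo_on_mean_value:
  assumes U: "openin (cspace_top n) U" "holo_on n U f" and P: "polydisc n a r \<subseteq> U"
    and bnd: "\<And>y i. y \<in> polydisc n a r \<Longrightarrow> i < n \<Longrightarrow> cmod (pderiv_at i f y - l i) \<le> e"
    and zw: "z \<in> polydisc n a r" "w \<in> polydisc n a r"
  shows "cmod (f z - f w - (\<Sum>i<n. l i * (z i - w i))) \<le> e * (\<Sum>i<n. cmod (z i - w i))"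
proof (rule polydisc_mean_value[OF _ bnd zw])
  fix y i assume "y \<in> polydisc n a r" "i < n"
  then show "((\<lambda>t. f (y(i := t))) has_field_derivative pderiv_at i f y) (at (y i))"
    using holo_on_has_derivative[OF U, of i y "y i"] P by auto
qed

text \<open>The chain rule along a curve. The partial derivatives are continuous, hence close to their
  values at the base point, so \<open>f\<close> is differentiable there in the strong sense.\<close>

lemma holo_on_chain:
  assumes U: "openin (cspace_top n) U" "holo_on n U f" and ct: "c t0 \<in> U"
    and cs: "\<forall>\<^sub>F t in at t0. c t \<in> cspace n"
    and D: "\<And>i. i < n \<Longrightarrow> ((\<lambda>t. c t i) has_field_derivative c' i) (at t0)"
  shows "((\<lambda>t. f (c t)) has_field_derivative (\<Sum>i<n. pderiv_at i f (c t0) * c' i)) (at t0)"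
proof -
  define l where "l i = pderiv_at i f (c t0)" for i
  define Q where "Q i t = (c t i - c t0 i) / (t - t0)" for i t
  define E where "E t = (f (c t) - f (c t0)) / (t - t0) - (\<Sum>i<n. l i * Q i t)" for t
  have Q: "(Q i \<longlongrightarrow> c' i) (at t0)" if "i < n" for i
    using D[OF that] unfolding Q_def has_field_derivative_iff .
  have "(E \<longlongrightarrow> 0) (at t0)"
  proof (rule tendstoI)
    fix e :: real assume e: "e > 0"
    define K where "K = (\<Sum>i<n. cmod (c' i)) + 1"
    have K: "K > 0" using sum_nonneg[of "{..<n}" "\<lambda>i. cmod (c' i)"] by (simp add: K_def)
    obtain r where r: "r > 0" "polydisc n (c t0) r \<subseteq> U"
      "\<forall>i<n. \<forall>y\<in>polydisc n (c t0) r. cmod (pderiv_at i f y - pderiv_at i f (c t0)) < e / K"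
      using continuous_near[OF U(1) ct, of n "\<lambda>i. pderiv_at i f" "e/K"] e K
        holo_on_continuous[OF holo_on_pderiv[OF U]] by auto
    have "\<forall>\<^sub>F t in at t0. \<forall>i\<in>{..<n}. cmod (c t i - c t0 i) < r"
    proof (rule eventually_ball_finite)
      show "\<forall>i\<in>{..<n}. \<forall>\<^sub>F t in at t0. cmod (c t i - c t0 i) < r"
      proof
        fix i assume "i \<in> {..<n}"
        then have "((\<lambda>t. c t i) \<longlongrightarrow> c t0 i) (at t0)"
          using D DERIV_isCont isCont_def by blast
        then show "\<forall>\<^sub>F t in at t0. cmod (c t i - c t0 i) < r"
          using r(1) by (auto dest: tendstoD simp: dist_norm)
      qed
    qed simp
    moreover have "((\<lambda>t. \<Sum>i<n. cmod (Q i t)) \<longlongrightarrow> (\<Sum>i<n. cmod (c' i))) (at t0)"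
      by (intro tendsto_intros Q) auto
    then have "\<forall>\<^sub>F t in at t0. (\<Sum>i<n. cmod (Q i t)) < K"
      by (rule order_tendstoD) (simp add: K_def)
    moreover have "\<forall>\<^sub>F t in at t0. t \<noteq> t0"
      by (simp add: eventually_at_filter)
    ultimately show "\<forall>\<^sub>F t in at t0. dist (E t) 0 < e"
      using cs
    proof eventually_elim
      case (elim t)
      have P: "c t \<in> polydisc n (c t0) r" "c t0 \<in> polydisc n (c t0) r"
        using elim ct r openin_cspace_subset[OF U(1)] by (auto simp: polydisc_def)
      have "cmod (f (c t) - f (c t0) - (\<Sum>i<n. l i * (c t i - c t0 i)))
          \<le> e / K * (\<Sum>i<n. cmod (c t i - c t0 i))"
        unfolding l_def by (rule holo_on_mean_value[OF U r(2) _ P]) (use r(3) less_imp_le in blast)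
      moreover have "E t = (f (c t) - f (c t0) - (\<Sum>i<n. l i * (c t i - c t0 i))) / (t - t0)"
      proof -
        have "(\<Sum>i<n. l i * Q i t) = (\<Sum>i<n. l i * (c t i - c t0 i)) / (t - t0)"
          by (simp add: Q_def sum_divide_distrib)
        then show ?thesis
          by (simp only: E_def diff_divide_distrib)
      qed
      ultimately have "cmod (E t) \<le> e / K * (\<Sum>i<n. cmod (c t i - c t0 i)) / cmod (t - t0)"
        unfolding norm_divide by (metis (no_types, lifting) divide_right_mono norm_divide norm_ge_zero)
      also have "\<dots> = e / K * (\<Sum>i<n. cmod (Q i t))"
        unfolding Q_def norm_divide sum_divide_distrib[symmetric] by simp
      also have "\<dots> < e / K * K"
        using elim e K by (intro mult_strict_left_mono) auto
      also have "\<dots> = e" using K by simp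
      finally show ?case by simp
    qed
  qed
  moreover have "((\<lambda>t. \<Sum>i<n. l i * Q i t) \<longlongrightarrow> (\<Sum>i<n. l i * c' i)) (at t0)"
    by (intro tendsto_intros Q) auto
  ultimately have "((\<lambda>t. E t + (\<Sum>i<n. l i * Q i t)) \<longlongrightarrow> 0 + (\<Sum>i<n. l i * c' i)) (at t0)"
    by (rule tendsto_add)
  then show ?thesis
    by (simp add: has_field_derivative_iff E_def l_def)
qed

lemma holo_on_compose:
  assumes U: "openin (cspace_top n) U" "holo_on n U f" and V: "openin (cspace_top m) V"
    and g: "\<And>l. l < n \<Longrightarrow> holo_on m V (\<lambda>z. g z l)" and gU: "\<And>z. z \<in> V \<Longrightarrow> g z \<in> U"
  shows "holo_on m V (\<lambda>z. f (g z))"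
  unfolding holo_on_def
proof (intro conjI ballI allI impI)
  have gc: "g z \<in> cspace n" if "z \<in> V" for z
    using gU[OF that] openin_cspace_subset[OF U(1)] by blast
  have "continuous_on V g"
  proof (rule continuous_on_coordinatewise_then_product)
    fix l
    show "continuous_on V (\<lambda>z. g z l)"
    proof (cases "l < n")
      case True
      then show ?thesis using g holo_on_continuous by blast
    next
      case False
      then show ?thesis
        using gc by (intro continuous_on_eq[OF continuous_on_const[of V 0]]) (auto simp: cspace_def)
    qed
  qed
  then show "continuous_on V (\<lambda>z. f (g z))"
    by (rule continuous_on_compose2[OF holo_on_continuous[OF U(2)]]) (use gU in blast)
  fix z i assume z: "z \<in> V" and i: "i < m"
  define S where "S = {t. z(i := t) \<in> V}"
  have opS: "open S"
    unfolding S_def using V z i openin_cspace_subset by (intro open_slice) auto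
  have "\<exists>d. ((\<lambda>t. f (g (z(i := t)))) has_field_derivative d) (at t)" if t: "t \<in> S" for t
  proof (rule exI, rule holo_on_chain[OF U])
    show "g (z(i := t)) \<in> U"
      using gU t by (simp add: S_def)
    have "\<forall>\<^sub>F s in at t. s \<in> S"
      using opS t unfolding eventually_at_topological by blast
    then show "\<forall>\<^sub>F s in at t. g (z(i := s)) \<in> cspace n"
      by eventually_elim (use gc in \<open>auto simp: S_def\<close>)
    show "((\<lambda>s. g (z(i := s)) l) has_field_derivative pderiv_at i (\<lambda>z. g z l) (z(i := t))) (at t)"
      if "l < n" for l
      using holo_on_has_derivative[OF V g[OF that] i] t by (simp add: S_def)
  qed
  then show "(\<lambda>t. f (g (z(i := t)))) holomorphic_on {t. z(i := t) \<in> V}"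
    using opS holomorphic_on_open by (auto simp: S_def)
qed

lemma pderiv_compose:
  assumes U: "openin (cspace_top n) U" "holo_on n U f" and V: "openin (cspace_top m) V"
    and g: "\<And>l. l < n \<Longrightarrow> holo_on m V (\<lambda>z. g z l)" and gU: "\<And>z. z \<in> V \<Longrightarrow> g z \<in> U"
    and z: "z \<in> V" and i: "i < m"
  shows "pderiv_at i (\<lambda>z. f (g z)) z = (\<Sum>l<n. pderiv_at l f (g z) * pderiv_at i (\<lambda>z. g z l) z)"
proof (rule pderiv_at_eqI)
  have opS: "open {t. z(i := t) \<in> V}"
    using V z i openin_cspace_subset by (intro open_slice) auto
  have "((\<lambda>t. f (g (z(i := t)))) has_field_derivative
      (\<Sum>l<n. pderiv_at l f (g (z(i := z i))) * pderiv_at i (\<lambda>z. g z l) z)) (at (z i))"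
  proof (rule holo_on_chain[OF U])
    show "g (z(i := z i)) \<in> U"
      using gU z by simp
    have "\<forall>\<^sub>F s in at (z i). s \<in> {t. z(i := t) \<in> V}"
      unfolding eventually_at_topological by (intro exI[of _ "{t. z(i := t) \<in> V}"]) (simp add: opS z)
    then show "\<forall>\<^sub>F s in at (z i). g (z(i := s)) \<in> cspace n"
      by eventually_elim (use gU openin_cspace_subset[OF U(1)] in auto)
    show "((\<lambda>s. g (z(i := s)) l) has_field_derivative pderiv_at i (\<lambda>z. g z l) z) (at (z i))"
      if "l < n" for l
      using holo_on_has_derivative[OF V g[OF that] i, of z "z i"] z by simp
  qed
  then show "((\<lambda>t. f (g (z(i := t)))) has_field_derivative
      (\<Sum>l<n. pderiv_at l f (g z) * pderiv_at i (\<lambda>z. g z l) z)) (at (z i))"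
    by simp
qed

lemma holo_on_const: "holo_on n U (\<lambda>z. c)"
  by (simp add: holo_on_def)

lemma holo_on_coord: "holo_on n U (\<lambda>z. z j)"
  unfolding holo_on_def
proof (intro conjI ballI allI impI)
  show "continuous_on U (\<lambda>z. z j)"
    by (rule continuous_on_product_then_coordinatewise) (rule continuous_on_id)
  show "(\<lambda>t. (z(i := t)) j) holomorphic_on {t. z(i := t) \<in> U}" for z i
    by (cases "j = i") (auto intro: holomorphic_intros)
qed

lemma holo_on_add: "holo_on n U f \<Longrightarrow> holo_on n U g \<Longrightarrow> holo_on n U (\<lambda>z. f z + g z)"
  unfolding holo_on_def by (auto intro!: continuous_intros holomorphic_intros)

lemma holo_on_diff: "holo_on n U f \<Longrightarrow> holo_on n U g \<Longrightarrow> holo_on n U (\<lambda>z. f z - g z)"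
  unfolding holo_on_def by (auto intro!: continuous_intros holomorphic_intros)

lemma holo_on_mult: "holo_on n U f \<Longrightarrow> holo_on n U g \<Longrightarrow> holo_on n U (\<lambda>z. f z * g z)"
  unfolding holo_on_def by (auto intro!: continuous_intros holomorphic_intros)

lemma holo_on_divide:
  "holo_on n U f \<Longrightarrow> holo_on n U g \<Longrightarrow> (\<And>z. z \<in> U \<Longrightarrow> g z \<noteq> 0) \<Longrightarrow> holo_on n U (\<lambda>z. f z / g z)"
  unfolding holo_on_def by (auto intro!: continuous_intros holomorphic_intros)

lemma holo_on_sum: "(\<And>i. i \<in> I \<Longrightarrow> holo_on n U (f i)) \<Longrightarrow> holo_on n U (\<lambda>z. \<Sum>i\<in>I. f i z)"
  unfolding holo_on_def by (auto intro!: continuous_intros holomorphic_intros)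

lemma holo_on_prod: "(\<And>i. i \<in> I \<Longrightarrow> holo_on n U (f i)) \<Longrightarrow> holo_on n U (\<lambda>z. \<Prod>i\<in>I. f i z)"
  unfolding holo_on_def by (auto intro!: continuous_intros holomorphic_intros)

lemmas holo_on_intros = holo_on_const holo_on_coord holo_on_add holo_on_diff holo_on_mult
  holo_on_divide holo_on_sum holo_on_prod

lemma holo_on_compose_one_variable:
  assumes g: "g holomorphic_on S" and f: "holo_on n U f" and fS: "\<And>z. z \<in> U \<Longrightarrow> f z \<in> S"
  shows "holo_on n U (\<lambda>z. g (f z))"
  unfolding holo_on_def
proof (intro conjI ballI allI impI)
  show "continuous_on U (\<lambda>z. g (f z))"
    by (rule continuous_on_compose2[OF holomorphic_on_imp_continuous_on[OF g] holo_on_continuous[OF f]])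
      (use fS in blast)
  fix z i assume "z \<in> U" "i < n"
  with f have "(\<lambda>t. f (z(i := t))) holomorphic_on {t. z(i := t) \<in> U}"
    unfolding holo_on_def by blast
  then have "g \<circ> (\<lambda>t. f (z(i := t))) holomorphic_on {t. z(i := t) \<in> U}"
    by (rule holomorphic_on_compose_gen[OF _ g]) (use fS in auto)
  then show "(\<lambda>t. g (f (z(i := t)))) holomorphic_on {t. z(i := t) \<in> U}"
    by (simp add: comp_def)
qed

text \<open>On the hyperplane \<open>w\<^sub>j = 0\<close>, where \<open>f\<close> vanishes, continuity of the quotient is the strong
  differentiability of \<open>f\<close>. Along the \<open>j\<close>-th axis the singularity is then removable, and along the other axes
  the quotient is either regular or a partial derivative of \<open>f\<close>.\<close>

lemma holo_on_division:
  assumes U: "openin (cspace_top n) U" "holo_on n U f" and j: "j < n"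
    and zero: "\<And>w. w \<in> U \<Longrightarrow> w j = 0 \<Longrightarrow> f w = 0"
  shows "holo_on n U (\<lambda>w. if w j = 0 then pderiv_at j f w else f w / w j)" (is "holo_on n U ?h")
proof -
  have pd: "holo_on n U (pderiv_at j f)"
    by (rule holo_on_pderiv[OF U j])
  have opC: "openin (cspace_top n) {w \<in> U. w j \<noteq> 0}"
  proof -
    have "openin (top_of_set U) (U \<inter> (\<lambda>w. w j) -` (- {0}))"
      using holo_on_continuous[OF holo_on_coord] by (intro continuous_openin_preimage_gen) auto
    moreover have "U \<inter> (\<lambda>w. w j) -` (- {0}) = {w \<in> U. w j \<noteq> 0}" by auto
    ultimately show ?thesis
      using U(1) openin_trans unfolding cspace_top_def by metis
  qed
  have cont: "continuous_on U ?h"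
    unfolding continuous_on_def
  proof
    fix w0 assume w0: "w0 \<in> U"
    show "(?h \<longlongrightarrow> ?h w0) (at w0 within U)"
    proof (cases "w0 j = 0")
      case True
      show ?thesis
      proof (rule tendstoI)
        fix e :: real assume e: "e > 0"
        obtain r where r: "r > 0" "polydisc n w0 r \<subseteq> U"
          "\<forall>i<n. \<forall>y\<in>polydisc n w0 r. cmod (pderiv_at i f y - pderiv_at i f w0) < e/2"
          using continuous_near[OF U(1) w0, of n "\<lambda>i. pderiv_at i f" "e/2"] e
            holo_on_continuous[OF holo_on_pderiv[OF U]] by auto
        have est: "dist (?h w) (?h w0) < e" if w: "w \<in> polydisc n w0 r" for w
        proof (cases "w j = 0")
          case True
          have "cmod (pderiv_at j f w - pderiv_at j f w0) < e/2"
            using r w j by blast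
          with True \<open>w0 j = 0\<close> e show ?thesis
            by (simp add: dist_norm)
        next
          case False
          define w' where "w' = w(j := 0)"
          have w': "w' \<in> polydisc n w0 r"
            using w j r \<open>w0 j = 0\<close> by (auto simp: w'_def polydisc_def cspace_def)
          have "f w' = 0"
            using zero[of w'] w' r by (auto simp: w'_def)
          have s1: "(\<Sum>i<n. pderiv_at i f w0 * (w i - w' i)) = pderiv_at j f w0 * w j"
            by (subst sum.remove[of _ j]) (use j in \<open>auto simp: w'_def\<close>)
          have s2: "(\<Sum>i<n. cmod (w i - w' i)) = cmod (w j)"
            by (subst sum.remove[of _ j]) (use j in \<open>auto simp: w'_def\<close>)
          have "cmod (f w - f w' - (\<Sum>i<n. pderiv_at i f w0 * (w i - w' i)))
              \<le> e/2 * (\<Sum>i<n. cmod (w i - w' i))"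
            by (rule holo_on_mean_value[OF U r(2) _ w w']) (use r(3) less_imp_le in blast)
          then have "cmod (f w - pderiv_at j f w0 * w j) \<le> e/2 * cmod (w j)"
            by (simp only: s1 s2 \<open>f w' = 0\<close> diff_zero)
          moreover have "f w / w j - pderiv_at j f w0 = (f w - pderiv_at j f w0 * w j) / w j"
            using False by (simp add: field_simps)
          ultimately have "cmod (f w / w j - pderiv_at j f w0) \<le> e/2"
            using False by (simp add: norm_divide divide_le_eq)
          with False \<open>w0 j = 0\<close> e show ?thesis
            by (simp add: dist_norm)
        qed
        obtain O' where O: "open O'" "polydisc n w0 r = cspace n \<inter> O'"
          using openin_polydisc[of n w0 r] unfolding cspace_top_def openin_open by blast
        have "w0 \<in> O'"
          using O centre_in_polydisc[of w0 n r] r w0 openin_cspace_subset[OF U(1)] by blast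
        then have "\<forall>\<^sub>F w in at w0 within U. w \<in> O' \<and> w \<in> U"
          using O(1) by (auto simp: eventually_at_topological)
        then show "\<forall>\<^sub>F w in at w0 within U. dist (?h w) (?h w0) < e"
          by eventually_elim (use est O openin_cspace_subset[OF U(1)] in blast)
      qed
    next
      case False
      have "continuous_on {w \<in> U. w j \<noteq> 0} (\<lambda>w. f w / w j)"
        by (intro continuous_on_divide continuous_on_subset[OF holo_on_continuous[OF U(2)]]
            holo_on_continuous[OF holo_on_coord]) auto
      then have "continuous_on {w \<in> U. w j \<noteq> 0} ?h"
        by (rule continuous_on_eq) auto
      then have "(?h \<longlongrightarrow> ?h w0) (at w0 within {w \<in> U. w j \<noteq> 0})"
        using w0 False unfolding continuous_on_def by blast
      moreover have "at w0 within {w \<in> U. w j \<noteq> 0} = at w0 within U"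
      proof -
        obtain O' where O: "open O'" "{w \<in> U. w j \<noteq> 0} = cspace n \<inter> O'"
          using opC unfolding cspace_top_def openin_open by blast
        show ?thesis
          by (rule at_within_nhd[of w0 O']) (use O w0 False openin_cspace_subset[OF U(1)] in auto)
      qed
      ultimately show ?thesis by simp
    qed
  qed
  show ?thesis
    unfolding holo_on_def
  proof (intro conjI ballI allI impI)
    show "continuous_on U ?h" by (rule cont)
    fix z i assume z: "z \<in> U" and i: "i < n"
    define S where "S = {t. z(i := t) \<in> U}"
    have opS: "open S"
      unfolding S_def using U z i openin_cspace_subset by (intro open_slice) auto
    have fS: "(\<lambda>t. f (z(i := t))) holomorphic_on S"
      by (rule holo_on_slice_ball[OF U i]) (simp add: S_def)
    have "(\<lambda>t. ?h (z(i := t))) holomorphic_on S"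
    proof (cases "i = j")
      case True
      show ?thesis
      proof (rule no_isolated_singularity[OF _ _ opS, where K = "{0}"])
        show "continuous_on S (\<lambda>t. ?h (z(i := t)))"
          by (rule continuous_on_compose2[OF cont continuous_on_upd]) (auto simp: S_def)
        have "(\<lambda>t. f (z(i := t)) / t) holomorphic_on S - {0}"
          using fS by (intro holomorphic_intros holomorphic_on_subset[OF fS]) auto
        then show "(\<lambda>t. ?h (z(i := t))) holomorphic_on S - {0}"
          by (rule holomorphic_transform) (use True in auto)
      qed simp
    next
      case False
      show ?thesis
      proof (cases "z j = 0")
        case True
        have "(\<lambda>t. pderiv_at j f (z(i := t))) holomorphic_on S"
          by (rule holo_on_slice_ball[OF U(1) pd i]) (simp add: S_def)
        then show ?thesis
          by (rule holomorphic_transform) (use True False in auto)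
      next
        case zj: False
        have "(\<lambda>t. f (z(i := t)) / z j) holomorphic_on S"
          using zj by (intro holomorphic_intros fS) auto
        then show ?thesis
          by (rule holomorphic_transform) (use zj False in auto)
      qed
    qed
    then show "(\<lambda>t. ?h (z(i := t))) holomorphic_on {t. z(i := t) \<in> U}"
      by (simp only: S_def)
  qed
qed


section \<open>Jacobian determinants\<close>

lemma det_mat_sum:
  "det (Matrix.mat n n f :: complex mat) =
     (\<Sum>p\<in>{p. p permutes {0..<n}}. signof p * (\<Prod>i=0..<n. f (i, p i)))"
proof -
  have "p i < n" if "p permutes {0..<n}" "i < n" for p i
    using permutes_in_image[OF that(1), of i] that(2) by simp
  then show ?thesis
    unfolding det_def by (auto intro!: sum.cong prod.cong)
qed

lemma norm_det_le:
  fixes f :: "nat \<times> nat \<Rightarrow> complex"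
  assumes "\<And>i j. i < n \<Longrightarrow> j < n \<Longrightarrow> cmod (f (i, j)) \<le> M"
  shows "cmod (det (Matrix.mat n n f)) \<le> fact n * M ^ n"
proof -
  have "cmod (signof p * (\<Prod>i=0..<n. f (i, p i))) \<le> M ^ n" if p: "p permutes {0..<n}" for p
  proof -
    have "cmod (signof p) = 1"
      by (simp add: sign_def)
    moreover have "cmod (f (i, p i)) \<le> M" if "i < n" for i
      using permutes_in_image[OF p, of i] that by (intro assms) auto
    then have "(\<Prod>i=0..<n. cmod (f (i, p i))) \<le> (\<Prod>i=0..<n. M)"
      by (intro prod_mono) auto
    ultimately show ?thesis
      by (simp add: norm_mult prod_norm[symmetric])
  qed
  then have "cmod (det (Matrix.mat n n f)) \<le> (\<Sum>p\<in>{p. p permutes {0..<n}}. M ^ n)"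
    unfolding det_mat_sum by (intro sum_norm_le) auto
  also have "\<dots> = fact n * M ^ n"
    using card_permutations[of "{0..<n}" n] by simp
  finally show ?thesis .
qed

lemma holo_on_det_jacobian:
  assumes U: "openin (cspace_top n) U" and F: "\<And>i. i < n \<Longrightarrow> holo_on n U (\<lambda>z. F z i)"
  shows "holo_on n U (\<lambda>z. det (jacobian n F z))"
  unfolding jacobian_def det_mat_sum prod.case
proof (intro holo_on_sum holo_on_mult holo_on_const holo_on_prod)
  fix p i assume "p \<in> {p. p permutes {0..<n}}" "i \<in> {0..<n}"
  then show "holo_on n U (pderiv_at (p i) (\<lambda>w. F w i))"
    using permutes_in_image[of p "{0..<n}" i] by (intro holo_on_pderiv U F) auto
qed

lemma det_jacobian_compose:
  assumes U: "openin (cspace_top n) U" and g: "\<And>i. i < n \<Longrightarrow> holo_on n U (\<lambda>z. g z i)"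
    and V: "openin (cspace_top n) V" and F: "\<And>i. i < n \<Longrightarrow> holo_on n V (\<lambda>z. F z i)"
    and FU: "\<And>z. z \<in> V \<Longrightarrow> F z \<in> U" and z: "z \<in> V"
  shows "det (jacobian n (\<lambda>z. g (F z)) z) = det (jacobian n g (F z)) * det (jacobian n F z)"
proof -
  have "jacobian n (\<lambda>z. g (F z)) z = jacobian n g (F z) * jacobian n F z"
  proof (rule eq_matI)
    fix j i assume "j < dim_row (jacobian n g (F z) * jacobian n F z)"
      "i < dim_col (jacobian n g (F z) * jacobian n F z)"
    then have ij: "j < n" "i < n" by (simp_all add: jacobian_def)
    then have "jacobian n (\<lambda>z. g (F z)) z $$ (j, i) =
        (\<Sum>l<n. pderiv_at l (\<lambda>w. g w j) (F z) * pderiv_at i (\<lambda>w. F w l) z)"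
      using pderiv_compose[OF U g V F FU z] by (simp add: jacobian_def)
    also have "\<dots> = (jacobian n g (F z) * jacobian n F z) $$ (j, i)"
      using ij by (simp add: jacobian_def scalar_prod_def atLeast0LessThan)
    finally show "jacobian n (\<lambda>z. g (F z)) z $$ (j, i) = (jacobian n g (F z) * jacobian n F z) $$ (j, i)" .
  qed (simp_all add: jacobian_def)
  then show ?thesis
    using det_mult[of "jacobian n g (F z)" n "jacobian n F z"] by (simp add: jacobian_def)
qed

lemma det_nonzero_rows_independent:
  fixes M :: "nat \<Rightarrow> nat \<Rightarrow> complex"
  assumes det: "det (Matrix.mat n n (\<lambda>(j, i). M j i)) \<noteq> 0"
    and zero: "\<And>i. i < n \<Longrightarrow> (\<Sum>j<n. \<xi> j * M j i) = 0" and j: "j < n"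
  shows "\<xi> j = 0"
proof -
  let ?B = "Matrix.mat n n (\<lambda>(i, j). M j i)"
  have "?B = transpose_mat (Matrix.mat n n (\<lambda>(j, i). M j i))"
    by (rule eq_matI) auto
  then have "det ?B \<noteq> 0"
    using det det_transpose[of "Matrix.mat n n (\<lambda>(j, i). M j i)" n] by simp
  moreover have "?B *\<^sub>v vec n \<xi> = 0\<^sub>v n"
  proof (rule eq_vecI)
    fix i assume "i < dim_vec (0\<^sub>v n :: complex vec)"
    then show "(?B *\<^sub>v vec n \<xi>) $ i = 0\<^sub>v n $ i"
      using zero[of i] by (simp add: scalar_prod_def mult.commute atLeast0LessThan)
  qed simp
  moreover have "vec n \<xi> \<in> carrier_vec n" by (rule vec_carrier)
  ultimately have "vec n \<xi> = 0\<^sub>v n"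
    using det_0_iff_vec_prod_zero_field[OF mat_carrier] by blast
  then show ?thesis
    using j by (metis index_vec index_zero_vec(1))
qed

lemma det_nonzero_columns_independent:
  fixes M :: "nat \<Rightarrow> nat \<Rightarrow> complex"
  assumes ind: "\<And>\<xi>. (\<And>j. j < n \<Longrightarrow> (\<Sum>i<n. M j i * \<xi> i) = 0) \<Longrightarrow> \<forall>i<n. \<xi> i = 0"
  shows "det (Matrix.mat n n (\<lambda>(j, i). M j i)) \<noteq> 0"
proof
  let ?B = "Matrix.mat n n (\<lambda>(j, i). M j i)"
  assume "det ?B = 0"
  then obtain v where v: "v \<in> carrier_vec n" "v \<noteq> 0\<^sub>v n" "?B *\<^sub>v v = 0\<^sub>v n"
    using det_0_iff_vec_prod_zero_field[of ?B n] by auto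
  have "(\<Sum>i<n. M j i * v $ i) = 0" if "j < n" for j
  proof -
    have "(?B *\<^sub>v v) $ j = 0" using v(3) that by simp
    then show ?thesis
      using that v(1) by (simp add: scalar_prod_def atLeast0LessThan)
  qed
  then have "\<forall>i<n. v $ i = 0" by (rule ind)
  with v(1,2) show False by (auto intro: eq_vecI)
qed

lemma pderiv_at_cong:
  assumes U: "openin (cspace_top n) U" and z: "z \<in> U" and i: "i < n"
    and eq: "\<And>w. w \<in> U \<Longrightarrow> f w = g w"
  shows "pderiv_at i f z = pderiv_at i g z"
proof -
  have "open {t. z(i := t) \<in> U}"
    using U z i openin_cspace_subset by (intro open_slice) auto
  then have "\<forall>\<^sub>F t in nhds (z i). t \<in> {t. z(i := t) \<in> U}"
    by (rule eventually_nhds_in_open) (use z in simp)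
  then have "\<forall>\<^sub>F t in nhds (z i). f (z(i := t)) = g (z(i := t))"
    by eventually_elim (use eq in blast)
  then show ?thesis
    unfolding pderiv_at_def by (intro deriv_cong_ev) auto
qed

lemma jacobian_cong:
  assumes "openin (cspace_top n) U" "z \<in> U" "\<And>w j. w \<in> U \<Longrightarrow> j < n \<Longrightarrow> F w j = G w j"
  shows "jacobian n F z = jacobian n G z"
  unfolding jacobian_def
  by (rule eq_matI) (use assms in \<open>auto intro: pderiv_at_cong\<close>)


section \<open>Manifolds given by an atlas\<close>

text \<open>The manifold axioms apart from the separation and countability of the topology. They already
  determine the local structure, and both topological axioms are derived from charts.\<close>

definition holo_atlas :: "nat \<Rightarrow> 'a chart set \<Rightarrow> bool" where
  "holo_atlas n Y \<longleftrightarrow>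
     (\<forall>(U, \<phi>)\<in>Y. inj_on \<phi> U \<and> openin (cspace_top n) (\<phi> ` U)) \<and>
     (\<forall>(U, \<phi>)\<in>Y. \<forall>(V, \<psi>)\<in>Y. openin (cspace_top n) (\<phi> ` (U \<inter> V)) \<and>
        (\<forall>i. holo_on n (\<phi> ` (U \<inter> V)) (\<lambda>w. \<psi> (inv_into U \<phi> w) i)))"

lemma holo_atlasD:
  assumes "holo_atlas n Y" "(U, \<phi>) \<in> Y"
  shows "inj_on \<phi> U" "openin (cspace_top n) (\<phi> ` U)"
    and "(V, \<psi>) \<in> Y \<Longrightarrow> openin (cspace_top n) (\<phi> ` (U \<inter> V))"
    and "(V, \<psi>) \<in> Y \<Longrightarrow> holo_on n (\<phi> ` (U \<inter> V)) (\<lambda>w. \<psi> (inv_into U \<phi> w) i)"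
  using assms unfolding holo_atlas_def by fast+

lemma topspace_mfd_top: "topspace (mfd_top Y) = (\<Union>(U, \<phi>)\<in>Y. U)"
  unfolding mfd_top_def topology_generated_by_topspace by blast

lemma openin_chart_vimage:
  assumes "(U, \<phi>) \<in> Y" "open W"
  shows "openin (mfd_top Y) {p \<in> U. \<phi> p \<in> W}"
  unfolding mfd_top_def openin_topology_generated_by_iff
  using assms by (intro generate_topology_on.Basis) blast

lemma openin_chart_vimage_cspace:
  assumes "(U, \<phi>) \<in> Y" "\<phi> ` U \<subseteq> cspace n" "openin (cspace_top n) W"
  shows "openin (mfd_top Y) {p \<in> U. \<phi> p \<in> W}"
proof -
  obtain O' where O: "open O'" "W = cspace n \<inter> O'"
    using assms(3) unfolding cspace_top_def openin_open by blast
  then have "{p \<in> U. \<phi> p \<in> W} = {p \<in> U. \<phi> p \<in> O'}"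
    using assms(2) by blast
  with openin_chart_vimage[OF assms(1) O(1)] show ?thesis by simp
qed

lemma openin_chart_domain:
  assumes "(U, \<phi>) \<in> Y"
  shows "openin (mfd_top Y) U"
  using openin_chart_vimage[OF assms open_UNIV] by simp

lemma continuous_on_components:
  assumes "\<And>i. i < n \<Longrightarrow> continuous_on S (\<lambda>z. g z i)" "\<And>z. z \<in> S \<Longrightarrow> g z \<in> cspace n"
  shows "continuous_on S g"
proof (rule continuous_on_coordinatewise_then_product)
  fix i
  show "continuous_on S (\<lambda>z. g z i)"
  proof (cases "i < n")
    case False
    then show ?thesis
      by (intro continuous_on_eq[OF continuous_on_const[of S 0]]) (use assms(2) in \<open>auto simp: cspace_def\<close>)
  qed (rule assms(1))
qed

lemma openin_preimage_cspace:
  assumes U: "openin (cspace_top m) U" and g: "\<And>i. i < n \<Longrightarrow> holo_on m U (\<lambda>z. g z i)"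
    and gc: "\<And>z. z \<in> U \<Longrightarrow> g z \<in> cspace n" and V: "openin (cspace_top n) V"
  shows "openin (cspace_top m) {z \<in> U. g z \<in> V}"
proof -
  obtain O' where O: "open O'" "V = cspace n \<inter> O'"
    using V unfolding cspace_top_def openin_open by blast
  have "continuous_on U g"
    by (rule continuous_on_components[OF holo_on_continuous[OF g] gc])
  then have "openin (top_of_set U) (U \<inter> g -` O')"
    using O(1) by (rule continuous_openin_preimage_gen)
  moreover have "U \<inter> g -` O' = {z \<in> U. g z \<in> V}"
    using O gc by blast
  ultimately show ?thesis
    using U openin_trans unfolding cspace_top_def by metis
qed

lemma openin_nonzero:
  assumes U: "openin (cspace_top n) U" and f: "holo_on n U f"
  shows "openin (cspace_top n) {z \<in> U. f z \<noteq> 0}"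
proof -
  have "openin (top_of_set U) (U \<inter> f -` (- {0}))"
    using holo_on_continuous[OF f] by (intro continuous_openin_preimage_gen) auto
  moreover have "U \<inter> f -` (- {0}) = {z \<in> U. f z \<noteq> 0}" by auto
  ultimately show ?thesis
    using U openin_trans unfolding cspace_top_def by metis
qed

text \<open>Compatibility makes each coordinate map open for the topology generated by all charts, so that
  it is a homeomorphism onto its image.\<close>

lemma openin_chart_image:
  assumes Y: "holo_atlas n Y" and G: "openin (mfd_top Y) G" and U: "(U, \<phi>) \<in> Y"
  shows "openin (cspace_top n) (\<phi> ` (U \<inter> G))"
proof -
  note inj = holo_atlasD(1)[OF Y U]
  have "generate_topology_on {{p \<in> U. \<phi> p \<in> W} | U \<phi> W. (U, \<phi>) \<in> Y \<and> open W} G"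
    using G unfolding mfd_top_def openin_topology_generated_by_iff .
  then show ?thesis
  proof induction
    case Empty
    show ?case by simp
  next
    case (Int a b)
    have "\<phi> ` (U \<inter> (a \<inter> b)) = \<phi> ` (U \<inter> a) \<inter> \<phi> ` (U \<inter> b)"
      using inj by (auto simp: inj_on_def)
    with Int show ?case by auto
  next
    case (UN K)
    have "\<phi> ` (U \<inter> \<Union>K) = (\<Union>k\<in>K. \<phi> ` (U \<inter> k))" by blast
    with UN show ?case by auto
  next
    case (Basis s)
    then obtain V \<psi> W where s: "s = {p \<in> V. \<psi> p \<in> W}" "(V, \<psi>) \<in> Y" "open W" by blast
    let ?R = "\<phi> ` (U \<inter> V)"
    let ?g = "\<lambda>w. \<psi> (inv_into U \<phi> w)"
    have op: "openin (cspace_top n) ?R"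
      by (rule holo_atlasD(3)[OF Y U s(2)])
    have "continuous_on ?R ?g"
      by (rule continuous_on_coordinatewise_then_product)
        (rule holo_on_continuous[OF holo_atlasD(4)[OF Y U s(2)]])
    then have "openin (top_of_set ?R) (?R \<inter> ?g -` W)"
      using s(3) by (rule continuous_openin_preimage_gen)
    then have "openin (cspace_top n) (?R \<inter> ?g -` W)"
      using op openin_trans unfolding cspace_top_def by metis
    moreover have "?R \<inter> ?g -` W = \<phi> ` (U \<inter> s)"
      using inj s(1) by (auto simp: inv_into_f_f)
    ultimately show ?case by simp
  qed
qed

text \<open>A countable base of \<open>\<complex>\<^sup>n\<close> pulled back along countably many charts is a base because the coordinate
  maps are open.\<close>

lemma second_countable_mfd_top:
  assumes Y: "holo_atlas n Y" and Y0: "Y0 \<subseteq> Y" "countable Y0"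
    and cover: "topspace (mfd_top Y) \<subseteq> (\<Union>(U, \<phi>)\<in>Y0. U)"
  shows "second_countable (mfd_top Y)"
proof -
  obtain \<B> :: "(nat \<Rightarrow> complex) set set" where B: "countable \<B>" "topological_basis \<B>"
    using ex_countable_basis by blast
  define \<C> where "\<C> = (\<lambda>((U, \<phi>), W). {p \<in> U. \<phi> p \<in> W}) ` (Y0 \<times> \<B>)"
  show ?thesis
    unfolding second_countable_def
  proof (intro exI[of _ \<C>] conjI ballI allI impI)
    show "countable \<C>"
      unfolding \<C>_def using Y0 B by (intro countable_image countable_SIGMA) auto
    show "openin (mfd_top Y) V" if "V \<in> \<C>" for V
    proof -
      obtain U \<phi> W where "V = {p \<in> U. \<phi> p \<in> W}" "(U, \<phi>) \<in> Y0" "W \<in> \<B>"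
        using \<open>V \<in> \<C>\<close> by (auto simp: \<C>_def)
      then show ?thesis
        using openin_chart_vimage Y0 topological_basis_open[OF B(2)] by blast
    qed
    fix G x assume G: "openin (mfd_top Y) G \<and> x \<in> G"
    then have "x \<in> topspace (mfd_top Y)"
      using openin_subset by blast
    then obtain U \<phi> where U: "(U, \<phi>) \<in> Y0" "x \<in> U"
      using cover by auto
    then have UY: "(U, \<phi>) \<in> Y" using Y0 by blast
    obtain O' where O: "open O'" "\<phi> ` (U \<inter> G) = cspace n \<inter> O'"
      using openin_chart_image[OF Y conjunct1[OF G] UY] unfolding cspace_top_def openin_open by blast
    have "\<phi> x \<in> O'" using O U G by blast
    then obtain W where W: "W \<in> \<B>" "\<phi> x \<in> W" "W \<subseteq> O'"
      using topological_basisE[OF B(2) O(1)] by metis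
    have "{p \<in> U. \<phi> p \<in> W} \<subseteq> G"
    proof clarify
      fix p assume p: "p \<in> U" "\<phi> p \<in> W"
      have "\<phi> p \<in> cspace n"
        using openin_cspace_subset[OF holo_atlasD(2)[OF Y UY]] p(1) by blast
      then have "\<phi> p \<in> \<phi> ` (U \<inter> G)"
        using O(2) W(3) p(2) by blast
      then obtain p' where "p' \<in> U" "p' \<in> G" "\<phi> p = \<phi> p'" by blast
      then show "p \<in> G"
        using holo_atlasD(1)[OF Y UY] p(1) by (metis inj_onD)
    qed
    moreover have "{p \<in> U. \<phi> p \<in> W} \<in> \<C>"
      unfolding \<C>_def by (rule image_eqI[where x = "((U, \<phi>), W)"])
        (simp only: case_prod_conv, rule SigmaI[OF U(1) W(1)])
    moreover have "x \<in> {p \<in> U. \<phi> p \<in> W}"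
      by (intro CollectI conjI U(2) W(2))
    ultimately show "\<exists>V\<in>\<C>. x \<in> V \<and> V \<subseteq> G"
      by (intro bexI[of _ "{p \<in> U. \<phi> p \<in> W}"] conjI)
  qed
qed


section \<open>Local coordinates and their differentials\<close>

lemma line_in_open:
  assumes U: "openin (cspace_top n) U" and a: "a \<in> U" and v: "v \<in> cspace n"
  shows "\<exists>r>0. \<forall>t. cmod t < r \<longrightarrow> (\<lambda>i. a i + t * v i) \<in> U"
proof -
  obtain r where r: "r > 0" "polydisc n a r \<subseteq> U"
    using U a openin_cspace_iff by blast
  define K where "K = (\<Sum>i<n. cmod (v i)) + 1"
  have K: "K > 0" "\<And>i. i < n \<Longrightarrow> cmod (v i) < K"
    using sum_nonneg[of "{..<n}" "\<lambda>i. cmod (v i)"] member_le_sum[of _ "{..<n}" "\<lambda>i. cmod (v i)"]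
    by (force simp: K_def)+
  show ?thesis
  proof (intro exI[of _ "r/K"] conjI allI impI)
    fix t :: complex assume t: "cmod t < r/K"
    have "cmod (t * v i) < r" if "i < n" for i
    proof -
      have "cmod (t * v i) \<le> cmod t * K"
        unfolding norm_mult using K(2)[OF that] by (intro mult_left_mono) auto
      also have "\<dots> < r"
        using t K by (simp add: less_divide_eq)
      finally show ?thesis .
    qed
    then have "(\<lambda>i. a i + t * v i) \<in> polydisc n a r"
      using line_in_cspace[OF _ v] a openin_cspace_subset[OF U] by (auto simp: polydisc_def)
    with r show "(\<lambda>i. a i + t * v i) \<in> U" by blast
  qed (use r K in simp)
qed

lemma DERIV_line: "((\<lambda>t. a + t * v) has_field_derivative (v :: complex)) (at t0)"
  by (auto intro!: derivative_eq_intros)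

lemma differential_line:
  assumes U: "openin (cspace_top n) U" "holo_on n U f" and a: "a \<in> U" and v: "v \<in> cspace n"
  shows "((\<lambda>t. f (\<lambda>i. a i + t * v i)) has_field_derivative differential n f a v) (at 0)"
proof -
  have "((\<lambda>t. f (\<lambda>i. a i + t * v i)) has_field_derivative
      (\<Sum>i<n. pderiv_at i f (\<lambda>i. a i + 0 * v i) * v i)) (at 0)"
  proof (rule holo_on_chain[OF U])
    show "(\<lambda>i. a i + 0 * v i) \<in> U" using a by simp
    show "\<forall>\<^sub>F t in at 0. (\<lambda>i. a i + t * v i) \<in> cspace n"
      using line_in_cspace[OF _ v] a openin_cspace_subset[OF U(1)] by (intro always_eventually) blast
    show "((\<lambda>t. a i + t * v i) has_field_derivative v i) (at 0)" for i
      by (rule DERIV_line)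
  qed
  then show ?thesis
    by (simp add: differential_def)
qed

lemma differential_linear:
  "differential n f a (\<lambda>i. s i + c * v i) = differential n f a s + c * differential n f a v"
  by (simp add: differential_def algebra_simps sum.distrib sum_distrib_left)

lemma differential_compose_curve:
  assumes U: "openin (cspace_top n) U" "holo_on n U f" and c: "c 0 \<in> U"
    and cs: "\<forall>\<^sub>F t in at 0. c t \<in> cspace n"
    and D: "\<And>i. i < n \<Longrightarrow> ((\<lambda>t. c t i) has_field_derivative v i) (at 0)"
  shows "((\<lambda>t. f (c t)) has_field_derivative differential n f (c 0) v) (at 0)"
  using holo_on_chain[OF U c cs D] by (simp add: differential_def)

text \<open>The chain rule for \<open>\<theta> \<circ> \<phi> = id\<close> along a line. Used for \<open>\<phi>\<close> and its inverse in both orders, it makes the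
  differentials of coordinates bijective.\<close>

lemma differential_left_inverse:
  assumes U: "openin (cspace_top n) U" and V: "openin (cspace_top n) V"
    and p: "\<And>i. holo_on n U (\<lambda>z. \<phi> z i)" and pV: "\<And>z. z \<in> U \<Longrightarrow> \<phi> z \<in> V"
    and q: "\<And>i. holo_on n V (\<lambda>z. \<theta> z i)" and inv: "\<And>z. z \<in> U \<Longrightarrow> \<theta> (\<phi> z) = z"
    and a: "a \<in> U" and v: "v \<in> cspace n"
  shows "differential n (\<lambda>w. \<theta> w l) (\<phi> a) (\<lambda>i. differential n (\<lambda>z. \<phi> z i) a v) = v l"
proof -
  define c where "c t = (\<lambda>i. a i + t * v i)" for t
  obtain r where r: "r > 0" "\<And>t. cmod t < r \<Longrightarrow> c t \<in> U"
    using line_in_open[OF U a v] unfolding c_def by blast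
  have c0: "c 0 = a" by (simp add: c_def)
  have "((\<lambda>t. \<theta> (\<phi> (c t)) l) has_field_derivative
      differential n (\<lambda>w. \<theta> w l) (\<phi> (c 0)) (\<lambda>i. differential n (\<lambda>z. \<phi> z i) a v)) (at 0)"
  proof (rule differential_compose_curve[OF V q])
    show "\<phi> (c 0) \<in> V" using pV a c0 by simp
    have "\<forall>\<^sub>F t in at 0. cmod t < r"
      using r(1) unfolding eventually_at by (intro exI[of _ r]) auto
    then show "\<forall>\<^sub>F t in at 0. \<phi> (c t) \<in> cspace n"
      by eventually_elim (use r pV openin_cspace_subset[OF V] in blast)
    show "((\<lambda>t. \<phi> (c t) i) has_field_derivative differential n (\<lambda>z. \<phi> z i) a v) (at 0)" for i
      unfolding c_def by (rule differential_line[OF U p a v])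
  qed
  moreover have "((\<lambda>t. \<theta> (\<phi> (c t)) l) has_field_derivative v l) (at 0)"
  proof (rule has_field_derivative_transform_within_open[where S = "ball 0 r"])
    show "((\<lambda>t. c t l) has_field_derivative v l) (at 0)"
      unfolding c_def by (rule DERIV_line)
    show "c t l = \<theta> (\<phi> (c t)) l" if "t \<in> ball 0 r" for t
      using that inv r(2)[of t] by simp
  qed (use r in auto)
  ultimately show ?thesis
    using DERIV_unique c0 by metis
qed

locale adapted_chart =
  fixes n :: nat and A :: "(nat \<Rightarrow> complex) set" and k :: nat
    and U :: "(nat \<Rightarrow> complex) set" and \<phi> :: "(nat \<Rightarrow> complex) \<Rightarrow> nat \<Rightarrow> complex"
  assumes adapted: "adapted n A k U \<phi>" and A_sub: "A \<subseteq> cspace n"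
begin

abbreviation "\<theta> \<equiv> inv_into U \<phi>"

abbreviation d :: "nat \<Rightarrow> (nat \<Rightarrow> complex) \<Rightarrow> (nat \<Rightarrow> complex) \<Rightarrow> complex" where
  "d i \<equiv> differential n (\<lambda>z. \<phi> z i)"

lemma U_open: "openin (cspace_top n) U" and image_open: "openin (cspace_top n) (\<phi> ` U)"
  and coord_inj: "inj_on \<phi> U" and coord_holo: "holo_on n U (\<lambda>z. \<phi> z i)"
  and inv_holo: "holo_on n (\<phi> ` U) (\<lambda>w. \<theta> w i)" and k_le: "k \<le> n"
  using adapted unfolding adapted_def local_coordinates_def by blast+

lemma A_iff: "z \<in> U \<Longrightarrow> z \<in> A \<longleftrightarrow> (\<forall>i<k. \<phi> z i = 0)"
  using adapted unfolding adapted_def by blast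

lemma U_sub: "U \<subseteq> cspace n"
  using U_open openin_cspace_subset by blast

lemma image_sub: "\<phi> ` U \<subseteq> cspace n"
  using image_open openin_cspace_subset by blast

lemma coord_in: "z \<in> U \<Longrightarrow> \<phi> z \<in> cspace n"
  using image_sub by blast

lemma inv_coord: "z \<in> U \<Longrightarrow> \<theta> (\<phi> z) = z"
  using coord_inj by (rule inv_into_f_f)

lemma coord_inv: "w \<in> \<phi> ` U \<Longrightarrow> \<phi> (\<theta> w) = w"
  by (rule f_inv_into_f[of w \<phi> U])

lemma inv_in: "w \<in> \<phi> ` U \<Longrightarrow> \<theta> w \<in> U"
  by (rule inv_into_into[of w \<phi> U])

text \<open>The inverse of the differential of \<open>\<phi>\<close> at \<open>a\<close>.\<close>

definition lift :: "(nat \<Rightarrow> complex) \<Rightarrow> (nat \<Rightarrow> complex) \<Rightarrow> nat \<Rightarrow> complex" where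
  "lift a u = (\<lambda>l. if l < n then differential n (\<lambda>w. \<theta> w l) (\<phi> a) u else 0)"

lemma lift_in: "lift a u \<in> cspace n"
  by (simp add: lift_def cspace_def)

lemma differential_lift_eq:
  "differential n f a (\<lambda>l. differential n (\<lambda>w. \<theta> w l) (\<phi> b) u) = differential n f a (lift b u)"
  by (simp add: differential_def lift_def)

lemma d_lift:
  assumes "a \<in> U" "u \<in> cspace n"
  shows "d i a (lift a u) = u i"
proof -
  have "differential n (\<lambda>z. \<phi> z i) (\<theta> (\<phi> a)) (\<lambda>l. differential n (\<lambda>w. \<theta> w l) (\<phi> a) u) = u i"
    by (rule differential_left_inverse[OF image_open U_open inv_holo inv_in coord_holo coord_inv])
      (use assms in auto)
  then show ?thesis
    using assms by (simp add: inv_coord differential_lift_eq)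
qed

lemma lift_d:
  assumes "a \<in> U" "v \<in> cspace n" "u \<in> cspace n" "\<And>i. i < n \<Longrightarrow> u i = d i a v"
  shows "lift a u = v"
proof (rule cspace_eqI[OF lift_in assms(2)])
  fix l assume l: "l < n"
  have "differential n (\<lambda>w. \<theta> w l) (\<phi> a) u = differential n (\<lambda>w. \<theta> w l) (\<phi> a) (\<lambda>i. d i a v)"
    unfolding differential_def using assms(4) by (simp add: differential_def)
  also have "\<dots> = v l"
    by (rule differential_left_inverse[OF U_open image_open coord_holo _ inv_holo inv_coord])
      (use assms in auto)
  finally show "lift a u l = v l"
    using l by (simp add: lift_def)
qed

text \<open>The disc stays in \<open>A\<close> when \<open>u\<^sub>i = 0\<close> for \<open>i < k\<close>, so it realises the lift of such a \<open>u\<close> as a tangent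
  vector.\<close>

lemma lift_disc:
  assumes a: "a \<in> U" and u: "u \<in> cspace n"
  shows "\<exists>r>0. (\<forall>t. cmod t < r \<longrightarrow> (\<lambda>i. \<phi> a i + t * u i) \<in> \<phi> ` U) \<and>
     (\<forall>l. (\<lambda>t. \<theta> (\<lambda>i. \<phi> a i + t * u i) l) holomorphic_on ball 0 r) \<and>
     (\<forall>l. ((\<lambda>t. \<theta> (\<lambda>i. \<phi> a i + t * u i) l) has_field_derivative lift a u l) (at 0))"
proof -
  define c where "c t = (\<lambda>i. \<phi> a i + t * u i)" for t
  obtain r where r: "r > 0" "\<And>t. cmod t < r \<Longrightarrow> c t \<in> \<phi> ` U"
    using line_in_open[OF image_open _ u, of "\<phi> a"] a unfolding c_def by blast
  have hol: "(\<lambda>t. \<theta> (c t) l) holomorphic_on ball 0 r" for l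
  proof -
    have "((\<lambda>t. \<theta> (c t) l) has_field_derivative (\<Sum>i<n. pderiv_at i (\<lambda>w. \<theta> w l) (c t) * u i)) (at t)"
      if t: "t \<in> ball 0 r" for t
    proof (rule holo_on_chain[OF image_open inv_holo])
      show "c t \<in> \<phi> ` U" using r t by simp
      show "\<forall>\<^sub>F s in at t. c s \<in> cspace n"
        unfolding c_def using line_in_cspace[OF coord_in[OF a] u] by (intro always_eventually) blast
      show "((\<lambda>s. c s i) has_field_derivative u i) (at t)" for i
        unfolding c_def by (rule DERIV_line)
    qed
    then show ?thesis
      using holomorphic_on_open by blast
  qed
  have der: "((\<lambda>t. \<theta> (c t) l) has_field_derivative lift a u l) (at 0)" for l
  proof (cases "l < n")
    case True
    then show ?thesis
      unfolding lift_def c_def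
      using differential_line[OF image_open inv_holo imageI[OF a] u, of l] by simp
  next
    case False
    show ?thesis
    proof (rule has_field_derivative_transform_within_open[where S = "ball 0 r"])
      show "((\<lambda>t. 0) has_field_derivative lift a u l) (at 0)"
        using False by (simp add: lift_def)
      show "0 = \<theta> (c t) l" if "t \<in> ball 0 r" for t
        using inv_in[OF r(2)[of t]] that U_sub False by (force simp: cspace_def)
    qed (use r in auto)
  qed
  show ?thesis
    using r hol der unfolding c_def by blast
qed

text \<open>Along a disc in \<open>A\<close> the first \<open>k\<close> coordinates vanish, hence so do their derivatives; conversely a vector
  killed by these differentials is the velocity of the disc in \<open>lift_disc\<close>. In particular the set of
  velocities is a linear subspace.\<close>

lemma tangent_space_eq:
  assumes a: "a \<in> A" "a \<in> U"
  shows "tangent_space A a = {v \<in> cspace n. \<forall>i<k. d i a v = 0}"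
proof (intro subset_antisym subsetI)
  fix v assume "v \<in> tangent_space A a"
  then obtain r c where r: "r > 0" and c: "\<And>i. (\<lambda>t. c t i) holomorphic_on ball 0 r"
    "c ` ball 0 r \<subseteq> A" "c 0 = a" "\<And>i. deriv (\<lambda>t. c t i) 0 = v i"
    unfolding tangent_space_def by blast
  have der: "((\<lambda>t. c t i) has_field_derivative v i) (at 0)" for i
    using holomorphic_derivI[OF c(1), of 0 i] r c(4) by simp
  have vc: "v \<in> cspace n"
    unfolding cspace_def
  proof (intro CollectI allI impI)
    fix i assume i: "n \<le> i"
    have "((\<lambda>t. c t i) has_field_derivative 0) (at 0)"
    proof (rule has_field_derivative_transform_within_open[where S = "ball 0 r"])
      show "0 = c t i" if "t \<in> ball 0 r" for t
        using c(2) A_sub that i by (force simp: cspace_def)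
    qed (use r in auto)
    with der show "v i = 0" by (rule DERIV_unique)
  qed
  have ev: "\<forall>\<^sub>F t in at 0. c t \<in> A"
    unfolding eventually_at using r c(2) by (intro exI[of _ r]) (auto simp: image_subset_iff)
  have "(c \<longlongrightarrow> a) (at 0)"
    unfolding tendsto_fun_iff using der DERIV_isCont c(3) by (metis isCont_def)
  obtain O' where O: "open O'" "U = cspace n \<inter> O'"
    using U_open unfolding cspace_top_def openin_open by blast
  have evO: "\<forall>\<^sub>F t in at 0. c t \<in> O'"
    using \<open>(c \<longlongrightarrow> a) (at 0)\<close> O a by (intro topological_tendstoD) auto
  have "d i a v = 0" if i: "i < k" for i
  proof -
    have "((\<lambda>t. \<phi> (c t) i) has_field_derivative d i (c 0) v) (at 0)"
    proof (rule differential_compose_curve[OF U_open coord_holo])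
      show "\<forall>\<^sub>F t in at 0. c t \<in> cspace n"
        using ev by eventually_elim (use A_sub in blast)
    qed (use a c der in auto)
    moreover have "((\<lambda>t. \<phi> (c t) i) has_field_derivative 0) (at 0)"
    proof -
      have "\<forall>\<^sub>F t in at 0. \<phi> (c t) i = 0"
        using ev evO by eventually_elim (use A_iff O A_sub i in blast)
      then have "\<forall>\<^sub>F t in nhds 0. \<phi> (c t) i = 0"
        using A_iff[OF a(2)] a(1) c(3) i by (simp add: eventually_nhds_conv_at)
      then show ?thesis
        by (subst DERIV_cong_ev[where g = "\<lambda>_. 0"]) auto
    qed
    ultimately show ?thesis
      using DERIV_unique c(3) by metis
  qed
  with vc show "v \<in> {v \<in> cspace n. \<forall>i<k. d i a v = 0}" by blast
next
  fix v assume v: "v \<in> {v \<in> cspace n. \<forall>i<k. d i a v = 0}"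
  define u where "u = (\<lambda>i. if i < n then d i a v else 0)"
  have u: "u \<in> cspace n" by (simp add: u_def cspace_def)
  have lu: "lift a u = v"
    using v u a by (intro lift_d) (auto simp: u_def)
  obtain r where r: "r > 0" and cin: "\<And>t. cmod t < r \<Longrightarrow> (\<lambda>i. \<phi> a i + t * u i) \<in> \<phi> ` U"
    and hol: "\<And>l. (\<lambda>t. \<theta> (\<lambda>i. \<phi> a i + t * u i) l) holomorphic_on ball 0 r"
    and der: "\<And>l. ((\<lambda>t. \<theta> (\<lambda>i. \<phi> a i + t * u i) l) has_field_derivative lift a u l) (at 0)"
    using lift_disc[OF a(2) u] by blast
  show "v \<in> tangent_space A a"
    unfolding tangent_space_def
  proof (intro CollectI exI conjI allI)
    show "r > 0" by (rule r)
    show "(\<lambda>t. \<theta> (\<lambda>i. \<phi> a i + t * u i) l) holomorphic_on ball 0 r" for l by (rule hol)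
    show "(\<lambda>t. \<theta> (\<lambda>i. \<phi> a i + t * u i)) ` ball 0 r \<subseteq> A"
    proof clarify
      fix t :: complex assume t: "t \<in> ball 0 r"
      have "\<phi> a i + t * u i = 0" if "i < k" for i
        using A_iff[OF a(2)] a(1) that v k_le by (simp add: u_def)
      then show "\<theta> (\<lambda>i. \<phi> a i + t * u i) \<in> A"
        using t cin[of t] by (subst A_iff[OF inv_in]) (simp_all add: coord_inv)
    qed
    show "\<theta> (\<lambda>i. \<phi> a i + 0 * u i) = a"
      using inv_coord[OF a(2)] by simp
    show "deriv (\<lambda>t. \<theta> (\<lambda>i. \<phi> a i + t * u i) l) 0 = v l" for l
      using der[of l] lu by (simp add: DERIV_imp_deriv)
  qed
qed

text \<open>Tangent vectors form a subspace, so any other vector of the line can replace its given generator. This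
  makes the blow-up coordinates independent of the vector chosen in their definition.\<close>

lemma normal_line_generated:
  assumes a: "a \<in> A" "a \<in> U" and L: "L \<in> normal_lines n A a"
    and v: "v \<in> L" "j < k" "d j a v \<noteq> 0"
  shows "L = {(\<lambda>i. s i + c * v i) | s c. s \<in> tangent_space A a}" "v \<in> cspace n"
proof -
  let ?T = "tangent_space A a"
  note T = tangent_space_eq[OF a]
  have sub: "(\<lambda>i. s i + c * s' i) \<in> ?T" if "s \<in> ?T" "s' \<in> ?T" for s s' c
    using that unfolding T by (auto simp: differential_linear line_in_cspace)
  obtain v0 where v0: "v0 \<in> cspace n" "L = {(\<lambda>i. s i + c * v0 i) | s c. s \<in> ?T}"
    using L unfolding normal_lines_def by blast
  then obtain s0 c0 where s0: "s0 \<in> ?T" "v = (\<lambda>i. s0 i + c0 * v0 i)"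
    using v(1) by blast
  show "v \<in> cspace n"
    using s0 v0 unfolding T by (simp add: line_in_cspace)
  have c0: "c0 \<noteq> 0"
    using s0 v(2,3) unfolding T by auto
  show "L = {(\<lambda>i. s i + c * v i) | s c. s \<in> ?T}"
  proof (intro subset_antisym subsetI)
    fix x assume "x \<in> L"
    then obtain s c where s: "s \<in> ?T" "x = (\<lambda>i. s i + c * v0 i)"
      using v0 by blast
    then have "x = (\<lambda>i. (s i + (- c / c0) * s0 i) + (c / c0) * v i)"
      using s0(2) c0 by (simp add: fun_eq_iff field_simps)
    then show "x \<in> {(\<lambda>i. s i + c * v i) | s c. s \<in> ?T}"
      using sub[OF s(1) s0(1), of "- c / c0"]
      by (intro CollectI exI[of _ "\<lambda>i. s i + (- c / c0) * s0 i"] exI[of _ "c / c0"] conjI)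
  next
    fix x assume "x \<in> {(\<lambda>i. s i + c * v i) | s c. s \<in> ?T}"
    then obtain s c where s: "s \<in> ?T" "x = (\<lambda>i. s i + c * v i)"
      by blast
    then have "x = (\<lambda>i. (s i + c * s0 i) + (c * c0) * v0 i)"
      using s0(2) by (simp add: fun_eq_iff algebra_simps)
    then show "x \<in> L"
      using sub[OF s(1) s0(1), of c] unfolding v0(2)
      by (intro CollectI exI[of _ "\<lambda>i. s i + c * s0 i"] exI[of _ "c * c0"] conjI)
  qed
qed

lemma normal_line_covered:
  assumes a: "a \<in> A" "a \<in> U" and L: "L \<in> normal_lines n A a"
  obtains v j where "v \<in> L" "v \<in> cspace n" "j < k" "d j a v \<noteq> 0"
proof -
  let ?T = "tangent_space A a"
  note T = tangent_space_eq[OF a]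
  obtain v0 where v0: "v0 \<in> cspace n" "v0 \<notin> ?T" "L = {(\<lambda>i. s i + c * v0 i) | s c. s \<in> ?T}"
    using L unfolding normal_lines_def by blast
  have "(\<lambda>i. 0) \<in> ?T"
    unfolding T by (simp add: cspace_def differential_def)
  then have "v0 \<in> L"
    unfolding v0(3) by (intro CollectI exI[of _ "\<lambda>i. 0"] exI[of _ 1]) auto
  moreover obtain j where "j < k" "d j a v0 \<noteq> 0"
    using v0(1,2) unfolding T by blast
  ultimately show ?thesis
    using that v0 by blast
qed

lemma normal_lineI:
  assumes a: "a \<in> A" "a \<in> U" and v: "v \<in> cspace n" "j < k" "d j a v \<noteq> 0"
  shows "{(\<lambda>i. s i + c * v i) | s c. s \<in> tangent_space A a} \<in> normal_lines n A a"
    and "v \<in> {(\<lambda>i. s i + c * v i) | s c. s \<in> tangent_space A a}"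
proof -
  have "v \<notin> tangent_space A a"
    using v unfolding tangent_space_eq[OF a] by blast
  with v show "{(\<lambda>i. s i + c * v i) | s c. s \<in> tangent_space A a} \<in> normal_lines n A a"
    unfolding normal_lines_def by blast
  have "(\<lambda>i. 0) \<in> tangent_space A a"
    unfolding tangent_space_eq[OF a] by (simp add: cspace_def differential_def)
  then show "v \<in> {(\<lambda>i. s i + c * v i) | s c. s \<in> tangent_space A a}"
    by (intro CollectI exI[of _ "\<lambda>i. 0"] exI[of _ 1]) auto
qed

end


section \<open>Coordinates on the blow-up\<close>

text \<open>The blow-down map in the \<open>j\<close>-th affine chart.\<close>

definition affine_blowdown :: "nat \<Rightarrow> nat \<Rightarrow> (nat \<Rightarrow> complex) \<Rightarrow> nat \<Rightarrow> complex" where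
  "affine_blowdown k j w = (\<lambda>i. if i < k \<and> i \<noteq> j then w i * w j else w i)"

definition blowdown :: "blowup_point \<Rightarrow> nat \<Rightarrow> complex" where
  "blowdown p = (case p of Inl z \<Rightarrow> z | Inr (a, L) \<Rightarrow> a)"

lemma blowdown_simps [simp]: "blowdown (Inl z) = z" "blowdown (Inr (a, L)) = a"
  by (simp_all add: blowdown_def)

lemma affine_blowdown_holo: "holo_on m W (\<lambda>w. affine_blowdown k j w i)"
  unfolding affine_blowdown_def
  by (cases "i < k \<and> i \<noteq> j") (auto intro: holo_on_intros)

lemma affine_blowdown_in: "j < n \<Longrightarrow> w \<in> cspace n \<Longrightarrow> affine_blowdown k j w \<in> cspace n"
  by (auto simp: affine_blowdown_def cspace_def)

locale blowup_chart = adapted_chart +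
  fixes j :: nat
  assumes j_less: "j < k"
begin

abbreviation "D \<equiv> blowup_domain n A U \<phi> j"
abbreviation "\<Phi> \<equiv> blowup_coord n k \<phi> j"
abbreviation "\<beta> \<equiv> affine_blowdown k j"

lemma jn: "j < n"
  using j_less k_le by simp

lemma Inl_in_D: "Inl z \<in> D \<longleftrightarrow> z \<in> U \<and> z \<notin> A \<and> \<phi> z j \<noteq> 0"
  by (auto simp: blowup_domain_def)

lemma Inr_in_D:
  "Inr (a, L) \<in> D \<longleftrightarrow> a \<in> A \<and> a \<in> U \<and> L \<in> normal_lines n A a \<and> (\<exists>v\<in>L. d j a v \<noteq> 0)"
  by (auto simp: blowup_domain_def)

lemma coord_Inl: "\<Phi> (Inl z) = (\<lambda>i. if i < k \<and> i \<noteq> j then \<phi> z i / \<phi> z j else \<phi> z i)"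
  by (simp add: blowup_coord_def)

lemma d_ratio:
  assumes a: "a \<in> A" "a \<in> U" and L: "L \<in> normal_lines n A a"
    and v: "v \<in> L" "d j a v \<noteq> 0" and x: "x \<in> L"
  obtains c where "\<And>i. i < k \<Longrightarrow> d i a x = c * d i a v"
proof -
  obtain s c where "s \<in> tangent_space A a" "x = (\<lambda>i. s i + c * v i)"
    using x normal_line_generated(1)[OF a L v(1) j_less v(2)] by blast
  then have "d i a x = c * d i a v" if "i < k" for i
    using that tangent_space_eq[OF a] by (simp add: differential_linear)
  with that show thesis by blast
qed

lemma coord_Inr:
  assumes a: "a \<in> A" "a \<in> U" and L: "L \<in> normal_lines n A a" and v: "v \<in> L" "d j a v \<noteq> 0"
  shows "\<Phi> (Inr (a, L)) = (\<lambda>i. if i < k \<and> i \<noteq> j then d i a v / d j a v else \<phi> a i)"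
proof -
  define x where "x = (SOME v. v \<in> L \<and> d j a v \<noteq> 0)"
  have x: "x \<in> L \<and> d j a x \<noteq> 0"
    unfolding x_def by (rule someI[where x = v]) (use v in blast)
  obtain c where c: "\<And>i. i < k \<Longrightarrow> d i a x = c * d i a v"
    using d_ratio[OF a L v] x by blast
  have "c \<noteq> 0" using c[OF j_less] x by auto
  then have "d i a x / d j a x = d i a v / d j a v" if "i < k" for i
    using c[OF that] c[OF j_less] by simp
  then show ?thesis
    by (auto simp: blowup_coord_def Let_def x_def[symmetric] fun_eq_iff)
qed

lemma blowdown_in: "p \<in> D \<Longrightarrow> blowdown p \<in> U"
  by (auto simp: blowup_domain_def)

lemma coord_in_cspace:
  assumes "p \<in> D"
  shows "\<Phi> p \<in> cspace n"
proof (cases p)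
  case (Inl z)
  with assms have "\<phi> z \<in> cspace n"
    using coord_in by (auto simp: Inl_in_D)
  with Inl k_le show ?thesis
    by (auto simp: coord_Inl cspace_def)
next
  case (Inr q)
  obtain a L where q: "q = (a, L)" by (cases q)
  with assms Inr obtain v where "a \<in> A" "a \<in> U" "L \<in> normal_lines n A a" "v \<in> L" "d j a v \<noteq> 0"
    by (auto simp: Inr_in_D)
  with Inr q k_le coord_in[of a] show ?thesis
    by (auto simp: coord_Inr cspace_def)
qed

lemma affine_blowdown_coord:
  assumes "p \<in> D"
  shows "\<beta> (\<Phi> p) = \<phi> (blowdown p)"
proof (cases p)
  case (Inl z)
  with assms show ?thesis
    by (auto simp: coord_Inl Inl_in_D affine_blowdown_def fun_eq_iff)
next
  case (Inr q)
  obtain a L where q: "q = (a, L)" by (cases q)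
  with assms Inr obtain v where v: "a \<in> A" "a \<in> U" "L \<in> normal_lines n A a" "v \<in> L" "d j a v \<noteq> 0"
    by (auto simp: Inr_in_D)
  moreover have "\<phi> a i = 0" if "i < k" for i
    using A_iff v that by blast
  ultimately show ?thesis
    using Inr q j_less by (auto simp: coord_Inr affine_blowdown_def fun_eq_iff)
qed

lemma blowdown_eq: "p \<in> D \<Longrightarrow> blowdown p = \<theta> (\<beta> (\<Phi> p))"
  by (simp add: affine_blowdown_coord blowdown_in inv_coord)

text \<open>Two normal lines at \<open>a\<close> with the same ratios \<open>d\<phi>\<^sub>i : d\<phi>\<^sub>j\<close> contain vectors whose difference is killed by all
  normal differentials, so it is tangent and the lines agree.\<close>

lemma coord_inj_D: "inj_on \<Phi> D"
proof (rule inj_onI)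
  fix p q assume p: "p \<in> D" and q: "q \<in> D" and eq: "\<Phi> p = \<Phi> q"
  have bd: "blowdown p = blowdown q"
    using blowdown_eq p q eq by metis
  show "p = q"
  proof (cases p)
    case (Inl z)
    then show ?thesis
      using p q bd by (cases q) (auto simp: Inl_in_D Inr_in_D)
  next
    case (Inr p')
    obtain a L where p': "p = Inr (a, L)" using Inr by (cases p') auto
    obtain M where q': "q = Inr (a, M)"
      using p q bd p' by (cases q) (auto simp: Inl_in_D Inr_in_D)
    obtain v where v: "a \<in> A" "a \<in> U" "L \<in> normal_lines n A a" "v \<in> L" "d j a v \<noteq> 0"
      using p unfolding p' Inr_in_D by blast
    obtain x where x: "M \<in> normal_lines n A a" "x \<in> M" "d j a x \<noteq> 0"
      using q unfolding q' Inr_in_D by blast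
    note vL = normal_line_generated[OF v(1-4) j_less v(5)]
    note xM = normal_line_generated[OF v(1,2) x(1,2) j_less x(3)]
    have rat: "d i a v / d j a v = d i a x / d j a x" if "i < k" for i
    proof (cases "i = j")
      case False
      from eq have "\<Phi> (Inr (a, L)) i = \<Phi> (Inr (a, M)) i" by (simp add: p' q')
      then show ?thesis
        using coord_Inr[OF v] coord_Inr[OF v(1,2) x] False that by simp
    qed (use v x in simp)
    define c where "c = d j a x / d j a v"
    define s where "s = (\<lambda>i. x i + (- c) * v i)"
    have "s \<in> tangent_space A a"
      unfolding tangent_space_eq[OF v(1,2)]
    proof (intro CollectI conjI allI impI)
      show "s \<in> cspace n"
        unfolding s_def by (rule line_in_cspace[OF xM(2) vL(2)])
      fix i assume "i < k"
      then show "d i a s = 0"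
        using rat[of i] v(5) x(3) unfolding s_def differential_linear c_def
        by (simp add: field_simps)
    qed
    moreover have "x = (\<lambda>i. s i + c * v i)"
      by (simp add: s_def)
    ultimately have "x \<in> L"
      using vL(1) by blast
    then have "L = M"
      using normal_line_generated(1)[OF v(1-3) _ j_less x(3)] xM(1) by simp
    then show ?thesis
      by (simp add: p' q')
  qed
qed

text \<open>A point with \<open>w\<^sub>j = 0\<close> is the image of the normal line spanned by the lift of the vector with \<open>j\<close>-th
  coordinate 1 and the other normal coordinates \<open>w\<^sub>i\<close>.\<close>

lemma coord_image: "\<Phi> ` D = {w \<in> cspace n. \<beta> w \<in> \<phi> ` U}"
proof (intro subset_antisym subsetI)
  fix w assume "w \<in> \<Phi> ` D"
  then show "w \<in> {w \<in> cspace n. \<beta> w \<in> \<phi> ` U}"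
    using coord_in_cspace affine_blowdown_coord blowdown_in by auto
next
  fix w assume "w \<in> {w \<in> cspace n. \<beta> w \<in> \<phi> ` U}"
  then obtain z where w: "w \<in> cspace n" and z: "z \<in> U" "\<beta> w = \<phi> z" by auto
  have zj: "\<phi> z j = w j"
    using z(2)[symmetric] by (simp add: affine_blowdown_def)
  show "w \<in> \<Phi> ` D"
  proof (cases "w j = 0")
    case False
    then have "z \<notin> A"
      using A_iff[OF z(1)] zj j_less by auto
    then have "Inl z \<in> D"
      using z(1) zj False by (simp add: Inl_in_D)
    moreover have "\<Phi> (Inl z) = w"
      using z(2)[symmetric] False by (auto simp: coord_Inl affine_blowdown_def fun_eq_iff)
    ultimately show ?thesis by (metis imageI)
  next
    case True
    have "\<phi> z i = 0" if "i < k" for i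
      using that True z(2)[symmetric] by (auto simp: affine_blowdown_def)
    then have zA: "z \<in> A"
      using A_iff[OF z(1)] by blast
    define u where "u = (\<lambda>i. if i < k then if i = j then 1 else w i else 0)"
    have u: "u \<in> cspace n"
      using k_le by (simp add: u_def cspace_def)
    define v where "v = lift z u"
    have dv: "d i z v = u i" for i
      unfolding v_def by (rule d_lift[OF z(1) u])
    have v: "v \<in> cspace n" "d j z v \<noteq> 0"
      using dv[of j] j_less by (auto simp: u_def v_def lift_in)
    define L where "L = {(\<lambda>i. s i + c * v i) | s c. s \<in> tangent_space A z}"
    have L: "L \<in> normal_lines n A z" "v \<in> L"
      unfolding L_def by (rule normal_lineI[OF zA z(1) v(1) j_less v(2)])+
    then have "Inr (z, L) \<in> D"
      using zA z(1) v(2) by (auto simp: Inr_in_D)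
    moreover have "\<Phi> (Inr (z, L)) = w"
      using z(2)[symmetric] dv True j_less
      by (auto simp: coord_Inr[OF zA z(1) L v(2)] u_def affine_blowdown_def fun_eq_iff)
    ultimately show ?thesis by (metis imageI)
  qed
qed

lemma coord_image_open: "openin (cspace_top n) (\<Phi> ` D)"
  unfolding coord_image
  by (rule openin_preimage_cspace[OF openin_cspace_whole affine_blowdown_holo _ image_open])
    (rule affine_blowdown_in[OF jn])

lemma image_open': "openin (cspace_top n) {w \<in> cspace n. \<beta> w \<in> \<phi> ` U}"
  using coord_image_open by (simp add: coord_image)

lemma blowdown_holo: "holo_on n {w \<in> cspace n. \<beta> w \<in> \<phi> ` U} (\<lambda>w. \<theta> (\<beta> w) i)"
  by (rule holo_on_compose[OF image_open inv_holo image_open' affine_blowdown_holo]) simp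

end

text \<open>The transition between two charts. In affine coordinates \<open>w\<close> of the first chart the second
  system of adapted coordinates is \<open>\<tau>\<close>; since \<open>\<tau>\<^sub>i\<close> vanishes on the exceptional divisor \<open>w\<^sub>j = 0\<close> for
  \<open>i < k'\<close>, it is \<open>w\<^sub>j h\<^sub>i\<close> with \<open>h\<^sub>i\<close> holomorphic. Hence the homogeneous coordinates of the second
  chart are \<open>[h\<^sub>i]\<close>: off the divisor by cancelling \<open>w\<^sub>j\<close>, on it because \<open>h\<^sub>i\<close> is there the derivative of
  \<open>\<psi>\<^sub>i\<close> along the normal line.\<close>

locale blowup_chart_pair = P: blowup_chart n A k U \<phi> j + Q: blowup_chart n A k' V \<psi> j'
  for n A k U \<phi> j k' V \<psi> j'
begin

definition \<Omega> :: "(nat \<Rightarrow> complex) set" where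
  "\<Omega> = {w \<in> {w \<in> cspace n. P.\<beta> w \<in> \<phi> ` U}. P.\<theta> (P.\<beta> w) \<in> V}"

definition \<tau> :: "nat \<Rightarrow> (nat \<Rightarrow> complex) \<Rightarrow> complex" where
  "\<tau> i w = \<psi> (P.\<theta> (P.\<beta> w)) i"

definition h :: "nat \<Rightarrow> (nat \<Rightarrow> complex) \<Rightarrow> complex" where
  "h i w = (if w j = 0 then pderiv_at j (\<tau> i) w else \<tau> i w / w j)"

lemma \<Omega>_open: "openin (cspace_top n) \<Omega>"
  unfolding \<Omega>_def
proof (rule openin_preimage_cspace[OF P.image_open' P.blowdown_holo _ Q.U_open])
  show "P.\<theta> (P.\<beta> w) \<in> cspace n" if "w \<in> {w \<in> cspace n. P.\<beta> w \<in> \<phi> ` U}" for w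
    using that P.inv_in P.U_sub by blast
qed

lemma \<tau>_holo: "holo_on n \<Omega> (\<tau> i)"
  unfolding \<tau>_def
proof (rule holo_on_compose[OF Q.U_open Q.coord_holo \<Omega>_open])
  show "holo_on n \<Omega> (\<lambda>w. P.\<theta> (P.\<beta> w) l)" for l
    by (rule holo_on_subset[OF P.blowdown_holo]) (auto simp: \<Omega>_def)
qed (simp add: \<Omega>_def)

lemma \<tau>_zero:
  assumes w: "w \<in> \<Omega>" "w j = 0" and i: "i < k'"
  shows "\<tau> i w = 0"
proof -
  let ?z = "P.\<theta> (P.\<beta> w)"
  have z: "?z \<in> U" "?z \<in> V" "\<phi> ?z = P.\<beta> w"
    using w P.inv_in P.coord_inv by (auto simp: \<Omega>_def)
  have "?z \<in> A"
    unfolding P.A_iff[OF z(1)] z(3) using w(2) by (auto simp: affine_blowdown_def)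
  then show ?thesis
    using Q.A_iff[OF z(2)] i by (simp add: \<tau>_def)
qed

lemma h_holo:
  assumes "i < k'"
  shows "holo_on n \<Omega> (h i)"
  unfolding h_def
  by (rule holo_on_division[OF \<Omega>_open \<tau>_holo P.jn]) (rule \<tau>_zero[OF _ _ assms])

lemma coord_in_\<Omega>:
  assumes "p \<in> P.D" "blowdown p \<in> V"
  shows "P.\<Phi> p \<in> \<Omega>" "\<tau> i (P.\<Phi> p) = \<psi> (blowdown p) i"
  using assms P.coord_image P.blowdown_eq by (auto simp: \<Omega>_def \<tau>_def)

text \<open>Varying \<open>w\<^sub>j\<close> from 0 moves \<open>\<beta> w\<close> along a straight line with direction \<open>u\<close>. The lift of \<open>u\<close> is the
  normalised generator of \<open>L\<close> up to a tangent vector, which the normal differentials of \<open>\<psi>\<close> kill.\<close>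

lemma h_exceptional:
  assumes a: "a \<in> A" "a \<in> U" "a \<in> V" and L: "L \<in> normal_lines n A a"
    and v: "v \<in> L" "P.d j a v \<noteq> 0" and i: "i < k'"
  shows "h i (P.\<Phi> (Inr (a, L))) = Q.d i a v / P.d j a v"
proof -
  let ?w = "P.\<Phi> (Inr (a, L))"
  have D: "Inr (a, L) \<in> P.D"
    using a L v by (auto simp: P.Inr_in_D)
  note w = P.coord_Inr[OF a(1,2) L v]
  have \<phi>0: "\<phi> a l = 0" if "l < k" for l
    using P.A_iff a that by blast
  have wj: "?w j = 0"
    using w \<phi>0 P.j_less by simp
  define u where "u = (\<lambda>i. if i < k then if i = j then 1 else ?w i else 0)"
  have u: "u \<in> cspace n"
    using P.k_le by (simp add: u_def cspace_def)
  have line: "P.\<beta> (?w(j := t)) = (\<lambda>i. \<phi> a i + t * u i)" for t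
    using \<phi>0 P.j_less w by (auto simp: affine_blowdown_def u_def fun_eq_iff)
  obtain r where r: "r > 0" "\<And>t. cmod t < r \<Longrightarrow> (\<lambda>i. \<phi> a i + t * u i) \<in> \<phi> ` U"
    and der: "\<And>l. ((\<lambda>t. P.\<theta> (\<lambda>i. \<phi> a i + t * u i) l) has_field_derivative P.lift a u l) (at 0)"
    using P.lift_disc[OF a(2) u] by blast
  have "((\<lambda>t. \<psi> (P.\<theta> (\<lambda>i. \<phi> a i + t * u i)) i) has_field_derivative
      Q.d i (P.\<theta> (\<lambda>i. \<phi> a i + 0 * u i)) (P.lift a u)) (at 0)"
  proof (rule differential_compose_curve[OF Q.U_open Q.coord_holo])
    show "P.\<theta> (\<lambda>i. \<phi> a i + 0 * u i) \<in> V"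
      using a P.inv_coord by simp
    have "\<forall>\<^sub>F t in at 0. cmod t < r"
      using r(1) unfolding eventually_at by (intro exI[of _ r]) auto
    then show "\<forall>\<^sub>F t in at 0. P.\<theta> (\<lambda>i. \<phi> a i + t * u i) \<in> cspace n"
      by eventually_elim (use r P.inv_in P.U_sub in blast)
  qed (rule der)
  then have "((\<lambda>t. \<tau> i (?w(j := t))) has_field_derivative Q.d i a (P.lift a u)) (at (?w j))"
    using P.inv_coord[OF a(2)] wj by (simp add: \<tau>_def line)
  then have "pderiv_at j (\<tau> i) ?w = Q.d i a (P.lift a u)"
    by (rule pderiv_at_eqI)
  then have hw: "h i ?w = Q.d i a (P.lift a u)"
    by (simp add: h_def wj)
  define c where "c = 1 / P.d j a v"
  define s where "s = (\<lambda>i. P.lift a u i + (- c) * v i)"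
  have "s \<in> tangent_space A a"
    unfolding P.tangent_space_eq[OF a(1,2)]
  proof (intro CollectI conjI allI impI)
    show "s \<in> cspace n"
      unfolding s_def
      using P.lift_in P.normal_line_generated(2)[OF a(1,2) L v(1) P.j_less v(2)]
      by (rule line_in_cspace)
    fix l assume l: "l < k"
    have "P.d l a s = u l - c * P.d l a v"
      unfolding s_def differential_linear P.d_lift[OF a(2) u] by simp
    also have "\<dots> = 0"
      using l w v(2) by (simp add: u_def c_def)
    finally show "P.d l a s = 0" .
  qed
  then have "Q.d i a s = 0"
    using Q.tangent_space_eq[OF a(1,3)] i by blast
  then have "Q.d i a (P.lift a u) = c * Q.d i a v"
    unfolding s_def differential_linear by simp
  with hw show ?thesis
    by (simp add: c_def)
qed

lemma in_second_domain_iff: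
  assumes p: "p \<in> P.D" "blowdown p \<in> V"
  shows "p \<in> Q.D \<longleftrightarrow> h j' (P.\<Phi> p) \<noteq> 0"
proof (cases p)
  case (Inl z)
  with p have z: "z \<in> U" "z \<in> V" "z \<notin> A" "\<phi> z j \<noteq> 0"
    by (auto simp: P.Inl_in_D)
  have wj: "P.\<Phi> p j = \<phi> z j"
    by (simp add: Inl P.coord_Inl)
  have "h j' (P.\<Phi> p) = \<psi> z j' / \<phi> z j"
    unfolding h_def wj using coord_in_\<Omega>(2)[OF p, of j'] z by (simp add: Inl)
  with z Inl show ?thesis
    by (simp add: Q.Inl_in_D)
next
  case (Inr q)
  obtain a L where pa: "p = Inr (a, L)" using Inr by (cases q) auto
  obtain v where v: "a \<in> A" "a \<in> U" "L \<in> normal_lines n A a" "v \<in> L" "P.d j a v \<noteq> 0"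
    using p unfolding pa P.Inr_in_D by blast
  have aV: "a \<in> V" using p(2) pa by simp
  have h: "h j' (P.\<Phi> p) = Q.d j' a v / P.d j a v"
    unfolding pa by (rule h_exceptional[OF v(1,2) aV v(3-5) Q.j_less])
  show ?thesis
  proof
    assume "p \<in> Q.D"
    then obtain x where x: "x \<in> L" "Q.d j' a x \<noteq> 0"
      unfolding pa Q.Inr_in_D by blast
    obtain s c where "s \<in> tangent_space A a" "x = (\<lambda>i. s i + c * v i)"
      using P.normal_line_generated(1)[OF v(1-4) P.j_less v(5)] x by blast
    then have "Q.d j' a x = c * Q.d j' a v"
      using Q.tangent_space_eq[OF v(1) aV] Q.j_less by (simp add: differential_linear)
    with x h v show "h j' (P.\<Phi> p) \<noteq> 0" by auto
  next
    assume "h j' (P.\<Phi> p) \<noteq> 0"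
    then have "Q.d j' a v \<noteq> 0" using h by auto
    then show "p \<in> Q.D"
      unfolding pa Q.Inr_in_D using v aV by blast
  qed
qed

lemma second_coord:
  assumes p: "p \<in> P.D" "p \<in> Q.D"
  shows "Q.\<Phi> p i = (if i < k' \<and> i \<noteq> j' then h i (P.\<Phi> p) / h j' (P.\<Phi> p) else \<tau> i (P.\<Phi> p))"
proof -
  have pV: "blowdown p \<in> V"
    using Q.blowdown_in p by blast
  note \<tau> = coord_in_\<Omega>(2)[OF p(1) pV]
  show ?thesis
  proof (cases p)
    case (Inl z)
    with p have z: "z \<in> U" "z \<in> V" "\<phi> z j \<noteq> 0" "\<psi> z j' \<noteq> 0"
      by (auto simp: P.Inl_in_D Q.Inl_in_D)
    have wj: "P.\<Phi> p j = \<phi> z j"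
      by (simp add: Inl P.coord_Inl)
    show ?thesis
      using z \<tau> wj by (simp add: h_def) (simp add: Inl Q.coord_Inl)
  next
    case (Inr q)
    obtain a L where pa: "p = Inr (a, L)" using Inr by (cases q) auto
    obtain v where v: "a \<in> A" "a \<in> U" "L \<in> normal_lines n A a" "v \<in> L" "P.d j a v \<noteq> 0"
      using p unfolding pa P.Inr_in_D by blast
    have aV: "a \<in> V" using pV pa by simp
    have h: "h i (P.\<Phi> p) = Q.d i a v / P.d j a v" if "i < k'" for i
      unfolding pa by (rule h_exceptional[OF v(1,2) aV v(3-5) that])
    have "h j' (P.\<Phi> p) \<noteq> 0"
      using in_second_domain_iff[OF p(1) pV] p(2) by blast
    then have "Q.d j' a v \<noteq> 0"
      using h[OF Q.j_less] by auto
    then have "Q.\<Phi> p = (\<lambda>i. if i < k' \<and> i \<noteq> j' then Q.d i a v / Q.d j' a v else \<psi> a i)"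
      unfolding pa by (rule Q.coord_Inr[OF v(1) aV v(3,4)])
    then show ?thesis
      using h Q.j_less \<tau>[of i] v(5) by (simp add: pa)
  qed
qed

lemma overlap_image: "P.\<Phi> ` (P.D \<inter> Q.D) = {w \<in> \<Omega>. h j' w \<noteq> 0}"
proof (intro subset_antisym subsetI)
  fix w assume "w \<in> P.\<Phi> ` (P.D \<inter> Q.D)"
  then obtain p where p: "p \<in> P.D" "p \<in> Q.D" "w = P.\<Phi> p" by blast
  then show "w \<in> {w \<in> \<Omega>. h j' w \<noteq> 0}"
    using Q.blowdown_in[OF p(2)] in_second_domain_iff coord_in_\<Omega>(1) by blast
next
  fix w assume w: "w \<in> {w \<in> \<Omega>. h j' w \<noteq> 0}"
  then obtain p where p: "p \<in> P.D" "w = P.\<Phi> p"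
    using P.coord_image by (auto simp: \<Omega>_def)
  moreover have "blowdown p \<in> V"
    using w p P.blowdown_eq by (auto simp: \<Omega>_def)
  ultimately show "w \<in> P.\<Phi> ` (P.D \<inter> Q.D)"
    using w in_second_domain_iff by blast
qed

lemma transition:
  "openin (cspace_top n) (P.\<Phi> ` (P.D \<inter> Q.D))"
  "holo_on n (P.\<Phi> ` (P.D \<inter> Q.D)) (\<lambda>w. Q.\<Phi> (inv_into P.D P.\<Phi> w) i)"
proof -
  show "openin (cspace_top n) (P.\<Phi> ` (P.D \<inter> Q.D))"
    unfolding overlap_image by (rule openin_nonzero[OF \<Omega>_open h_holo[OF Q.j_less]])
  let ?R = "{w \<in> \<Omega>. h j' w \<noteq> 0}"
  have sub: "?R \<subseteq> \<Omega>" by blast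
  have "holo_on n ?R (\<lambda>w. if i < k' \<and> i \<noteq> j' then h i w / h j' w else \<tau> i w)"
  proof (cases "i < k' \<and> i \<noteq> j'")
    case True
    then have "holo_on n ?R (\<lambda>w. h i w / h j' w)"
      by (intro holo_on_divide holo_on_subset[OF h_holo sub] Q.j_less) auto
    with True show ?thesis by simp
  next
    case False
    then show ?thesis
      using holo_on_subset[OF \<tau>_holo sub, of i] by (simp only: if_False)
  qed
  then have "holo_on n (P.\<Phi> ` (P.D \<inter> Q.D))
      (\<lambda>w. if i < k' \<and> i \<noteq> j' then h i w / h j' w else \<tau> i w)"
    by (simp only: overlap_image)
  then show "holo_on n (P.\<Phi> ` (P.D \<inter> Q.D)) (\<lambda>w. Q.\<Phi> (inv_into P.D P.\<Phi> w) i)"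
  proof (rule holo_on_cong)
    fix w assume "w \<in> P.\<Phi> ` (P.D \<inter> Q.D)"
    then obtain p where p: "p \<in> P.D" "p \<in> Q.D" "w = P.\<Phi> p" by blast
    then show "(if i < k' \<and> i \<noteq> j' then h i w / h j' w else \<tau> i w) = Q.\<Phi> (inv_into P.D P.\<Phi> w) i"
      using second_coord[OF p(1,2), of i] inv_into_f_f[OF P.coord_inj_D p(1)] by simp
  qed
qed

end

lemma blowup_member:
  assumes "(W, \<Psi>) \<in> blowup n A" "A \<subseteq> cspace n"
  obtains k U \<phi> j where "blowup_chart n A k U \<phi> j" "W = blowup_domain n A U \<phi> j" "\<Psi> = blowup_coord n k \<phi> j"
proof -
  obtain k U \<phi> j where "adapted n A k U \<phi>" "j < k" "W = blowup_domain n A U \<phi> j" "\<Psi> = blowup_coord n k \<phi> j"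
    using assms(1) unfolding blowup_def by blast
  then show thesis
    using that assms(2) by (simp add: blowup_chart_def blowup_chart_axioms_def adapted_chart_def)
qed

lemma (in blowup_chart) chart_in_blowup: "(D, \<Phi>) \<in> blowup n A"
  unfolding blowup_def using adapted j_less by blast

lemma holo_atlas_blowup:
  assumes A: "A \<subseteq> cspace n"
  shows "holo_atlas n (blowup n A)"
  unfolding holo_atlas_def
proof (intro conjI ballI, safe)
  fix W \<Psi> assume "(W, \<Psi>) \<in> blowup n A"
  then obtain k U \<phi> j where P: "blowup_chart n A k U \<phi> j"
    "W = blowup_domain n A U \<phi> j" "\<Psi> = blowup_coord n k \<phi> j"
    using blowup_member A by metis
  show "inj_on \<Psi> W" "openin (cspace_top n) (\<Psi> ` W)"
    unfolding P(2,3) using blowup_chart.coord_inj_D[OF P(1)] blowup_chart.coord_image_open[OF P(1)]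
    by blast+
next
  fix W \<Psi> W' \<Psi>' assume "(W, \<Psi>) \<in> blowup n A" "(W', \<Psi>') \<in> blowup n A"
  then obtain k U \<phi> j k' V \<psi> j' where P: "blowup_chart n A k U \<phi> j"
    "W = blowup_domain n A U \<phi> j" "\<Psi> = blowup_coord n k \<phi> j"
    and Q: "blowup_chart n A k' V \<psi> j'"
    "W' = blowup_domain n A V \<psi> j'" "\<Psi>' = blowup_coord n k' \<psi> j'"
    using blowup_member A by metis
  interpret blowup_chart_pair n A k U \<phi> j k' V \<psi> j'
    using P(1) Q(1) by (simp add: blowup_chart_pair_def)
  show "openin (cspace_top n) (\<Psi> ` (W \<inter> W'))"
    unfolding P(2,3) Q(2) by (rule transition(1))
  show "holo_on n (\<Psi> ` (W \<inter> W')) (\<lambda>w. \<Psi>' (inv_into W \<Psi> w) i)" for i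
    unfolding P(2,3) Q(2,3) by (rule transition(2))
qed


section \<open>The blow-up as a complex manifold\<close>

lemma local_coordinates_identity:
  assumes "openin (cspace_top n) U"
  shows "local_coordinates n U (\<lambda>z. z)"
  unfolding local_coordinates_def
proof (intro conjI allI)
  show "holo_on n ((\<lambda>z. z) ` U) (\<lambda>w. inv_into U (\<lambda>z. z) w i)" for i
    by (rule holo_on_cong[OF holo_on_coord[of n _ i]]) (auto simp: inv_into_f_f[of "\<lambda>z. z"])
qed (use assms in \<open>auto intro: holo_on_coord\<close>)

lemma local_coordinates_compose:
  assumes lc: "local_coordinates n U \<phi>"
    and S: "\<And>i. holo_on n (cspace n) (\<lambda>w. S w i)" "\<And>w. w \<in> cspace n \<Longrightarrow> S w \<in> cspace n"
    and S': "\<And>i. holo_on n (cspace n) (\<lambda>w. S' w i)" "\<And>w. w \<in> cspace n \<Longrightarrow> S' w \<in> cspace n"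
    and inv: "\<And>w. w \<in> cspace n \<Longrightarrow> S' (S w) = w" "\<And>w. w \<in> cspace n \<Longrightarrow> S (S' w) = w"
  shows "local_coordinates n U (\<lambda>z. S (\<phi> z))"
proof -
  have U: "openin (cspace_top n) U" and inj: "inj_on \<phi> U" and im: "openin (cspace_top n) (\<phi> ` U)"
    and hol: "\<And>i. holo_on n U (\<lambda>z. \<phi> z i)"
    and inv_hol: "\<And>i. holo_on n (\<phi> ` U) (\<lambda>w. inv_into U \<phi> w i)"
    using lc unfolding local_coordinates_def by blast+
  have \<phi>c: "\<phi> z \<in> cspace n" if "z \<in> U" for z
    using openin_cspace_subset[OF im] that by blast
  have image: "(\<lambda>z. S (\<phi> z)) ` U = {w \<in> cspace n. S' w \<in> \<phi> ` U}"
  proof (intro subset_antisym subsetI)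
    fix w assume "w \<in> (\<lambda>z. S (\<phi> z)) ` U"
    then show "w \<in> {w \<in> cspace n. S' w \<in> \<phi> ` U}"
      using S(2) inv(1) \<phi>c by auto
  next
    fix w assume "w \<in> {w \<in> cspace n. S' w \<in> \<phi> ` U}"
    then obtain z where "w \<in> cspace n" "z \<in> U" "S' w = \<phi> z" by blast
    then have "w = S (\<phi> z)" using inv(2) by metis
    with \<open>z \<in> U\<close> show "w \<in> (\<lambda>z. S (\<phi> z)) ` U" by blast
  qed
  have inj': "inj_on (\<lambda>z. S (\<phi> z)) U"
    using inj inv(1) \<phi>c unfolding inj_on_def by metis
  have im': "openin (cspace_top n) ((\<lambda>z. S (\<phi> z)) ` U)"
    unfolding image by (rule openin_preimage_cspace[OF openin_cspace_whole S' im])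
  show ?thesis
    unfolding local_coordinates_def
  proof (intro conjI allI)
    show "holo_on n U (\<lambda>z. S (\<phi> z) i)" for i
      by (rule holo_on_compose[OF openin_cspace_whole S(1) U hol \<phi>c])
    show "holo_on n ((\<lambda>z. S (\<phi> z)) ` U) (\<lambda>w. inv_into U (\<lambda>z. S (\<phi> z)) w i)" for i
    proof (rule holo_on_cong)
      show "holo_on n ((\<lambda>z. S (\<phi> z)) ` U) (\<lambda>w. inv_into U \<phi> (S' w) i)"
      proof (rule holo_on_compose[OF im inv_hol im'])
        show "holo_on n ((\<lambda>z. S (\<phi> z)) ` U) (\<lambda>w. S' w l)" for l
          by (rule holo_on_subset[OF S'(1) openin_cspace_subset[OF im']])
        show "S' w \<in> \<phi> ` U" if "w \<in> (\<lambda>z. S (\<phi> z)) ` U" for w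
          using that unfolding image by blast
      qed
      fix w assume "w \<in> (\<lambda>z. S (\<phi> z)) ` U"
      then obtain z where z: "z \<in> U" "w = S (\<phi> z)" by blast
      then show "inv_into U \<phi> (S' w) i = inv_into U (\<lambda>z. S (\<phi> z)) w i"
        using inv_into_f_f[OF inj z(1)] inv_into_f_f[OF inj' z(1)] inv(1)[OF \<phi>c[OF z(1)]] by simp
    qed
  qed (rule U inj' im')+
qed

lemma translation_coordinates:
  assumes U: "openin (cspace_top n) U" and n: "0 < n"
  shows "local_coordinates n U (\<lambda>z. z(0 := z 0 + c))"
proof (rule local_coordinates_compose[OF local_coordinates_identity[OF U],
      where S = "\<lambda>z. z(0 := z 0 + c)" and S' = "\<lambda>z. z(0 := z 0 - c)"])
  show "holo_on n (cspace n) (\<lambda>z. (z(0 := z 0 + c)) i)" "holo_on n (cspace n) (\<lambda>z. (z(0 := z 0 - c)) i)" for i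
    by (cases "i = 0"; auto intro: holo_on_intros)+
qed (use n in \<open>auto intro: cspace_upd\<close>)

text \<open>Since \<open>U\<close> misses \<open>A\<close> and the translated 0-th coordinate has no zero on the unit polydisc, the condition
  for adapted coordinates with \<open>k = 1\<close> says that two empty sets agree.\<close>

lemma chart_off_submanifold:
  assumes A: "closedin (cspace_top n) A" and n: "0 < n" and a: "a \<in> cspace n" "a \<notin> A"
  defines "U \<equiv> {z \<in> polydisc n a 1. z \<notin> A}" and "\<phi> \<equiv> (\<lambda>z. z(0 := z 0 + (1 - a 0)))"
  shows "adapted n A 1 U \<phi>" "a \<in> U" "U \<inter> A = {}" "\<And>z. z \<in> U \<Longrightarrow> \<phi> z 0 \<noteq> 0"
proof -
  show aU: "a \<in> U" "U \<inter> A = {}"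
    using a by (auto simp: U_def polydisc_def)
  have "U = polydisc n a 1 - A"
    by (auto simp: U_def)
  then have opU: "openin (cspace_top n) U"
    using A openin_polydisc by (simp add: openin_diff)
  show nz: "\<phi> z 0 \<noteq> 0" if "z \<in> U" for z
  proof
    assume "\<phi> z 0 = 0"
    then have "z 0 - a 0 = -1" by (simp add: \<phi>_def algebra_simps eq_neg_iff_add_eq_0)
    then have "cmod (z 0 - a 0) = 1" by simp
    with that n show False by (auto simp: U_def polydisc_def)
  qed
  show "adapted n A 1 U \<phi>"
    unfolding adapted_def
  proof (intro conjI)
    show "local_coordinates n U \<phi>"
      unfolding \<phi>_def by (rule translation_coordinates[OF opU n])
    show "A \<inter> U = {z \<in> U. \<forall>i<1. \<phi> z i = 0}"
      using aU(2) nz by auto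
  qed (use n in simp)
qed

lemma closed_submanifold_subset: "closed_submanifold n m A \<Longrightarrow> A \<subseteq> cspace n"
  unfolding closed_submanifold_def cspace_top_def
  by (metis closedin_subset topspace_euclidean_subtopology)

lemma topspace_blowupE:
  assumes "p \<in> topspace (mfd_top (blowup n A))" "A \<subseteq> cspace n"
  obtains k U \<phi> j where "blowup_chart n A k U \<phi> j" "p \<in> blowup_domain n A U \<phi> j"
proof -
  obtain W \<Psi> where W: "(W, \<Psi>) \<in> blowup n A" "p \<in> W"
    using assms(1) unfolding topspace_mfd_top by blast
  then show thesis
    using blowup_member[OF W(1) assms(2)] that by metis
qed

lemma (in blowup_chart) D_in_topspace: "p \<in> D \<Longrightarrow> p \<in> topspace (mfd_top (blowup n A))"
  unfolding topspace_mfd_top using chart_in_blowup by blast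

lemma (in adapted_chart) covered_by_blowup_charts:
  assumes p: "p \<in> topspace (mfd_top (blowup n A))" "blowdown p \<in> U"
  obtains j where "j < k" "p \<in> blowup_domain n A U \<phi> j"
proof -
  obtain k' V \<psi> j' where Q: "blowup_chart n A k' V \<psi> j'" "p \<in> blowup_domain n A V \<psi> j'"
    using topspace_blowupE[OF p(1) A_sub] by blast
  show thesis
  proof (cases p)
    case (Inl z)
    then have z: "z \<in> U" "z \<notin> A"
      using p Q(2) blowup_chart.Inl_in_D[OF Q(1)] by auto
    then obtain j where "j < k" "\<phi> z j \<noteq> 0"
      using A_iff by blast
    with z Inl that[of j] show thesis
      by (simp add: blowup_domain_def)
  next
    case (Inr q)
    obtain a L where pa: "p = Inr (a, L)" using Inr by (cases q) auto
    have a: "a \<in> A" "a \<in> U" "L \<in> normal_lines n A a"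
      using p Q(2) blowup_chart.Inr_in_D[OF Q(1)] unfolding pa by auto
    obtain v j where "v \<in> L" "j < k" "d j a v \<noteq> 0"
      using normal_line_covered[OF a] by blast
    with a pa that[of j] show thesis
      by (auto simp: blowup_domain_def)
  qed
qed

lemma (in adapted_chart) blowup_chartI: "j < k \<Longrightarrow> blowup_chart n A k U \<phi> j"
  by (simp add: blowup_chart_def blowup_chart_axioms_def adapted_chart_axioms)

text \<open>By the Lindelof property countably many adapted coordinate domains cover all those that occur, and each
  of them carries finitely many charts of the blow-up, which cover its preimage.\<close>

lemma second_countable_blowup:
  assumes As: "A \<subseteq> cspace n"
  shows "second_countable (mfd_top (blowup n A))"
proof -
  define \<F> where "\<F> = {U. \<exists>k \<phi>. adapted_chart n A k U \<phi>}"
  have op: "openin (top_of_set (cspace n)) U" if "U \<in> \<F>" for U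
    using that adapted_chart.U_open unfolding \<F>_def cspace_top_def by blast
  obtain \<F>' where F': "\<F>' \<subseteq> \<F>" "countable \<F>'" "\<Union>\<F>' = \<Union>\<F>"
    using Lindelof_openin[OF op] by metis
  have "\<forall>U\<in>\<F>'. \<exists>k \<phi>. adapted_chart n A k U \<phi>"
    using F'(1) unfolding \<F>_def by blast
  then obtain kk ff where ch: "\<And>U. U \<in> \<F>' \<Longrightarrow> adapted_chart n A (kk U) U (ff U)"
    by metis
  define Y0 where "Y0 = (\<Union>U\<in>\<F>'. (\<lambda>j. (blowup_domain n A U (ff U) j, blowup_coord n (kk U) (ff U) j)) ` {..<kk U})"
  show ?thesis
  proof (rule second_countable_mfd_top[OF holo_atlas_blowup[OF As]])
    show "Y0 \<subseteq> blowup n A"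
      unfolding Y0_def
      using blowup_chart.chart_in_blowup adapted_chart.blowup_chartI[OF ch] by blast
    show "countable Y0"
      unfolding Y0_def using F'(2) by (intro countable_UN countable_image) auto
    show "topspace (mfd_top (blowup n A)) \<subseteq> (\<Union>(U, \<phi>)\<in>Y0. U)"
    proof
      fix p assume p: "p \<in> topspace (mfd_top (blowup n A))"
      obtain k V \<psi> j where V: "blowup_chart n A k V \<psi> j" "p \<in> blowup_domain n A V \<psi> j"
        using topspace_blowupE[OF p As] by blast
      have "blowdown p \<in> V"
        using blowup_chart.blowdown_in[OF V] .
      moreover have "V \<in> \<F>"
        using V(1) unfolding \<F>_def blowup_chart_def by blast
      ultimately obtain U where U: "U \<in> \<F>'" "blowdown p \<in> U"
        using F'(3) by blast
      obtain j where "j < kk U" "p \<in> blowup_domain n A U (ff U) j"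
        using adapted_chart.covered_by_blowup_charts[OF ch[OF U(1)] p U(2)] by blast
      then show "p \<in> (\<Union>(U, \<phi>)\<in>Y0. U)"
        unfolding Y0_def using U(1) by blast
    qed
  qed
qed

lemma continuous_map_blowdown:
  assumes A: "A \<subseteq> cspace n"
  shows "continuous_map (mfd_top (blowup n A)) (cspace_top n) blowdown"
  unfolding continuous_map
proof (intro conjI allI impI)
  show "blowdown ` topspace (mfd_top (blowup n A)) \<subseteq> topspace (cspace_top n)"
  proof clarify
    fix p assume "p \<in> topspace (mfd_top (blowup n A))"
    then obtain k U \<phi> j where P: "blowup_chart n A k U \<phi> j" "p \<in> blowup_domain n A U \<phi> j"
      using topspace_blowupE A by metis
    then interpret blowup_chart n A k U \<phi> j by simp
    show "blowdown p \<in> topspace (cspace_top n)"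
      using blowdown_in[OF P(2)] U_sub by (auto simp: cspace_top_def)
  qed
  fix W assume W: "openin (cspace_top n) W"
  let ?G = "{p \<in> topspace (mfd_top (blowup n A)). blowdown p \<in> W}"
  show "openin (mfd_top (blowup n A)) ?G"
  proof (subst openin_subopen, intro ballI)
    fix p assume p: "p \<in> ?G"
    then obtain k U \<phi> j where P: "blowup_chart n A k U \<phi> j" "p \<in> blowup_domain n A U \<phi> j"
      using topspace_blowupE A by (metis (no_types, lifting) mem_Collect_eq)
    interpret blowup_chart n A k U \<phi> j by (rule P(1))
    let ?V = "{w \<in> {w \<in> cspace n. \<beta> w \<in> \<phi> ` U}. \<theta> (\<beta> w) \<in> W}"
    have opV: "openin (cspace_top n) ?V"
      by (rule openin_preimage_cspace[OF image_open' blowdown_holo _ W]) (use inv_in U_sub in blast)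
    have "openin (mfd_top (blowup n A)) {q \<in> D. \<Phi> q \<in> ?V}"
      by (rule openin_chart_vimage_cspace[OF chart_in_blowup _ opV]) (use coord_in_cspace in blast)
    moreover have "p \<in> {q \<in> D. \<Phi> q \<in> ?V}"
      using p P(2) coord_image blowdown_eq[OF P(2)] by auto
    moreover have "{q \<in> D. \<Phi> q \<in> ?V} \<subseteq> ?G"
      using blowdown_eq D_in_topspace by auto
    ultimately show "\<exists>T. openin (mfd_top (blowup n A)) T \<and> p \<in> T \<and> T \<subseteq> ?G"
      by blast
  qed
qed

lemma differential_add:
  assumes U: "openin (cspace_top n) U" "holo_on n U f" "holo_on n U g" and a: "a \<in> U" and v: "v \<in> cspace n"
  shows "differential n (\<lambda>z. f z + g z) a v = differential n f a v + differential n g a v"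
  using differential_line[OF U(1) holo_on_add[OF U(2,3)] a v]
    DERIV_add[OF differential_line[OF U(1,2) a v] differential_line[OF U(1,3) a v]]
  by (rule DERIV_unique)

text \<open>Needed to bring two points of one exceptional fibre into a common affine chart: if each of two normal
  coordinates vanishes on one of the lines, their sum vanishes on neither.\<close>

lemma (in adapted_chart) adapted_shear:
  assumes ij: "i < k" "j < k" "i \<noteq> j"
  shows "adapted_chart n A k U (\<lambda>z. (\<phi> z)(j := \<phi> z j + \<phi> z i))"
proof -
  have jn: "j < n" using ij k_le by simp
  have "local_coordinates n U (\<lambda>z. (\<phi> z)(j := \<phi> z j + \<phi> z i))"
  proof (rule local_coordinates_compose[where S = "\<lambda>w. w(j := w j + w i)" and S' = "\<lambda>w. w(j := w j - w i)"])
    show "local_coordinates n U \<phi>"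
      using adapted unfolding adapted_def by blast
    show "holo_on n (cspace n) (\<lambda>w. (w(j := w j + w i)) l)" "holo_on n (cspace n) (\<lambda>w. (w(j := w j - w i)) l)" for l
      by (cases "l = j"; auto intro: holo_on_intros)+
  qed (use ij jn in \<open>auto intro: cspace_upd\<close>)
  moreover have "A \<inter> U = {z \<in> U. \<forall>l<k. ((\<phi> z)(j := \<phi> z j + \<phi> z i)) l = 0}"
  proof -
    have "(\<forall>l<k. \<phi> z l = 0) \<longleftrightarrow> (\<forall>l<k. ((\<phi> z)(j := \<phi> z j + \<phi> z i)) l = 0)" for z
    proof
      assume *: "\<forall>l<k. ((\<phi> z)(j := \<phi> z j + \<phi> z i)) l = 0"
      have "\<phi> z i = 0" using *[rule_format, OF ij(1)] ij(3) by simp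
      moreover have "\<phi> z j + \<phi> z i = 0" using *[rule_format, OF ij(2)] by simp
      moreover have "\<phi> z l = 0" if "l < k" "l \<noteq> j" for l
        using *[rule_format, OF that(1)] that(2) by simp
      ultimately show "\<forall>l<k. \<phi> z l = 0" by (metis add_0_right)
    qed (use ij in simp)
    then show ?thesis using A_iff by blast
  qed
  ultimately show ?thesis
    using k_le A_sub by (simp add: adapted_chart_def adapted_def)
qed

lemma (in adapted_chart) common_chart:
  assumes a: "a \<in> A" "a \<in> U" and L: "L \<in> normal_lines n A a" and M: "M \<in> normal_lines n A a"
  obtains \<psi> j where "blowup_chart n A k U \<psi> j" "Inr (a, L) \<in> blowup_domain n A U \<psi> j"
    "Inr (a, M) \<in> blowup_domain n A U \<psi> j"
proof -
  obtain v j where v: "v \<in> L" "v \<in> cspace n" "j < k" "d j a v \<noteq> 0"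
    using normal_line_covered[OF a L] by blast
  obtain x i where x: "x \<in> M" "x \<in> cspace n" "i < k" "d i a x \<noteq> 0"
    using normal_line_covered[OF a M] by blast
  consider "d j a x \<noteq> 0" | "d i a v \<noteq> 0" | "d j a x = 0" "d i a v = 0" by blast
  then show thesis
  proof cases
    case 1
    then show thesis
      using that[OF blowup_chartI[OF v(3)]] a L M v x by (auto simp: blowup_domain_def)
  next
    case 2
    then show thesis
      using that[OF blowup_chartI[OF x(3)]] a L M v x by (auto simp: blowup_domain_def)
  next
    case 3
    then have "i \<noteq> j" using x by auto
    define \<psi> where "\<psi> = (\<lambda>z. (\<phi> z)(j := \<phi> z j + \<phi> z i))"
    interpret S: adapted_chart n A k U \<psi>
      unfolding \<psi>_def by (rule adapted_shear[OF x(3) v(3) \<open>i \<noteq> j\<close>])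
    have "S.d j a y = d j a y + d i a y" if "y \<in> cspace n" for y
      using differential_add[OF U_open coord_holo coord_holo a(2) that] by (simp add: \<psi>_def)
    then have "S.d j a v \<noteq> 0" "S.d j a x \<noteq> 0"
      using 3 v x by auto
    then show thesis
      using that[OF S.blowup_chartI[OF v(3)]] a L M v x by (auto simp: blowup_domain_def)
  qed
qed

text \<open>The continuous blow-down separates points with different images, and two points of one fibre lie in a
  common chart.\<close>

lemma Hausdorff_blowup:
  assumes A: "A \<subseteq> cspace n"
  shows "Hausdorff_space (mfd_top (blowup n A))"
  unfolding Hausdorff_space_def
proof (intro allI impI, elim conjE)
  fix p q assume p: "p \<in> topspace (mfd_top (blowup n A))" and q: "q \<in> topspace (mfd_top (blowup n A))"
    and ne: "p \<noteq> q"
  let ?X = "mfd_top (blowup n A)"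
  show "\<exists>G H. openin ?X G \<and> openin ?X H \<and> p \<in> G \<and> q \<in> H \<and> disjnt G H"
  proof (cases "blowdown p = blowdown q")
    case False
    then obtain G H where GH: "open G" "open H" "blowdown p \<in> G" "blowdown q \<in> H" "G \<inter> H = {}"
      using hausdorff by metis
    have op: "openin ?X {x \<in> topspace ?X. blowdown x \<in> W}" if "open W" for W
    proof -
      have "openin (cspace_top n) (cspace n \<inter> W)"
        using that by (auto simp: cspace_top_def)
      from openin_continuous_map_preimage[OF continuous_map_blowdown[OF A] this]
      have "openin ?X {x \<in> topspace ?X. blowdown x \<in> cspace n \<inter> W}" .
      moreover have "blowdown x \<in> cspace n" if "x \<in> topspace ?X" for x
        using continuous_map_image_subset_topspace[OF continuous_map_blowdown[OF A]] that
        by (auto simp: cspace_top_def)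
      then have "{x \<in> topspace ?X. blowdown x \<in> cspace n \<inter> W} = {x \<in> topspace ?X. blowdown x \<in> W}"
        by blast
      ultimately show ?thesis by simp
    qed
    show ?thesis
    proof (intro exI conjI)
      show "openin ?X {x \<in> topspace ?X. blowdown x \<in> G}" "openin ?X {x \<in> topspace ?X. blowdown x \<in> H}"
        using op GH by blast+
      show "p \<in> {x \<in> topspace ?X. blowdown x \<in> G}" "q \<in> {x \<in> topspace ?X. blowdown x \<in> H}"
        using p q GH by blast+
      show "disjnt {x \<in> topspace ?X. blowdown x \<in> G} {x \<in> topspace ?X. blowdown x \<in> H}"
        using GH(5) by (auto simp: disjnt_def)
    qed
  next
    case True
    obtain k U \<phi> j where P: "blowup_chart n A k U \<phi> j" "p \<in> blowup_domain n A U \<phi> j"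
      using topspace_blowupE[OF p A] by blast
    obtain k' V \<psi> j' where Q: "blowup_chart n A k' V \<psi> j'" "q \<in> blowup_domain n A V \<psi> j'"
      using topspace_blowupE[OF q A] by blast
    interpret P: blowup_chart n A k U \<phi> j by (rule P(1))
    interpret Q: blowup_chart n A k' V \<psi> j' by (rule Q(1))
    obtain a L M where pq: "p = Inr (a, L)" "q = Inr (a, M)"
      using P(2) Q(2) True ne
      by (cases p; cases q) (auto simp: P.Inl_in_D P.Inr_in_D Q.Inl_in_D Q.Inr_in_D)
    have a: "a \<in> A" "a \<in> U" "L \<in> normal_lines n A a" "M \<in> normal_lines n A a"
      using P(2) Q(2) unfolding pq P.Inr_in_D Q.Inr_in_D by blast+
    obtain \<eta> i where C: "blowup_chart n A k U \<eta> i" "p \<in> blowup_domain n A U \<eta> i"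
      "q \<in> blowup_domain n A U \<eta> i"
      using P.common_chart[OF a] unfolding pq by metis
    interpret C: blowup_chart n A k U \<eta> i by (rule C(1))
    have "C.\<Phi> p \<noteq> C.\<Phi> q"
      using C.coord_inj_D C(2,3) ne by (metis inj_onD)
    then obtain G H where GH: "open G" "open H" "C.\<Phi> p \<in> G" "C.\<Phi> q \<in> H" "G \<inter> H = {}"
      using hausdorff by metis
    show ?thesis
    proof (intro exI conjI)
      show "openin ?X {x \<in> C.D. C.\<Phi> x \<in> G}" "openin ?X {x \<in> C.D. C.\<Phi> x \<in> H}"
        using openin_chart_vimage[OF C.chart_in_blowup] GH by blast+
      show "p \<in> {x \<in> C.D. C.\<Phi> x \<in> G}" "q \<in> {x \<in> C.D. C.\<Phi> x \<in> H}"
        using C GH by blast+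
      show "disjnt {x \<in> C.D. C.\<Phi> x \<in> G} {x \<in> C.D. C.\<Phi> x \<in> H}"
        using GH(5) by (auto simp: disjnt_def)
    qed
  qed
qed

theorem complex_manifold_blowup:
  assumes "A \<subseteq> cspace n"
  shows "complex_manifold n (blowup n A)"
  using holo_atlas_blowup[OF assms] Hausdorff_blowup[OF assms] second_countable_blowup[OF assms]
  by (simp add: complex_manifold_def holo_atlas_def)


section \<open>Holomorphic maps into the blow-up\<close>

lemma holo_map_chart_open:
  assumes W: "openin (cspace_top m) W" and f: "holo_map m W Y f" and D: "(D, \<Phi>) \<in> Y"
  shows "openin (cspace_top m) (W \<inter> f -` D)"
proof -
  have "openin (top_of_set W) {z \<in> topspace (top_of_set W). f z \<in> D}"
    using f openin_chart_domain[OF D] unfolding holo_map_def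
    by (intro openin_continuous_map_preimage) auto
  then have "openin (top_of_set W) (W \<inter> f -` D)"
    by (simp add: vimage_def Int_def)
  with W show ?thesis
    unfolding cspace_top_def using openin_trans by blast
qed

lemma holo_map_coord:
  assumes "holo_map m W Y f" "(D, \<Phi>) \<in> Y"
  shows "holo_on m (W \<inter> f -` D) (\<lambda>z. \<Phi> (f z) i)"
  using assms unfolding holo_map_def by fast

lemma holo_map_in_topspace: "holo_map m W Y f \<Longrightarrow> z \<in> W \<Longrightarrow> f z \<in> topspace (mfd_top Y)"
  unfolding holo_map_def using continuous_map_image_subset_topspace by fastforce

lemma holo_on_blowdown_map:
  assumes A: "A \<subseteq> cspace n" and W: "openin (cspace_top m) W" and f: "holo_map m W (blowup n A) f"
  shows "holo_on m W (\<lambda>z. blowdown (f z) i)"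
proof (rule holo_on_local[OF W])
  fix z assume z: "z \<in> W"
  obtain k U \<phi> j where P: "blowup_chart n A k U \<phi> j" "f z \<in> blowup_domain n A U \<phi> j"
    using topspace_blowupE[OF holo_map_in_topspace[OF f z] A] by blast
  interpret blowup_chart n A k U \<phi> j by (rule P(1))
  let ?V = "W \<inter> f -` D"
  have op: "openin (cspace_top m) ?V"
    by (rule holo_map_chart_open[OF W f chart_in_blowup])
  have "holo_on m ?V (\<lambda>z. \<theta> (\<beta> (\<Phi> (f z))) i)"
    by (rule holo_on_compose[OF image_open' blowdown_holo op holo_map_coord[OF f chart_in_blowup]])
      (use coord_image in blast)
  then have "holo_on m ?V (\<lambda>z. blowdown (f z) i)"
    by (rule holo_on_cong) (simp add: blowdown_eq)
  with op z P(2) show "\<exists>V. openin (cspace_top m) V \<and> z \<in> V \<and> V \<subseteq> W \<and> holo_on m V (\<lambda>z. blowdown (f z) i)"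
    by (intro exI[of _ ?V]) auto
qed

text \<open>A lift to the blow-up makes the normal components of the map divisible by one of them. At a
  point over the centre their differentials are then proportional, so the map cannot be locally
  invertible there when the codimension is at least two.\<close>

lemma (in adapted_chart) lift_degenerate_over_centre:
  assumes W: "openin (cspace_top n) W" and f: "holo_map n W (blowup n A) f"
    and k: "2 \<le> k" and p: "p \<in> W" "blowdown (f p) \<in> A" "blowdown (f p) \<in> U"
  shows "det (jacobian n (\<lambda>z. blowdown (f z)) p) = 0"
proof (rule ccontr)
  assume det: "det (jacobian n (\<lambda>z. blowdown (f z)) p) \<noteq> 0"
  define F where "F z = blowdown (f z)" for z
  obtain j where j: "j < k" "f p \<in> blowup_domain n A U \<phi> j"
    using covered_by_blowup_charts[OF holo_map_in_topspace[OF f p(1)] p(3)] by blast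
  interpret blowup_chart n A k U \<phi> j by (rule blowup_chartI[OF j(1)])
  obtain i where i: "i < k" "i \<noteq> j"
    using k by (metis less_2_cases_iff not_less_iff_gr_or_eq order_less_le_trans zero_neq_one pos2 one_less_numeral_iff semiring_norm(76))
  have ijn: "i < n" "j < n" using i j k_le by auto
  define V where "V = W \<inter> f -` D"
  have V: "openin (cspace_top n) V" "p \<in> V"
    unfolding V_def using holo_map_chart_open[OF W f chart_in_blowup] p j by auto
  have F: "holo_on n V (\<lambda>z. F z l)" for l
    unfolding F_def using holo_on_subset[OF holo_on_blowdown_map[OF A_sub W f]] V_def by blast
  have FU: "F z \<in> U" if "z \<in> V" for z
    unfolding F_def using that blowdown_in by (auto simp: V_def)
  define g where "g l z = \<Phi> (f z) l" for l z
  have g: "holo_on n V (g l)" for l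
    unfolding g_def V_def by (rule holo_map_coord[OF f chart_in_blowup])
  have \<phi>F: "\<phi> (F z) l = \<beta> (\<lambda>l. g l z) l" if "z \<in> V" for z l
    using that affine_blowdown_coord[of "f z"] by (auto simp: F_def g_def V_def)
  have gj: "g j p = 0"
    using \<phi>F[OF V(2), of j] A_iff[OF p(3)] p(2) j(1) by (simp add: F_def affine_blowdown_def)
  have prod_rule: "pderiv_at l (\<lambda>z. \<phi> (F z) i) p = g i p * pderiv_at l (\<lambda>z. \<phi> (F z) j) p" if l: "l < n" for l
  proof -
    have "pderiv_at l (\<lambda>z. \<phi> (F z) i) p = pderiv_at l (\<lambda>z. g i z * g j z) p"
      using \<phi>F i by (intro pderiv_at_cong[OF V l]) (simp add: affine_blowdown_def)
    also have "\<dots> = g i p * pderiv_at l (g j) p"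
    proof (rule pderiv_at_eqI)
      have "((\<lambda>s. g i (p(l := s)) * g j (p(l := s))) has_field_derivative
          pderiv_at l (g i) (p(l := p l)) * g j (p(l := p l)) + pderiv_at l (g j) (p(l := p l)) * g i (p(l := p l))) (at (p l))"
        by (intro DERIV_mult holo_on_has_derivative[OF V(1) g l]) (use V(2) in simp_all)
      then show "((\<lambda>s. g i (p(l := s)) * g j (p(l := s))) has_field_derivative g i p * pderiv_at l (g j) p) (at (p l))"
        using gj by (simp add: mult.commute)
    qed
    also have "pderiv_at l (g j) p = pderiv_at l (\<lambda>z. \<phi> (F z) j) p"
      using \<phi>F by (intro pderiv_at_cong[OF V l]) (simp add: affine_blowdown_def)
    finally show ?thesis .
  qed
  define c where "c = g i p"
  define \<xi> where "\<xi> m = pderiv_at m (\<lambda>z. \<phi> z i) (F p) - c * pderiv_at m (\<lambda>z. \<phi> z j) (F p)" for m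
  have \<xi>: "\<xi> m = 0" if "m < n" for m
  proof (rule det_nonzero_rows_independent[of n "\<lambda>m l. pderiv_at l (\<lambda>z. F z m) p" \<xi>])
    show "det (Matrix.mat n n (\<lambda>(m, l). pderiv_at l (\<lambda>z. F z m) p)) \<noteq> 0"
      using det by (simp add: jacobian_def F_def)
    show "(\<Sum>m<n. \<xi> m * pderiv_at l (\<lambda>z. F z m) p) = 0" if l: "l < n" for l
    proof -
      have chain: "pderiv_at l (\<lambda>z. \<phi> (F z) i') p =
          (\<Sum>m<n. pderiv_at m (\<lambda>z. \<phi> z i') (F p) * pderiv_at l (\<lambda>z. F z m) p)" for i'
        by (rule pderiv_compose[OF U_open coord_holo V(1) F FU V(2) l])
      show ?thesis
        using prod_rule[OF l] unfolding chain \<xi>_def c_def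
        by (simp add: algebra_simps sum_subtractf sum_distrib_left)
    qed
  qed (rule that)
  define u where "u = (\<lambda>l. if l = i then 1 else 0 :: complex)"
  have u: "u \<in> cspace n"
    using ijn by (simp add: u_def cspace_def)
  have "d i (F p) (lift (F p) u) - c * d j (F p) (lift (F p) u) = (\<Sum>m<n. \<xi> m * lift (F p) u m)"
    by (simp add: differential_def \<xi>_def algebra_simps sum_subtractf sum_distrib_left)
  also have "\<dots> = 0"
    using \<xi> by simp
  finally show False
    unfolding d_lift[OF FU[OF V(2)] u] using i by (simp add: u_def)
qed

lemma rank_full_iff_det:
  fixes M :: "complex mat"
  assumes "M \<in> carrier_mat n n"
  shows "vec_space.rank n M = n \<longleftrightarrow> det M \<noteq> 0"
  using vec_space.det_rank_iff[OF assms] by blast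

text \<open>The blow-down is locally biholomorphic off the exceptional divisor, and a map whose Jacobian
  does not vanish identically in a chart does not map into that divisor.\<close>

lemma nondegenerate_blowdown:
  assumes A: "A \<subseteq> cspace n" and f: "holo_map n (cspace n) (blowup n A) f"
    and nd: "nondegenerate n (blowup n A) f"
  obtains z where "z \<in> cspace n" "det (jacobian n (\<lambda>z. blowdown (f z)) z) \<noteq> 0"
proof -
  obtain z0 E \<Psi> where z0: "z0 \<in> cspace n" "(E, \<Psi>) \<in> blowup n A" "f z0 \<in> E"
    "vec_space.rank n (jacobian n (\<Psi> \<circ> f) z0) = n"
    using nd unfolding nondegenerate_def by blast
  obtain k U \<phi> j where P: "blowup_chart n A k U \<phi> j" "E = blowup_domain n A U \<phi> j" "\<Psi> = blowup_coord n k \<phi> j"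
    using blowup_member[OF z0(2) A] by blast
  interpret blowup_chart n A k U \<phi> j by (rule P(1))
  define g where "g z = \<Phi> (f z)" for z
  define V where "V = cspace n \<inter> f -` D"
  have V: "openin (cspace_top n) V"
    unfolding V_def by (rule holo_map_chart_open[OF openin_cspace_whole f chart_in_blowup])
  have g: "holo_on n V (\<lambda>z. g z l)" for l
    unfolding g_def V_def by (rule holo_map_coord[OF f chart_in_blowup])
  define V1 where "V1 = {z \<in> V. det (jacobian n g z) \<noteq> 0}"
  have V1: "openin (cspace_top n) V1"
    unfolding V1_def by (rule openin_nonzero[OF V holo_on_det_jacobian[OF V g]])
  have "det (jacobian n g z0) \<noteq> 0"
    using z0(4) rank_full_iff_det[of "jacobian n (\<Psi> \<circ> f) z0" n]
    by (simp add: jacobian_def g_def P(3))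
  then have z0V: "z0 \<in> V1"
    using z0 P by (simp add: V1_def V_def)
  have "\<exists>z1\<in>V1. g z1 j \<noteq> 0"
  proof (rule ccontr)
    assume "\<not> ?thesis"
    then have zero: "g z j = 0" if "z \<in> V1" for z
      using that by blast
    have row: "pderiv_at i (\<lambda>z. g z j) z0 = 0" if "i < n" for i
    proof -
      have "pderiv_at i (\<lambda>z. g z j) z0 = pderiv_at i (\<lambda>z. 0) z0"
        by (rule pderiv_at_cong[OF V1 z0V that zero])
      then show ?thesis by (simp add: pderiv_at_def)
    qed
    define e where "e = (\<lambda>m. if m = j then 1 else 0 :: complex)"
    have "e j = 0"
    proof (rule det_nonzero_rows_independent[of n "\<lambda>m i. pderiv_at i (\<lambda>z. g z m) z0"])
      show "det (Matrix.mat n n (\<lambda>(m, i). pderiv_at i (\<lambda>z. g z m) z0)) \<noteq> 0"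
        using z0V by (simp add: V1_def jacobian_def)
      show "(\<Sum>m<n. e m * pderiv_at i (\<lambda>z. g z m) z0) = 0" if "i < n" for i
        using row[OF that] by (intro sum.neutral) (simp add: e_def)
    qed (rule jn)
    then show False by (simp add: e_def)
  qed
  then obtain z1 where z1: "z1 \<in> V1" "g z1 j \<noteq> 0" by blast
  define V2 where "V2 = {z \<in> V1. g z j \<noteq> 0}"
  have V12: "V1 \<subseteq> V" by (auto simp: V1_def)
  have V2: "openin (cspace_top n) V2" "z1 \<in> V2"
    unfolding V2_def using openin_nonzero[OF V1 holo_on_subset[OF g V12]] z1 by auto
  have V2V: "V2 \<subseteq> V" by (auto simp: V2_def V1_def)
  define F where "F z = blowdown (f z)" for z
  define U' where "U' = {w \<in> U. \<phi> w j \<noteq> 0}"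
  define R where "R w = (\<lambda>i. if i < k \<and> i \<noteq> j then \<phi> w i / \<phi> w j else \<phi> w i)" for w
  have U': "openin (cspace_top n) U'"
    unfolding U'_def by (rule openin_nonzero[OF U_open coord_holo])
  have hol\<phi>: "holo_on n U' (\<lambda>w. \<phi> w i)" for i
    by (rule holo_on_subset[OF coord_holo]) (auto simp: U'_def)
  have R: "holo_on n U' (\<lambda>w. R w i)" for i
  proof (cases "i < k \<and> i \<noteq> j")
    case True
    have "holo_on n U' (\<lambda>w. \<phi> w i / \<phi> w j)"
      by (rule holo_on_divide[OF hol\<phi> hol\<phi>]) (simp add: U'_def)
    with True show ?thesis by (simp add: R_def)
  next
    case False
    then show ?thesis unfolding R_def using hol\<phi>[of i] by (simp only: if_False)
  qed
  have \<phi>F: "\<phi> (F z) = \<beta> (g z)" "F z \<in> U" if "z \<in> V" for z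
    using that affine_blowdown_coord[of "f z"] blowdown_in[of "f z"] by (auto simp: F_def g_def V_def)
  have FU': "F z \<in> U'" if "z \<in> V2" for z
    using that \<phi>F V2V by (auto simp: U'_def affine_blowdown_def V2_def)
  have F: "holo_on n V2 (\<lambda>z. F z i)" for i
    unfolding F_def using holo_on_blowdown_map[OF A openin_cspace_whole f]
    by (rule holo_on_subset) (rule openin_cspace_subset[OF V2(1)])
  have gR: "g z i = R (F z) i" if "z \<in> V2" for z i
    using that \<phi>F(1)[of z] V2V by (auto simp: R_def affine_blowdown_def V2_def)
  have "jacobian n g z1 = jacobian n (\<lambda>z. R (F z)) z1"
    using gR by (intro jacobian_cong[OF V2])
  then have "det (jacobian n g z1) = det (jacobian n R (F z1)) * det (jacobian n F z1)"
    using det_jacobian_compose[OF U' R V2(1) F FU' V2(2)] by simp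
  then have "det (jacobian n F z1) \<noteq> 0"
    using z1(1) by (auto simp: V1_def)
  moreover have "F = (\<lambda>z. blowdown (f z))"
    by (rule ext) (simp add: F_def)
  ultimately have "det (jacobian n (\<lambda>z. blowdown (f z)) z1) \<noteq> 0"
    by simp
  with subsetD[OF openin_cspace_subset[OF V2(1)] V2(2)] show thesis by (rule that)
qed


section \<open>A quantitative inverse function theorem\<close>

text \<open>The inverse is the adjugate divided by the determinant, and the entries of the adjugate are minors.\<close>

lemma inverse_matrix_bound:
  fixes f :: "nat \<times> nat \<Rightarrow> complex"
  assumes M: "\<And>i j. i < n \<Longrightarrow> j < n \<Longrightarrow> cmod (f (i, j)) \<le> M"
    and \<eta>: "\<eta> > 0" "cmod (det (Matrix.mat n n f)) \<ge> \<eta>"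
  obtains L :: "nat \<Rightarrow> nat \<Rightarrow> complex" where
    "\<And>i j. i < n \<Longrightarrow> j < n \<Longrightarrow> cmod (L i j) \<le> fact (n - 1) * M ^ (n - 1) / \<eta>"
    "\<And>i j. i < n \<Longrightarrow> j < n \<Longrightarrow> (\<Sum>l<n. L i l * f (l, j)) = (if i = j then 1 else 0)"
    "\<And>i j. i < n \<Longrightarrow> j < n \<Longrightarrow> (\<Sum>l<n. f (i, l) * L l j) = (if i = j then 1 else 0)"
proof -
  define A where "A = Matrix.mat n n f"
  have A: "A \<in> carrier_mat n n" by (simp add: A_def)
  define L where "L i j = adj_mat A $$ (i, j) / det A" for i j
  have dA: "det A \<noteq> 0" using \<eta> by (auto simp: A_def)
  note adj = adj_mat[OF A]
  have dims: "dim_row (adj_mat A) = n" "dim_col (adj_mat A) = n"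
    using adj(1) by auto
  have dimA: "dim_row A = n" "dim_col A = n" by (simp_all add: A_def)
  have "cmod (L i j) \<le> fact (n - 1) * M ^ (n - 1) / \<eta>" if ij: "i < n" "j < n" for i j
  proof -
    define B where "B = mat_delete A j i"
    have "B = Matrix.mat (n - 1) (n - 1) (\<lambda>(i', j').
        f (if i' < j then i' else Suc i', if j' < i then j' else Suc j'))"
      unfolding B_def mat_delete_def A_def
      by (rule eq_matI) (use ij in auto)
    then have "cmod (det B) \<le> fact (n - 1) * M ^ (n - 1)"
      by (simp only:) (rule norm_det_le, use M in auto)
    moreover have "adj_mat A $$ (i, j) = (-1) ^ (j + i) * det B"
      using ij A by (simp add: adj_mat_def cofactor_def B_def)
    ultimately have *: "cmod (adj_mat A $$ (i, j)) \<le> fact (n - 1) * M ^ (n - 1)"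
      by (simp add: norm_mult norm_power)
    then have "0 \<le> fact (n - 1) * M ^ (n - 1)"
      using norm_ge_zero order_trans by blast
    with * \<eta> show ?thesis
      unfolding L_def norm_divide by (intro frac_le) (auto simp: A_def)
  qed
  moreover have "(\<Sum>l<n. L i l * f (l, j)) = (if i = j then 1 else 0)" if ij: "i < n" "j < n" for i j
  proof -
    have "(\<Sum>l<n. adj_mat A $$ (i, l) * f (l, j)) = (adj_mat A * A) $$ (i, j)"
      using ij dims dimA by (simp add: scalar_prod_def atLeast0LessThan) (simp add: A_def)
    also have "\<dots> = det A * (if i = j then 1 else 0)"
      using adj(3) ij by simp
    finally show ?thesis
      using dA by (simp add: L_def sum_divide_distrib[symmetric])
  qed
  moreover have "(\<Sum>l<n. f (i, l) * L l j) = (if i = j then 1 else 0)" if ij: "i < n" "j < n" for i j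
  proof -
    have "(\<Sum>l<n. f (i, l) * adj_mat A $$ (l, j)) = (A * adj_mat A) $$ (i, j)"
      using ij dims dimA by (simp add: scalar_prod_def atLeast0LessThan) (simp add: A_def)
    also have "\<dots> = det A * (if i = j then 1 else 0)"
      using adj(2) ij by simp
    finally show ?thesis
      using dA by (simp add: L_def sum_divide_distrib[symmetric])
  qed
  ultimately show thesis using that by blast
qed

definition entire_self_map :: "nat \<Rightarrow> ((nat \<Rightarrow> complex) \<Rightarrow> nat \<Rightarrow> complex) \<Rightarrow> bool" where
  "entire_self_map n F \<longleftrightarrow> (\<forall>i. holo_on n (cspace n) (\<lambda>z. F z i)) \<and> (\<forall>z\<in>cspace n. F z \<in> cspace n)"

definition covers_near :: "nat \<Rightarrow> ((nat \<Rightarrow> complex) \<Rightarrow> nat \<Rightarrow> complex) \<Rightarrow> (nat \<Rightarrow> complex) \<Rightarrow> real \<Rightarrow> bool" where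
  "covers_near n F y \<delta> \<longleftrightarrow> (\<forall>w\<in>cspace n. (\<forall>i<n. cmod (w i - y i) < \<delta>) \<longrightarrow>
     (\<exists>z\<in>cspace n. F z = w \<and> det (jacobian n F z) \<noteq> 0))"

lemma polydisc_in_polydisc:
  assumes "z \<in> polydisc n a r"
  shows "polydisc n z s \<subseteq> polydisc n a (r + s)"
proof
  fix w assume w: "w \<in> polydisc n z s"
  have "cmod (w i - a i) < r + s" if "i < n" for i
  proof -
    have "cmod (w i - a i) \<le> cmod (w i - z i) + cmod (z i - a i)"
      using norm_triangle_ineq[of "w i - z i" "z i - a i"] by simp
    moreover have "cmod (w i - z i) < s" "cmod (z i - a i) < r"
      using assms w that by (simp_all add: polydisc_def)
    ultimately show ?thesis by linarith
  qed
  with w show "w \<in> polydisc n a (r + s)" by (simp add: polydisc_def)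
qed

lemma pderiv_bound_polydisc:
  assumes f: "holo_on n (cspace n) f" and B: "\<And>z. z \<in> polydisc n a (r + s) \<Longrightarrow> cmod (f z) \<le> B"
    and z: "z \<in> polydisc n a r" and s: "s > 0" and i: "i < n"
  shows "cmod (pderiv_at i f z) \<le> 2 * B / s"
  using polydisc_in_polydisc[OF z, of s] z polydisc_subset_cspace[of n z s]
  by (intro pderiv_bound[OF openin_cspace_whole f]) (auto simp: polydisc_def intro!: B s i)

lemma lipschitz_polydisc:
  assumes f: "holo_on n (cspace n) f" and B: "\<And>z i. z \<in> polydisc n a r \<Longrightarrow> i < n \<Longrightarrow> cmod (pderiv_at i f z) \<le> B"
    and zw: "z \<in> polydisc n a r" "w \<in> polydisc n a r"
  shows "cmod (f z - f w) \<le> B * (\<Sum>i<n. cmod (z i - w i))"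
  using holo_on_mean_value[OF openin_cspace_whole f polydisc_subset_cspace _ zw, of "\<lambda>_. 0" B] B by simp

text \<open>Newton's map \<open>T z = z - L (F z - w)\<close>, with \<open>L\<close> the inverse of the differential at \<open>p\<close>, halves
  \<open>\<ell>\<^sup>1\<close>-distances on a polydisc whose size only depends on the given bounds. A point minimising the
  displacement of \<open>T\<close> is fixed, so it solves \<open>F z = w\<close>.\<close>

lemma uniform_local_surjectivity:
  fixes s R \<eta> :: real
  assumes n: "0 < n" and s: "s > 0" and R: "R > 0" and \<eta>: "\<eta> > 0"
  shows "\<exists>\<delta>>0. \<forall>F p. entire_self_map n F \<and> p \<in> cspace n \<and>
      (\<forall>z\<in>polydisc n p s. \<forall>i<n. cmod (F z i) \<le> R) \<and> cmod (det (jacobian n F p)) \<ge> \<eta> \<longrightarrow>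
      covers_near n F (F p) \<delta>"
proof -
  define M1 where "M1 = 2 * R / (s/2)"
  define M2 where "M2 = 2 * M1 / (s/4)"
  define K where "K = fact (n - 1) * M1 ^ (n - 1) / \<eta>"
  have M1: "M1 > 0" and M2: "M2 > 0" using s R by (auto simp: M1_def M2_def)
  have K: "K > 0" using M1 \<eta> by (simp add: K_def)
  define N where "N = real n"
  have N: "N > 0" using n by (simp add: N_def)
  define \<rho> where "\<rho> = min (s/8) (1 / (4 * N * N * N * K * M2))"
  \<comment> \<open>On the polydisc of radius \<open>2 \<rho>\<close> all entries of the differential of \<open>T\<close> are at most \<open>1 / (2 n)\<close>.\<close>
  have \<rho>: "\<rho> > 0" "2 * \<rho> \<le> s/4" using s N K M2 by (auto simp: \<rho>_def)
  have \<rho>2: "N * (K * (M2 * (N * (2 * \<rho>)))) \<le> 1 / (2 * N)"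
  proof -
    have "\<rho> \<le> 1 / (4 * N * N * N * K * M2)" by (simp add: \<rho>_def)
    then have "\<rho> * (4 * N * N * N * K * M2) \<le> 1"
      using N K M2 by (subst (asm) le_divide_eq) auto
    then show ?thesis
      using N by (simp add: le_divide_eq algebra_simps)
  qed
  \<comment> \<open>Then \<open>T\<close> moves \<open>p\<close> by at most \<open>\<rho> / 2\<close> and so maps the polydisc of radius \<open>\<rho>\<close> into itself.\<close>
  define \<delta> where "\<delta> = \<rho> / (2 * N * K)"
  have \<delta>: "\<delta> > 0" "K * (N * \<delta>) = \<rho> / 2" using \<rho> N K by (auto simp: \<delta>_def)
  show ?thesis
    unfolding covers_near_def
  proof (intro exI[of _ \<delta>] conjI allI impI ballI)
    show "\<delta> > 0" by (rule \<delta>)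
    fix F p w
    assume A: "entire_self_map n F \<and> p \<in> cspace n \<and>
      (\<forall>z\<in>polydisc n p s. \<forall>i<n. cmod (F z i) \<le> R) \<and> cmod (det (jacobian n F p)) \<ge> \<eta>"
      and w: "w \<in> cspace n" "\<forall>i<n. cmod (w i - F p i) < \<delta>"
    have F: "holo_on n (cspace n) (\<lambda>z. F z i)" "z \<in> cspace n \<Longrightarrow> F z \<in> cspace n" for i z
      using A by (auto simp: entire_self_map_def)
    have p: "p \<in> cspace n" and bF: "\<And>z i. z \<in> polydisc n p s \<Longrightarrow> i < n \<Longrightarrow> cmod (F z i) \<le> R"
      using A by auto
    have d1: "cmod (pderiv_at m (\<lambda>z. F z l) z) \<le> M1" if "z \<in> polydisc n p (s/2)" "m < n" "l < n" for z m l
      unfolding M1_def by (rule pderiv_bound_polydisc[OF F(1) _ that(1)]) (use bF that s in auto)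
    have d2: "cmod (pderiv_at i (pderiv_at m (\<lambda>z. F z l)) z) \<le> M2"
      if "z \<in> polydisc n p (s/4)" "m < n" "l < n" "i < n" for z m l i
      unfolding M2_def
      by (rule pderiv_bound_polydisc[OF holo_on_pderiv[OF openin_cspace_whole F(1)] _ that(1)])
        (use d1 that s in auto)
    have osc: "cmod (pderiv_at m (\<lambda>z. F z l) z - pderiv_at m (\<lambda>z. F z l) p) \<le> M2 * (N * (2 * \<rho>))"
      if z: "z \<in> polydisc n p (2 * \<rho>)" and ml: "m < n" "l < n" for z m l
    proof -
      have "polydisc n p (2 * \<rho>) \<subseteq> polydisc n p (s/4)"
        using \<rho>(2) by (rule polydisc_mono)
      then have "z \<in> polydisc n p (s/4)" "p \<in> polydisc n p (s/4)"
        using z s p by (auto simp: polydisc_def)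
      then have "cmod (pderiv_at m (\<lambda>z. F z l) z - pderiv_at m (\<lambda>z. F z l) p) \<le> M2 * (\<Sum>i<n. cmod (z i - p i))"
        by (intro lipschitz_polydisc[OF holo_on_pderiv[OF openin_cspace_whole F(1)]] d2 ml)
      also have "(\<Sum>i<n. cmod (z i - p i)) \<le> real (card {..<n}) * (2 * \<rho>)"
        using z by (intro sum_bounded_above) (simp add: polydisc_def less_imp_le)
      then have "M2 * (\<Sum>i<n. cmod (z i - p i)) \<le> M2 * (N * (2 * \<rho>))"
        using M2 by (intro mult_left_mono) (simp_all add: N_def)
      finally show ?thesis .
    qed
    obtain L where L: "\<And>i j. i < n \<Longrightarrow> j < n \<Longrightarrow> cmod (L i j) \<le> K"
      "\<And>i j. i < n \<Longrightarrow> j < n \<Longrightarrow> (\<Sum>l<n. L i l * pderiv_at j (\<lambda>z. F z l) p) = (if i = j then 1 else 0)"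
      "\<And>i j. i < n \<Longrightarrow> j < n \<Longrightarrow> (\<Sum>l<n. pderiv_at l (\<lambda>z. F z i) p * L l j) = (if i = j then 1 else 0)"
    proof (rule inverse_matrix_bound[of n "\<lambda>(j, i). pderiv_at i (\<lambda>z. F z j) p" M1 \<eta>])
      show "cmod (case (i, j) of (j, i) \<Rightarrow> pderiv_at i (\<lambda>z. F z j) p) \<le> M1" if "i < n" "j < n" for i j
        using d1[of p j i] that centre_in_polydisc[OF p] s by simp
      show "\<eta> \<le> cmod (det (Matrix.mat n n (\<lambda>(j, i). pderiv_at i (\<lambda>z. F z j) p)))"
        using A by (simp add: jacobian_def)
    qed (use \<eta> that in \<open>auto simp: K_def\<close>)
    define T where "T z = (\<lambda>i. if i < n then z i - (\<Sum>l<n. L i l * (F z l - w l)) else 0)" for z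
    define E where "E i m z = (\<Sum>l<n. L i l * (pderiv_at m (\<lambda>z. F z l) p - pderiv_at m (\<lambda>z. F z l) z))" for i m z
    have E_eq: "E i m z = (if i = m then 1 else 0) - (\<Sum>l<n. L i l * pderiv_at m (\<lambda>z. F z l) z)"
      if "i < n" "m < n" for i m z
      using L(2)[OF that] by (simp add: E_def right_diff_distrib sum_subtractf)
    have E: "cmod (E i m z) \<le> 1 / (2 * N)" if "z \<in> polydisc n p (2 * \<rho>)" "i < n" "m < n" for i m z
    proof -
      have "cmod (E i m z) \<le> (\<Sum>l<n. K * (M2 * (N * (2 * \<rho>))))"
        unfolding E_def
      proof (rule sum_norm_le)
        fix l assume "l \<in> {..<n}"
        then show "cmod (L i l * (pderiv_at m (\<lambda>z. F z l) p - pderiv_at m (\<lambda>z. F z l) z)) \<le> K * (M2 * (N * (2 * \<rho>)))"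
          unfolding norm_mult using L(1)[of i l] osc[OF that(1,3), of l] that K
          by (intro mult_mono) (auto simp: norm_minus_commute)
      qed
      also have "\<dots> = N * (K * (M2 * (N * (2 * \<rho>))))" by (simp add: N_def)
      finally show ?thesis using \<rho>2 by simp
    qed
    have contr: "cmod (T z i - T z' i) \<le> 1 / (2 * N) * (\<Sum>m<n. cmod (z m - z' m))"
      if zz: "z \<in> polydisc n p (2 * \<rho>)" "z' \<in> polydisc n p (2 * \<rho>)" and i: "i < n" for z z' i
    proof -
      have "cmod (T z i - T z' i - (\<Sum>m<n. 0 * (z m - z' m))) \<le> 1 / (2 * N) * (\<Sum>m<n. cmod (z m - z' m))"
      proof (rule polydisc_mean_value[OF _ _ zz, where D = "\<lambda>m y. E i m y"])
        fix y m assume y: "y \<in> polydisc n p (2 * \<rho>)" and m: "m < n"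
        show "cmod (E i m y - 0) \<le> 1 / (2 * N)"
          using E[OF y i m] by simp
        have dF: "((\<lambda>t. F (y(m := t)) l) has_field_derivative pderiv_at m (\<lambda>z. F z l) y) (at (y m))" for l
          using holo_on_has_derivative[OF openin_cspace_whole F(1) m, of y "y m"] y by (simp add: polydisc_def)
        have dy: "((\<lambda>t. (y(m := t)) i) has_field_derivative (if i = m then 1 else 0)) (at (y m))"
          by (cases "i = m") auto
        have "((\<lambda>t. (y(m := t)) i - (\<Sum>l<n. L i l * (F (y(m := t)) l - w l))) has_field_derivative
            (if i = m then 1 else 0) - (\<Sum>l<n. L i l * (pderiv_at m (\<lambda>z. F z l) y - 0))) (at (y m))"
          by (intro DERIV_diff DERIV_sum DERIV_cmult DERIV_const dF dy)
        then show "((\<lambda>t. T (y(m := t)) i) has_field_derivative E i m y) (at (y m))"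
          using E_eq[OF i m] i by (simp add: T_def)
      qed
      then show ?thesis by simp
    qed
    have sub: "cpolydisc n p \<rho> \<subseteq> polydisc n p (2 * \<rho>)"
      using \<rho>(1) by (force simp: cpolydisc_def polydisc_def)
    have pin: "p \<in> cpolydisc n p \<rho>" using p \<rho>(1) by (simp add: cpolydisc_def)
    have Tself: "T z \<in> cpolydisc n p \<rho>" if z: "z \<in> cpolydisc n p \<rho>" for z
    proof -
      have "cmod (T z i - p i) \<le> \<rho>" if i: "i < n" for i
      proof -
        have "cmod (T z i - T p i) \<le> 1 / (2 * N) * (\<Sum>m<n. cmod (z m - p m))"
          using z pin sub i by (intro contr) auto
        also have "(\<Sum>m<n. cmod (z m - p m)) \<le> real (card {..<n}) * \<rho>"
          using z by (intro sum_bounded_above) (simp add: cpolydisc_def)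
        then have "1 / (2 * N) * (\<Sum>m<n. cmod (z m - p m)) \<le> 1 / (2 * N) * (N * \<rho>)"
          using N by (intro mult_left_mono) (simp_all add: N_def)
        finally have 1: "cmod (T z i - T p i) \<le> \<rho> / 2"
          using N by simp
        have "cmod (T p i - p i) = cmod (\<Sum>l<n. L i l * (F p l - w l))"
          using i by (simp add: T_def)
        also have "\<dots> \<le> (\<Sum>l<n. K * \<delta>)"
        proof (rule sum_norm_le)
          fix l assume "l \<in> {..<n}"
          then show "cmod (L i l * (F p l - w l)) \<le> K * \<delta>"
            unfolding norm_mult using L(1)[OF i, of l] w(2) K
            by (intro mult_mono) (auto simp: norm_minus_commute less_imp_le)
        qed
        also have "\<dots> = \<rho> / 2" using \<delta>(2) by (simp add: N_def algebra_simps)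
        finally have 2: "cmod (T p i - p i) \<le> \<rho> / 2" .
        have "cmod (T z i - p i) \<le> cmod (T z i - T p i) + cmod (T p i - p i)"
          using norm_triangle_ineq[of "T z i - T p i" "T p i - p i"] by simp
        with 1 2 show ?thesis by simp
      qed
      then show ?thesis by (simp add: cpolydisc_def cspace_def T_def)
    qed
    define D where "D z = (\<Sum>i<n. cmod (T z i - z i))" for z
    have contF: "continuous_on (cpolydisc n p \<rho>) (\<lambda>z. F z l)" for l
      by (rule continuous_on_subset[OF holo_on_continuous[OF F(1)]]) (auto simp: cpolydisc_def)
    have contT: "continuous_on (cpolydisc n p \<rho>) (\<lambda>z. T z i - z i)" if "i < n" for i
    proof -
      have "continuous_on (cpolydisc n p \<rho>) (\<lambda>z. z i - (\<Sum>l<n. L i l * (F z l - w l)) - z i)"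
        by (intro continuous_on_diff continuous_on_sum continuous_on_mult continuous_on_const contF
            holo_on_continuous[OF holo_on_coord])
      with that show ?thesis by (simp add: T_def)
    qed
    have "continuous_on (cpolydisc n p \<rho>) D"
      unfolding D_def by (intro continuous_on_sum continuous_on_norm contT) simp
    then obtain z where z: "z \<in> cpolydisc n p \<rho>" and zmin: "\<And>y. y \<in> cpolydisc n p \<rho> \<Longrightarrow> D z \<le> D y"
      using continuous_attains_inf[OF compact_cpolydisc] pin by blast
    have z2: "z \<in> polydisc n p (2 * \<rho>)" using z sub by blast
    have "D (T z) \<le> (\<Sum>i<n. 1 / (2 * N) * (\<Sum>m<n. cmod (T z m - z m)))"
      unfolding D_def using z z2 Tself[OF z] sub by (intro sum_mono contr) auto
    also have "\<dots> = D z / 2" using N by (simp add: D_def N_def)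
    finally have "D z \<le> D z / 2"
      using zmin[OF Tself[OF z]] by simp
    moreover have "D z \<ge> 0" by (simp add: D_def sum_nonneg)
    ultimately have "D z = 0" by simp
    then have fix_T: "T z i = z i" if "i < n" for i
      using that by (simp add: D_def sum_nonneg_eq_0_iff)
    have zc: "z \<in> cspace n" using z by (simp add: cpolydisc_def)
    have "F z = w"
    proof (rule cspace_eqI[OF F(2)[OF zc] w(1)])
      fix k assume k: "k < n"
      have y0: "(\<Sum>l<n. L i l * (F z l - w l)) = 0" if "i < n" for i
        using fix_T[OF that] that by (simp add: T_def)
      have "0 = (\<Sum>i<n. pderiv_at i (\<lambda>z. F z k) p * (\<Sum>l<n. L i l * (F z l - w l)))"
        using y0 by simp
      also have "\<dots> = (\<Sum>l<n. (\<Sum>i<n. pderiv_at i (\<lambda>z. F z k) p * L i l) * (F z l - w l))"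
        by (simp add: sum_distrib_left sum_distrib_right mult.assoc) (rule sum.swap)
      also have "\<dots> = (\<Sum>l<n. (if k = l then 1 else 0) * (F z l - w l))"
        using L(3)[OF k] by (intro sum.cong) auto
      also have "\<dots> = F z k - w k"
        using k by (subst sum.remove[of _ k]) auto
      finally show "F z k = w k" by simp
    qed
    moreover have "det (jacobian n F z) \<noteq> 0"
      unfolding jacobian_def
    proof (rule det_nonzero_columns_independent)
      fix \<xi> assume \<xi>: "\<And>l. l < n \<Longrightarrow> (\<Sum>m<n. pderiv_at m (\<lambda>z. F z l) z * \<xi> m) = 0"
      define S where "S = (\<Sum>m<n. cmod (\<xi> m))"
      have "cmod (\<xi> i) \<le> 1 / (2 * N) * S" if i: "i < n" for i
      proof -
        have "(\<Sum>m<n. E i m z * \<xi> m) =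
            (\<Sum>m<n. (if i = m then 1 else 0) * \<xi> m) - (\<Sum>m<n. (\<Sum>l<n. L i l * pderiv_at m (\<lambda>z. F z l) z) * \<xi> m)"
          using E_eq[OF i] by (simp add: left_diff_distrib sum_subtractf)
        also have "(\<Sum>m<n. (if i = m then 1 else 0) * \<xi> m) = \<xi> i"
          using i by (subst sum.remove[of _ i]) auto
        also have "(\<Sum>m<n. (\<Sum>l<n. L i l * pderiv_at m (\<lambda>z. F z l) z) * \<xi> m) =
            (\<Sum>l<n. L i l * (\<Sum>m<n. pderiv_at m (\<lambda>z. F z l) z * \<xi> m))"
          by (simp add: sum_distrib_left sum_distrib_right mult.assoc) (rule sum.swap)
        also have "\<dots> = 0" using \<xi> by simp
        finally have "\<xi> i = (\<Sum>m<n. E i m z * \<xi> m)" by simp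
        also have "cmod \<dots> \<le> (\<Sum>m<n. 1 / (2 * N) * cmod (\<xi> m))"
        proof (rule sum_norm_le)
          show "cmod (E i m z * \<xi> m) \<le> 1 / (2 * N) * cmod (\<xi> m)" if "m \<in> {..<n}" for m
            unfolding norm_mult using E[OF z2 i, of m] that by (intro mult_right_mono) auto
        qed
        finally show ?thesis by (simp add: S_def sum_distrib_left)
      qed
      then have "S \<le> (\<Sum>i<n. 1 / (2 * N) * S)"
        unfolding S_def by (intro sum_mono) auto
      also have "\<dots> = S / 2" using N by (simp add: N_def)
      finally have "S \<le> 0" by simp
      then have "S = 0" by (simp add: S_def sum_nonneg order_antisym)
      then show "\<forall>i<n. \<xi> i = 0"
        by (simp add: S_def sum_nonneg_eq_0_iff)
    qed
    ultimately show "\<exists>z\<in>cspace n. F z = w \<and> det (jacobian n F z) \<noteq> 0"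
      using zc by blast
  qed
qed


section \<open>Unavoidable sets\<close>

text \<open>By normality, functions that become small near 1 would have a limit vanishing identically there, hence
  everywhere by the identity theorem, although they are not small at 0.\<close>

lemma uniform_lower_bound:
  fixes \<rho> s M :: real
  assumes \<rho>: "\<rho> > 1" and s: "s > 0"
  shows "\<exists>\<eta>>0. \<forall>g. g holomorphic_on ball 0 \<rho> \<and> (\<forall>t\<in>ball 0 \<rho>. cmod (g t) \<le> M) \<and> cmod (g 0) \<ge> 1 \<longrightarrow>
      (\<exists>t\<in>ball 0 \<rho>. cmod (t - 1) < s \<and> cmod (g t) \<ge> \<eta>)"
proof (rule ccontr)
  assume neg: "\<not> ?thesis"
  define S where "S = ball (0 :: complex) \<rho>"
  have "\<exists>g. g holomorphic_on S \<and> (\<forall>t\<in>S. cmod (g t) \<le> M) \<and> cmod (g 0) \<ge> 1 \<and>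
      (\<forall>t\<in>S. cmod (t - 1) < s \<longrightarrow> cmod (g t) < 1 / real (Suc k))" for k
  proof -
    have "1 / real (Suc k) > 0" by simp
    with neg show ?thesis
      unfolding S_def by (metis linorder_not_le)
  qed
  then obtain g where g: "\<And>k. g k holomorphic_on S" "\<And>k t. t \<in> S \<Longrightarrow> cmod (g k t) \<le> M"
    "\<And>k. cmod (g k 0) \<ge> 1" "\<And>k t. t \<in> S \<Longrightarrow> cmod (t - 1) < s \<Longrightarrow> cmod (g k t) < 1 / real (Suc k)"
    by metis
  obtain G r where G: "G holomorphic_on S" "strict_mono r"
    and lim: "\<And>t. t \<in> S \<Longrightarrow> (\<lambda>k. g (r k) t) \<longlonglongrightarrow> G t"
  proof (rule Montel[of S "{h. h holomorphic_on S \<and> (\<forall>t\<in>S. cmod (h t) \<le> M)}" g])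
    show "range g \<subseteq> {h. h holomorphic_on S \<and> (\<forall>t\<in>S. cmod (h t) \<le> M)}"
      using g by auto
    show "\<exists>B. \<forall>h\<in>{h. h holomorphic_on S \<and> (\<forall>t\<in>S. cmod (h t) \<le> M)}. \<forall>z\<in>K. cmod (h z) \<le> B"
      if "compact K" "K \<subseteq> S" for K
      using that by blast
  qed (auto simp: S_def)
  define U where "U = S \<inter> ball 1 s"
  have "open U" "1 \<in> U" using \<rho> s by (auto simp: U_def S_def)
  have "G 0 = 0"
  proof (rule analytic_continuation[of G S U 1])
    show "G t = 0" if "t \<in> U" for t
    proof -
      have t: "t \<in> S" "cmod (t - 1) < s"
        using that by (auto simp: U_def dist_norm norm_minus_commute)
      have "(\<lambda>k. g (r k) t) \<longlonglongrightarrow> 0"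
      proof (rule Lim_null_comparison)
        show "\<forall>\<^sub>F k in sequentially. cmod (g (r k) t) \<le> inverse (real (Suc k))"
        proof (intro always_eventually allI)
          fix k
          have "cmod (g (r k) t) < 1 / real (Suc (r k))" by (rule g(4)[OF t])
          also have "\<dots> \<le> 1 / real (Suc k)"
            using seq_suble[OF G(2), of k] by (intro divide_left_mono) auto
          finally show "cmod (g (r k) t) \<le> inverse (real (Suc k))"
            by (simp add: inverse_eq_divide)
        qed
      qed (rule LIMSEQ_inverse_real_of_nat)
      with lim[OF t(1)] show ?thesis by (rule LIMSEQ_unique)
    qed
    show "1 islimpt U"
      using \<open>open U\<close> \<open>1 \<in> U\<close> by (simp add: interior_limit_point interior_open)
  qed (use G \<rho> in \<open>auto simp: U_def S_def\<close>)
  moreover have "cmod (G 0) \<ge> 1"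
  proof (rule LIMSEQ_le_const[OF tendsto_norm[OF lim]])
    show "0 \<in> S" using \<rho> by (simp add: S_def)
  qed (use g(3) in blast)
  ultimately show False by simp
qed

lemma holomorphic_along_line:
  assumes f: "holo_on n (cspace n) f" and q: "q \<in> cspace n"
  shows "(\<lambda>t. f (\<lambda>i. t * q i)) holomorphic_on S"
proof -
  have "((\<lambda>t. f (\<lambda>i. t * q i)) has_field_derivative (\<Sum>i<n. pderiv_at i f (\<lambda>i. t * q i) * q i)) (at t)" for t
  proof (rule holo_on_chain[OF openin_cspace_whole f])
    show "\<forall>\<^sub>F t in at t. (\<lambda>i. t * q i) \<in> cspace n"
      using q by (intro always_eventually) (simp add: cspace_def)
    show "((\<lambda>t. t * q i) has_field_derivative q i) (at t)" for i
      by (auto intro!: derivative_eq_intros)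
  qed (use q in \<open>simp add: cspace_def\<close>)
  then have "(\<lambda>t. f (\<lambda>i. t * q i)) holomorphic_on UNIV"
    using holomorphic_on_open by blast
  then show ?thesis by (rule holomorphic_on_subset) simp
qed

text \<open>Near a point that \<open>F\<close> maps far out the Jacobian is bounded below somewhere, by the previous bound on
  the line through the origin. There the inverse function theorem applies with constants that do not depend on \<open>F\<close>.\<close>

lemma escaping_map_covers:
  fixes a b r R :: real
  assumes n: "0 < n" and ab: "0 < a" "a < b" and R: "R > 0"
  shows "\<exists>\<delta>>0. \<forall>F. entire_self_map n F \<and> (\<forall>z\<in>cpolydisc n (\<lambda>_. 0) b. \<forall>i<n. cmod (F z i) \<le> R) \<and>
      cmod (det (jacobian n F (\<lambda>_. 0))) \<ge> 1 \<and> (\<exists>q\<in>cpolydisc n (\<lambda>_. 0) a. \<exists>i<n. cmod (F q i) > r) \<longrightarrow>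
      (\<exists>p\<in>cpolydisc n (\<lambda>_. 0) b. (\<exists>i<n. cmod (F p i) > r - 1) \<and> covers_near n F (F p) \<delta>)"
proof -
  define g where "g = (b - a) / 2"
  define b1 where "b1 = (a + b) / 2"
  have g: "g > 0" "b1 + g = b" and b1: "a < b1" "b1 < b" using ab by (auto simp: g_def b1_def field_simps)
  define M1 where "M1 = 2 * R / g"
  have M1: "M1 > 0" using g R by (simp add: M1_def)
  define MJ where "MJ = fact n * M1 ^ n"
  \<comment> \<open>Moving \<open>q\<close> to \<open>t q\<close> with \<open>|t - 1| < s\<close> changes \<open>F\<close> by at most 1.\<close>
  define s where "s = 1 / (M1 * real n * a)"
  have s: "s > 0" "M1 * (real n * (s * a)) = 1" using M1 n ab by (auto simp: s_def)
  have "b1 / a > 1" using b1 ab by simp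
  from uniform_lower_bound[OF this s(1), of MJ]
  obtain \<eta> where \<eta>: "\<eta> > 0" "\<And>h. h holomorphic_on ball 0 (b1/a) \<Longrightarrow>
      (\<And>t. t \<in> ball 0 (b1/a) \<Longrightarrow> cmod (h t) \<le> MJ) \<Longrightarrow> cmod (h 0) \<ge> 1 \<Longrightarrow>
      \<exists>t\<in>ball 0 (b1/a). cmod (t - 1) < s \<and> cmod (h t) \<ge> \<eta>"
    by metis
  from uniform_local_surjectivity[OF n g(1) R \<eta>(1)]
  obtain \<delta> where \<delta>0: "\<delta> > 0" and \<delta>1: "\<forall>F p. entire_self_map n F \<and> p \<in> cspace n \<and>
      (\<forall>z\<in>polydisc n p g. \<forall>i<n. cmod (F z i) \<le> R) \<and> cmod (det (jacobian n F p)) \<ge> \<eta> \<longrightarrow>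
      covers_near n F (F p) \<delta>"
    by (elim exE conjE) (rule that)
  have \<delta>: "covers_near n F (F p) \<delta>"
    if "entire_self_map n F" "p \<in> cspace n"
      "\<And>z i. z \<in> polydisc n p g \<Longrightarrow> i < n \<Longrightarrow> cmod (F z i) \<le> R" "cmod (det (jacobian n F p)) \<ge> \<eta>" for F p
    using \<delta>1[rule_format, of F p] that by simp
  show ?thesis
  proof (intro exI[of _ \<delta>] conjI allI impI)
    show "\<delta> > 0" by (rule \<delta>0)
    fix F assume A: "entire_self_map n F \<and> (\<forall>z\<in>cpolydisc n (\<lambda>_. 0) b. \<forall>i<n. cmod (F z i) \<le> R) \<and>
      cmod (det (jacobian n F (\<lambda>_. 0))) \<ge> 1 \<and> (\<exists>q\<in>cpolydisc n (\<lambda>_. 0) a. \<exists>i<n. cmod (F q i) > r)"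
    then obtain q i where q: "q \<in> cpolydisc n (\<lambda>_. 0) a" and i: "i < n" "cmod (F q i) > r" by blast
    have F: "holo_on n (cspace n) (\<lambda>z. F z l)" for l
      using A by (simp add: entire_self_map_def)
    have qc: "q \<in> cspace n" using q by (simp add: cpolydisc_def)
    have sub: "polydisc n (\<lambda>_. 0) b \<subseteq> cpolydisc n (\<lambda>_. 0) b"
      by (auto simp: polydisc_def cpolydisc_def less_imp_le)
    have bF: "cmod (F z l) \<le> R" if "z \<in> polydisc n (\<lambda>_. 0) b" "l < n" for z l
      using A that sub by blast
    have d1: "cmod (pderiv_at m (\<lambda>z. F z l) z) \<le> M1" if "z \<in> polydisc n (\<lambda>_. 0) b1" "m < n" "l < n" for z m l
      unfolding M1_def by (rule pderiv_bound_polydisc[OF F _ that(1)]) (use bF that g in auto)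
    have tq: "(\<lambda>i. t * q i) \<in> polydisc n (\<lambda>_. 0) b1" if "t \<in> ball 0 (b1/a)" for t
    proof -
      have "cmod (t * q i) < b1" if "i < n" for i
      proof -
        have "cmod (t * q i) \<le> cmod t * a"
          unfolding norm_mult using q that by (intro mult_left_mono) (auto simp: cpolydisc_def)
        also have "\<dots> < b1"
          using \<open>t \<in> ball 0 (b1/a)\<close> ab by (simp add: less_divide_eq)
        finally show ?thesis .
      qed
      with qc show ?thesis by (simp add: polydisc_def cspace_def)
    qed
    obtain t where t: "t \<in> ball 0 (b1/a)" "cmod (t - 1) < s" "cmod (det (jacobian n F (\<lambda>i. t * q i))) \<ge> \<eta>"
    proof -
      have "\<exists>t\<in>ball 0 (b1/a). cmod (t - 1) < s \<and> cmod (det (jacobian n F (\<lambda>i. t * q i))) \<ge> \<eta>"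
      proof (rule \<eta>(2))
        show "(\<lambda>t. det (jacobian n F (\<lambda>i. t * q i))) holomorphic_on ball 0 (b1/a)"
          by (rule holomorphic_along_line[OF holo_on_det_jacobian[OF openin_cspace_whole F] qc])
        show "cmod (det (jacobian n F (\<lambda>i. t * q i))) \<le> MJ" if "t \<in> ball 0 (b1/a)" for t
          unfolding MJ_def jacobian_def by (rule norm_det_le) (use d1[OF tq[OF that]] in simp)
        show "1 \<le> cmod (det (jacobian n F (\<lambda>i. 0 * q i)))"
          using A by simp
      qed
      with that show thesis by blast
    qed
    define p where "p = (\<lambda>i. t * q i)"
    have p1: "p \<in> polydisc n (\<lambda>_. 0) b1" unfolding p_def by (rule tq[OF t(1)])
    have q1: "q \<in> polydisc n (\<lambda>_. 0) b1"
      using q b1 by (force simp: cpolydisc_def polydisc_def)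
    have "cmod (F p i - F q i) \<le> M1 * (\<Sum>m<n. cmod (p m - q m))"
      by (rule lipschitz_polydisc[OF F d1[OF _ _ i(1)] p1 q1])
    also have "\<dots> \<le> M1 * (real n * (s * a))"
    proof (rule mult_left_mono)
      have "cmod (p m - q m) \<le> s * a" if "m < n" for m
      proof -
        have "cmod (p m - q m) = cmod (t - 1) * cmod (q m)"
          by (simp add: p_def norm_mult[symmetric] algebra_simps)
        also have "\<dots> \<le> s * a"
          using t(2) q that s by (intro mult_mono) (auto simp: cpolydisc_def)
        finally show ?thesis .
      qed
      then show "(\<Sum>m<n. cmod (p m - q m)) \<le> real n * (s * a)"
        using sum_bounded_above[of "{..<n}" "\<lambda>m. cmod (p m - q m)" "s * a"] by simp
    qed (use M1 in simp)
    also have "\<dots> = 1" by (rule s(2))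
    finally have "cmod (F p i - F q i) \<le> 1" .
    then have "cmod (F p i) > r - 1"
      using i(2) norm_triangle_ineq3[of "F p i" "F q i"] by linarith
    moreover have "p \<in> cpolydisc n (\<lambda>_. 0) b"
      using p1 polydisc_mono[of b1 b n "\<lambda>_. 0"] sub b1 by auto
    moreover have "covers_near n F (F p) \<delta>"
    proof (rule \<delta>)
      show "cmod (F z l) \<le> R" if "z \<in> polydisc n p g" "l < n" for z l
        using that polydisc_in_polydisc[OF p1, of g] g(2) bF by auto
      show "\<eta> \<le> cmod (det (jacobian n F p))"
        unfolding p_def by (rule t(3))
    qed (use A p1 in \<open>auto simp: polydisc_def\<close>)
    ultimately show "\<exists>p\<in>cpolydisc n (\<lambda>_. 0) b. (\<exists>i<n. cmod (F p i) > r - 1) \<and> covers_near n F (F p) \<delta>"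
      using i(1) by blast
  qed
qed

lemma finite_net:
  assumes "(\<delta> :: real) > 0"
  obtains N where "finite N" "N \<subseteq> cspace n"
    "\<And>y. y \<in> cpolydisc n (\<lambda>_. 0) R \<Longrightarrow> \<exists>e\<in>N. \<forall>i<n. cmod (y i - e i) < \<delta>"
proof -
  let ?K = "cpolydisc n (\<lambda>_. 0) R"
  define W where "W e = {w :: nat \<Rightarrow> complex. \<forall>i<n. cmod (w i - e i) < \<delta>}" for e
  have "open (W e)" for e
  proof -
    have "open (\<Inter>i<n. {w :: nat \<Rightarrow> complex. cmod (w i - e i) < \<delta>})"
      by (intro open_INT ballI open_Collect_less continuous_intros continuous_on_product_then_coordinatewise) auto
    moreover have "W e = (\<Inter>i<n. {w. cmod (w i - e i) < \<delta>})" by (auto simp: W_def)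
    ultimately show ?thesis by simp
  qed
  moreover have "?K \<subseteq> (\<Union>e\<in>?K. W e)"
    using assms by (auto simp: W_def)
  ultimately obtain N where N: "N \<subseteq> ?K" "finite N" "?K \<subseteq> (\<Union>e\<in>N. W e)"
    using compactE_image[OF compact_cpolydisc] by metis
  show thesis
  proof (rule that[OF N(2)])
    show "N \<subseteq> cspace n" using N(1) by (auto simp: cpolydisc_def)
    show "\<exists>e\<in>N. \<forall>i<n. cmod (y i - e i) < \<delta>" if "y \<in> ?K" for y
      using N(3) that by (auto simp: W_def)
  qed
qed

text \<open>Radii that increase with \<open>k\<close> but stay bounded, so that all levels of the descent stay in a
  fixed polydisc of the source.\<close>

definition shell_radius :: "nat \<Rightarrow> real" where
  "shell_radius k = 2 - 1 / real (Suc k)"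

lemma shell_radius: "0 < shell_radius k" "shell_radius k < shell_radius (Suc k)"
  "shell_radius k \<le> 2" "shell_radius 0 = 1"
proof -
  have "1 / real (Suc k) \<le> 1" by simp
  then show "0 < shell_radius k" unfolding shell_radius_def by linarith
  have "1 / real (Suc (Suc k)) < 1 / real (Suc k)"
    by (intro divide_strict_left_mono) auto
  then show "shell_radius k < shell_radius (Suc k)" unfolding shell_radius_def by linarith
qed (simp_all add: shell_radius_def)

text \<open>A map that escapes covers a ball of a fixed size around one of its values in the shell, and therefore
  a smaller ball around the nearest point of a fine enough net. The extra point \<open>e0\<close> keeps the set
  nonempty, which simplifies its enumeration.\<close>

lemma unavoidable_shell:
  assumes n: "0 < n"
  shows "\<exists>E tol. finite E \<and> E \<noteq> {} \<and> tol > (0 :: real) \<and>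
      (\<forall>e\<in>E. e \<in> cspace n \<and> (\<exists>i<n. cmod (e i) > real k)) \<and>
      (\<forall>F. entire_self_map n F \<and>
       (\<forall>z\<in>cpolydisc n (\<lambda>_. 0) (shell_radius (Suc k)). \<forall>i<n. cmod (F z i) \<le> real k + 3) \<and>
       cmod (det (jacobian n F (\<lambda>_. 0))) \<ge> 1 \<and> \<not> (\<exists>e\<in>E. covers_near n F e tol) \<longrightarrow>
       (\<forall>z\<in>cpolydisc n (\<lambda>_. 0) (shell_radius k). \<forall>i<n. cmod (F z i) \<le> real k + 2))"
proof -
    obtain \<delta> where \<delta>: "\<delta> > 0" and cov: "\<And>F. entire_self_map n F \<Longrightarrow>
        \<forall>z\<in>cpolydisc n (\<lambda>_. 0) (shell_radius (Suc k)). \<forall>i<n. cmod (F z i) \<le> real k + 3 \<Longrightarrow>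
        cmod (det (jacobian n F (\<lambda>_. 0))) \<ge> 1 \<Longrightarrow>
        \<exists>q\<in>cpolydisc n (\<lambda>_. 0) (shell_radius k). \<exists>i<n. cmod (F q i) > real k + 2 \<Longrightarrow>
        \<exists>p\<in>cpolydisc n (\<lambda>_. 0) (shell_radius (Suc k)).
          (\<exists>i<n. cmod (F p i) > real k + 2 - 1) \<and> covers_near n F (F p) \<delta>"
      using escaping_map_covers[OF n shell_radius(1,2)[of k], of "real k + 3" "real k + 2"] by (auto 0 0)
    define tol where "tol = min (\<delta>/2) 1"
    have tol: "tol > 0" "tol \<le> \<delta>/2" "tol \<le> 1" using \<delta> by (auto simp: tol_def)
    obtain N where N: "finite N" "N \<subseteq> cspace n"
      "\<And>y. y \<in> cpolydisc n (\<lambda>_. 0) (real k + 3) \<Longrightarrow> \<exists>e\<in>N. \<forall>i<n. cmod (y i - e i) < tol"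
      using finite_net[OF tol(1)] by metis
    define e0 :: "nat \<Rightarrow> complex" where "e0 = (\<lambda>i. if i = 0 then complex_of_real (real k + 1) else 0)"
    have e0: "e0 \<in> cspace n" "cmod (e0 0) > real k"
      using n norm_of_real[of "real k + 1", where 'a = complex] by (auto simp: e0_def cspace_def)
    define E where "E = insert e0 {e \<in> N. \<exists>i<n. cmod (e i) > real k}"
    show ?thesis
    proof (intro exI[of _ E] exI[of _ tol] conjI allI impI)
      show "finite E" "E \<noteq> {}" "tol > 0" using N tol by (auto simp: E_def)
      show "\<forall>e\<in>E. e \<in> cspace n \<and> (\<exists>i<n. cmod (e i) > real k)"
        using N(2) e0 n by (auto simp: E_def)
      fix F assume A: "entire_self_map n F \<and>
       (\<forall>z\<in>cpolydisc n (\<lambda>_. 0) (shell_radius (Suc k)). \<forall>i<n. cmod (F z i) \<le> real k + 3) \<and>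
       cmod (det (jacobian n F (\<lambda>_. 0))) \<ge> 1 \<and> \<not> (\<exists>e\<in>E. covers_near n F e tol)"
      show "\<forall>z\<in>cpolydisc n (\<lambda>_. 0) (shell_radius k). \<forall>i<n. cmod (F z i) \<le> real k + 2"
      proof (rule ccontr)
        assume "\<not> ?thesis"
        then have "\<exists>q\<in>cpolydisc n (\<lambda>_. 0) (shell_radius k). \<exists>i<n. cmod (F q i) > real k + 2"
          by (meson linorder_not_le)
        then obtain p i where p: "p \<in> cpolydisc n (\<lambda>_. 0) (shell_radius (Suc k))" "i < n"
          "cmod (F p i) > real k + 1" "covers_near n F (F p) \<delta>"
          using cov[of F] A by auto
        have "F p \<in> cpolydisc n (\<lambda>_. 0) (real k + 3)"
          using A p(1) by (auto simp: cpolydisc_def entire_self_map_def)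
        then obtain e where e: "e \<in> N" "\<And>i. i < n \<Longrightarrow> cmod (F p i - e i) < tol"
          using N(3) by blast
        have "cmod (e i) > real k"
          using e(2)[OF p(2)] p(3) tol(3) norm_triangle_ineq2[of "F p i" "e i"] by linarith
        then have eE: "e \<in> E" using e(1) p(2) by (auto simp: E_def)
        have "covers_near n F e tol"
          unfolding covers_near_def
        proof (intro ballI impI)
          fix w assume w: "w \<in> cspace n" "\<forall>i<n. cmod (w i - e i) < tol"
          have "cmod (w i - F p i) < \<delta>" if "i < n" for i
          proof -
            have "cmod (w i - F p i) \<le> cmod (w i - e i) + cmod (F p i - e i)"
              using norm_triangle_ineq4[of "w i - e i" "F p i - e i"] by simp
            also have "\<dots> < tol + tol"
              using w(2) e(2) that by (intro add_strict_mono) auto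
            finally show ?thesis using tol(2) by simp
          qed
          then show "\<exists>z\<in>cspace n. F z = w \<and> det (jacobian n F z) \<noteq> 0"
            using p(4) w(1) unfolding covers_near_def by blast
        qed
        with A eE show False by blast
      qed
    qed
  qed
lemma entire_self_map_affine:
  assumes F: "entire_self_map n F" and z0: "z0 \<in> cspace n"
  shows "entire_self_map n (\<lambda>z. F (\<lambda>i. z0 i + c * z i))"
    and "z \<in> cspace n \<Longrightarrow>
      det (jacobian n (\<lambda>z. F (\<lambda>i. z0 i + c * z i)) z) = det (jacobian n F (\<lambda>i. z0 i + c * z i)) * c ^ n"
proof -
  have A: "holo_on n (cspace n) (\<lambda>z. z0 i + c * z i)" for i
    by (intro holo_on_intros)
  have Ac: "(\<lambda>i. z0 i + c * z i) \<in> cspace n" if "z \<in> cspace n" for z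
    by (rule line_in_cspace[OF z0 that])
  have Fi: "holo_on n (cspace n) (\<lambda>z. F z i)" for i
    using F by (simp add: entire_self_map_def)
  show "entire_self_map n (\<lambda>z. F (\<lambda>i. z0 i + c * z i))"
    unfolding entire_self_map_def
  proof (intro conjI allI ballI)
    show "holo_on n (cspace n) (\<lambda>z. F (\<lambda>i. z0 i + c * z i) l)" for l
      by (rule holo_on_compose[OF openin_cspace_whole Fi openin_cspace_whole A Ac])
    show "F (\<lambda>i. z0 i + c * z i) \<in> cspace n" if "z \<in> cspace n" for z
      using F Ac[OF that] by (simp add: entire_self_map_def)
  qed
  assume z: "z \<in> cspace n"
  have "jacobian n (\<lambda>z i. z0 i + c * z i) z = c \<cdot>\<^sub>m 1\<^sub>m n"
  proof (rule eq_matI)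
    fix j i assume "j < dim_row (c \<cdot>\<^sub>m 1\<^sub>m n)" "i < dim_col (c \<cdot>\<^sub>m 1\<^sub>m n)"
    then have ij: "j < n" "i < n" by auto
    have "((\<lambda>s. (z(i := s)) j) has_field_derivative (if j = i then 1 else 0)) (at (z i))"
      by (cases "j = i") auto
    then have "((\<lambda>s. z0 j + c * (z(i := s)) j) has_field_derivative 0 + c * (if j = i then 1 else 0)) (at (z i))"
      by (intro DERIV_add DERIV_const DERIV_cmult)
    then have "pderiv_at i (\<lambda>z. z0 j + c * z j) z = 0 + c * (if j = i then 1 else 0)"
      by (rule pderiv_at_eqI)
    with ij show "jacobian n (\<lambda>z i. z0 i + c * z i) z $$ (j, i) = (c \<cdot>\<^sub>m 1\<^sub>m n) $$ (j, i)"
      by (simp add: jacobian_def)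
  qed (simp_all add: jacobian_def)
  then have "det (jacobian n (\<lambda>z i. z0 i + c * z i) z) = c ^ n"
    by simp
  then show "det (jacobian n (\<lambda>z. F (\<lambda>i. z0 i + c * z i)) z) = det (jacobian n F (\<lambda>i. z0 i + c * z i)) * c ^ n"
    using det_jacobian_compose[OF openin_cspace_whole Fi openin_cspace_whole A Ac z] by simp
qed

lemma enumerate_shells:
  fixes E :: "nat \<Rightarrow> 'a set"
  assumes "\<And>k. finite (E k)" "\<And>k. E k \<noteq> {}"
  shows "\<exists>(e :: nat \<Rightarrow> 'a) (x :: nat \<Rightarrow> nat). (\<forall>m. e m \<in> E (x m)) \<and>
    (\<forall>k. \<forall>y\<in>E k. \<exists>m. x m = k \<and> e m = y) \<and> filterlim x at_top sequentially"
proof -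
  define X where "X = (SIGMA k:UNIV. E k)"
  have "countable X"
    unfolding X_def by (rule countable_SIGMA[OF _ countable_finite[OF assms(1)]]) simp
  moreover have "infinite X"
  proof
    assume "finite X"
    then have "finite (fst ` X)" by simp
    moreover have "fst ` X = UNIV"
    proof (intro subset_antisym subsetI UNIV_I)
      fix k
      obtain y where "y \<in> E k" using assms(2) by blast
      then show "k \<in> fst ` X"
        unfolding X_def by (intro image_eqI[of _ _ "(k, y)"]) auto
    qed
    ultimately show False by (metis infinite_UNIV_nat)
  qed
  ultimately obtain b where b: "bij_betw b (UNIV :: nat set) X"
    using countableE_infinite[of X] bij_betw_inv by metis
  show ?thesis
  proof (intro exI[of _ "snd \<circ> b"] exI[of _ "fst \<circ> b"] conjI allI ballI)
    show "(snd \<circ> b) m \<in> E ((fst \<circ> b) m)" for m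
      using bij_betw_apply[OF b, of m] by (auto simp: X_def)
    show "\<exists>m. (fst \<circ> b) m = k \<and> (snd \<circ> b) m = y" if "y \<in> E k" for k y
    proof -
      have "(k, y) \<in> b ` UNIV"
        using that bij_betw_imp_surj_on[OF b] by (simp add: X_def)
      then obtain m where "b m = (k, y)" by auto
      then show ?thesis by (intro exI[of _ m]) simp
    qed
    show "filterlim (fst \<circ> b) at_top sequentially"
      unfolding filterlim_at_top
    proof
      fix Z
      have "finite (SIGMA k:{..<Z}. E k)"
        using assms(1) by (intro finite_SigmaI) auto
      then have "finite (b -` (SIGMA k:{..<Z}. E k))"
        using bij_betw_imp_inj_on[OF b] by (rule finite_vimageI)
      moreover have "{m. (fst \<circ> b) m < Z} \<subseteq> b -` (SIGMA k:{..<Z}. E k)"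
      proof
        fix m assume "m \<in> {m. (fst \<circ> b) m < Z}"
        then show "m \<in> b -` (SIGMA k:{..<Z}. E k)"
          using bij_betw_apply[OF b, of m] by (cases "b m") (auto simp: X_def)
      qed
      ultimately have "finite {m. (fst \<circ> b) m < Z}"
        by (rule finite_subset[rotated])
      then have "\<forall>\<^sub>F m in cofinite. \<not> (fst \<circ> b) m < Z"
        by (simp add: eventually_cofinite)
      then show "\<forall>\<^sub>F m in sequentially. Z \<le> (fst \<circ> b) m"
        by (simp add: cofinite_eq_sequentially not_less)
    qed
  qed
qed

text \<open>A map avoiding all neighbourhoods of the net points is bounded by some \<open>K + 2\<close> on the polydisc of radius
  2. Each shell improves the bound on a slightly smaller polydisc, until on the unit polydisc a bound
  independent of the map remains. This limits the Jacobian at the origin, although it could be made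
  arbitrarily large by the dilation \<open>sc\<close>.\<close>

theorem unavoidable_sequence:
  assumes n: "0 < n"
  obtains e :: "nat \<Rightarrow> nat \<Rightarrow> complex" and tol :: "nat \<Rightarrow> real" and x :: "nat \<Rightarrow> nat" where
    "\<And>m. e m \<in> cspace n" "\<And>m. tol m > 0" "\<And>m. \<exists>i<n. cmod (e m i) > real (x m)"
    "filterlim x at_top sequentially"
    "\<And>F z0 e'. entire_self_map n F \<Longrightarrow> z0 \<in> cspace n \<Longrightarrow> det (jacobian n F z0) \<noteq> 0 \<Longrightarrow>
       (\<And>m. e' m \<in> cspace n) \<Longrightarrow> (\<And>m i. i < n \<Longrightarrow> cmod (e' m i - e m i) < tol m) \<Longrightarrow>
       \<exists>m. \<exists>z\<in>cspace n. F z = e' m \<and> det (jacobian n F z) \<noteq> 0"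
proof -
  obtain E tol where Et: "\<And>k. finite (E k) \<and> E k \<noteq> {} \<and> tol k > (0 :: real) \<and>
      (\<forall>e\<in>E k. e \<in> cspace n \<and> (\<exists>i<n. cmod (e i) > real k)) \<and>
      (\<forall>F. entire_self_map n F \<and>
       (\<forall>z\<in>cpolydisc n (\<lambda>_. 0) (shell_radius (Suc k)). \<forall>i<n. cmod (F z i) \<le> real k + 3) \<and>
       cmod (det (jacobian n F (\<lambda>_. 0))) \<ge> 1 \<and> \<not> (\<exists>e\<in>E k. covers_near n F e (tol k)) \<longrightarrow>
       (\<forall>z\<in>cpolydisc n (\<lambda>_. 0) (shell_radius k). \<forall>i<n. cmod (F z i) \<le> real k + 2))"
    using unavoidable_shell[OF n] by metis
  have E: "finite (E k)" "E k \<noteq> {}" "tol k > 0" for k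
    using Et[of k] by simp_all
  have E': "e \<in> cspace n" "\<exists>i<n. cmod (e i) > real k" if "e \<in> E k" for k e
    using Et[of k] that by simp_all
  have desc: "\<forall>z\<in>cpolydisc n (\<lambda>_. 0) (shell_radius k). \<forall>i<n. cmod (F z i) \<le> real k + 2"
    if "entire_self_map n F"
      "\<forall>z\<in>cpolydisc n (\<lambda>_. 0) (shell_radius (Suc k)). \<forall>i<n. cmod (F z i) \<le> real k + 3"
      "cmod (det (jacobian n F (\<lambda>_. 0))) \<ge> 1" "\<not> (\<exists>e\<in>E k. covers_near n F e (tol k))" for F k
    using Et[of k] that by simp
  obtain e x where ex: "\<And>m. e m \<in> E (x m)" "\<And>k y. y \<in> E k \<Longrightarrow> \<exists>m. x m = k \<and> e m = y"
    "filterlim x at_top sequentially"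
    using enumerate_shells[of E, OF E(1,2)] by blast
  show thesis
  proof (rule that[of e "\<lambda>m. tol (x m)" x])
    show "e m \<in> cspace n" "tol (x m) > 0" "\<exists>i<n. cmod (e m i) > real (x m)" for m
      by (rule E'(1)[OF ex(1)] E(3) E'(2)[OF ex(1)])+
    show "filterlim x at_top sequentially" by (rule ex)
    fix F z0 e'
    assume F: "entire_self_map n F" and z0: "z0 \<in> cspace n" and det: "det (jacobian n F z0) \<noteq> 0"
      and e': "\<And>m. e' m \<in> cspace n" "\<And>m i. i < n \<Longrightarrow> cmod (e' m i - e m i) < tol (x m)"
    show "\<exists>m. \<exists>z\<in>cspace n. F z = e' m \<and> det (jacobian n F z) \<noteq> 0"
    proof (rule ccontr)
      assume miss: "\<not> ?thesis"
      define B where "B = fact n * 4 ^ n + (1 :: real)"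
      have B: "B > 1" by (simp add: B_def)
      define sc where "sc = max 1 (B / cmod (det (jacobian n F z0)))"
      have sc: "sc \<ge> 1" "sc * cmod (det (jacobian n F z0)) \<ge> B"
      proof -
        show "sc \<ge> 1" by (simp add: sc_def)
        have "B / cmod (det (jacobian n F z0)) \<le> sc" by (simp add: sc_def)
        then show "sc * cmod (det (jacobian n F z0)) \<ge> B"
          using det by (simp add: divide_le_eq)
      qed
      define G where "G z = F (\<lambda>i. z0 i + complex_of_real sc * z i)" for z
      have Gdef: "G = (\<lambda>z. F (\<lambda>i. z0 i + complex_of_real sc * z i))" by (rule ext) (rule G_def)
      have G: "entire_self_map n G"
        unfolding Gdef by (rule entire_self_map_affine(1)[OF F z0])
      have Gdet: "det (jacobian n G z) = det (jacobian n F (\<lambda>i. z0 i + complex_of_real sc * z i)) * complex_of_real sc ^ n"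
        if "z \<in> cspace n" for z
        unfolding Gdef by (rule entire_self_map_affine(2)[OF F z0 that])
      have zero: "(\<lambda>_. 0) \<in> cspace n" by (simp add: cspace_def)
      have big: "cmod (det (jacobian n G (\<lambda>_. 0))) \<ge> B"
      proof -
        have "sc \<le> sc ^ n" using sc(1) n by (simp add: self_le_power)
        then have "sc * cmod (det (jacobian n F z0)) \<le> sc ^ n * cmod (det (jacobian n F z0))"
          by (intro mult_right_mono) auto
        moreover have "cmod (det (jacobian n G (\<lambda>_. 0))) = sc ^ n * cmod (det (jacobian n F z0))"
          using Gdet[OF zero] sc(1) by (simp add: norm_mult norm_power)
        ultimately show ?thesis using sc(2) by linarith
      qed
      have avoid: "\<not> (\<exists>y\<in>E k. covers_near n G y (tol k))" for k
      proof
        assume "\<exists>y\<in>E k. covers_near n G y (tol k)"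
        then obtain y where y: "y \<in> E k" "covers_near n G y (tol k)" by blast
        obtain m where m: "x m = k" "e m = y" using ex(2)[OF y(1)] by blast
        obtain z where z: "z \<in> cspace n" "G z = e' m" "det (jacobian n G z) \<noteq> 0"
          using y(2) e'(1)[of m] e'(2)[of _ m] unfolding covers_near_def m(1)[symmetric] m(2)[symmetric] by blast
        then have "det (jacobian n F (\<lambda>i. z0 i + complex_of_real sc * z i)) \<noteq> 0"
          using Gdet by auto
        with miss z(2) line_in_cspace[OF z0 z(1)] show False
          unfolding G_def by blast
      qed
      define P where "P k \<longleftrightarrow> (\<forall>z\<in>cpolydisc n (\<lambda>_. 0) (shell_radius k). \<forall>i<n. cmod (G z i) \<le> real k + 2)" for k
      have Gi: "holo_on n (cspace n) (\<lambda>z. G z i)" for i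
        using G by (simp add: entire_self_map_def)
      have "\<exists>K. P K"
      proof -
        have "continuous_on (cpolydisc n (\<lambda>_. 0) 2) (\<lambda>z. \<Sum>i<n. cmod (G z i))"
          by (intro continuous_on_sum continuous_on_norm continuous_on_subset[OF holo_on_continuous[OF Gi]])
            (auto simp: cpolydisc_def)
        from compact_imp_bounded[OF compact_continuous_image[OF this compact_cpolydisc]]
        obtain C where C0: "\<forall>y\<in>(\<lambda>z. \<Sum>i<n. cmod (G z i)) ` cpolydisc n (\<lambda>_. 0) 2. norm y \<le> C"
          unfolding bounded_iff by (elim exE) (rule that)
        have C: "(\<Sum>i<n. cmod (G z i)) \<le> C" if "z \<in> cpolydisc n (\<lambda>_. 0) 2" for z
          using bspec[OF C0 imageI[OF that]] by (simp only: real_norm_def)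
        obtain K :: nat where K: "C \<le> real K" using real_arch_simple by blast
        have "P K"
          unfolding P_def
        proof (intro ballI allI impI)
          fix z i assume z: "z \<in> cpolydisc n (\<lambda>_. 0) (shell_radius K)" and i: "i < n"
          have "z \<in> cpolydisc n (\<lambda>_. 0) 2"
            using z shell_radius(3)[of K] by (force simp: cpolydisc_def)
          then have "cmod (G z i) \<le> C"
            using C[of z] i member_le_sum[of i "{..<n}" "\<lambda>i. cmod (G z i)"] by simp
          with K show "cmod (G z i) \<le> real K + 2" by linarith
        qed
        then show ?thesis ..
      qed
      then obtain K where "P K" ..
      moreover have "P k" if "P (Suc k)" for k
        unfolding P_def
      proof (rule desc[OF G _ _ avoid])
        show "\<forall>z\<in>cpolydisc n (\<lambda>_. 0) (shell_radius (Suc k)). \<forall>i<n. cmod (G z i) \<le> real k + 3"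
          using that unfolding P_def by (simp add: add.commute add.left_commute)
        show "1 \<le> cmod (det (jacobian n G (\<lambda>_. 0)))"
          using big B by linarith
      qed
      ultimately have "P 0"
        by (induction K) blast+
      then have bG: "cmod (G z i) \<le> 2" if "z \<in> cpolydisc n (\<lambda>_. 0) 1" "i < n" for z i
        using that by (simp add: P_def shell_radius(4))
      have "cmod (pderiv_at i (\<lambda>z. G z l) (\<lambda>_. 0)) \<le> 2 * 2 / 1" if "i < n" "l < n" for i l
        by (rule pderiv_bound[OF openin_cspace_whole Gi polydisc_subset_cspace _ zero])
          (use that in \<open>auto intro!: bG simp: polydisc_def cpolydisc_def less_imp_le\<close>)
      then have "cmod (det (jacobian n G (\<lambda>_. 0))) \<le> fact n * 4 ^ n"
        unfolding jacobian_def by (intro norm_det_le) simp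
      with big show False by (simp add: B_def)
    qed
  qed
qed


section \<open>A proper curve near a prescribed sequence\<close>

text \<open>The cubic \<open>3 x\<^sup>2 - 2 x\<^sup>3\<close> has super-attracting fixed points at 0 and 1. Its iterates are
  polynomials that are nearly 0 on a disc around 0 and nearly 1 on a disc around 1.\<close>

lemma polynomial_cutoff:
  assumes "\<epsilon> > 0"
  obtains p :: "complex poly" where "degree p \<ge> 1"
    "\<And>x. cmod x \<le> 1/4 \<Longrightarrow> cmod (poly p x) \<le> \<epsilon>"
    "\<And>x. cmod (x - 1) \<le> 1/4 \<Longrightarrow> cmod (poly p x - 1) \<le> \<epsilon>"
proof -
  define h :: "complex poly" where "h = [:0, 0, 3, -2:]"
  define H where "H N = ((pcompose h) ^^ N) [:0, 1:]" for N
  have poly_h: "poly h x = x\<^sup>2 * (3 - 2 * x)" for x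
    by (simp add: h_def power2_eq_square algebra_simps)
  have contr: "cmod (poly h x) \<le> 7/8 * cmod x" if "cmod x \<le> 1/4" for x
  proof -
    have "cmod (3 - 2 * x) \<le> 3 + 2 * cmod x"
      using norm_triangle_ineq4[of 3 "2 * x"] by (simp add: norm_mult)
    then have "cmod x * cmod (3 - 2 * x) \<le> 1/4 * (7/2)"
      using that by (intro mult_mono) auto
    then have "cmod x * (cmod x * cmod (3 - 2 * x)) \<le> cmod x * (7/8)"
      by (intro mult_left_mono) auto
    then show ?thesis
      by (simp add: poly_h norm_mult norm_power power2_eq_square mult.assoc mult.commute)
  qed
  have sym: "poly h x - 1 = - poly h (1 - x)" for x
    by (simp add: poly_h power2_eq_square algebra_simps)
  have step: "poly (H (Suc N)) x = poly h (poly (H N) x)" for N x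
    by (simp add: H_def poly_pcompose)
  have H0: "cmod (poly (H N) x) \<le> (7/8) ^ N * (1/4)" if "cmod x \<le> 1/4" for N x
  proof (induction N)
    case 0
    then show ?case using that by (simp add: H_def)
  next
    case (Suc N)
    have "(7/8 :: real) ^ N * (1/4) \<le> 1/4" by (simp add: power_le_one)
    then have "cmod (poly (H (Suc N)) x) \<le> 7/8 * cmod (poly (H N) x)"
      unfolding step using Suc by (intro contr) linarith
    with Suc show ?case by simp
  qed
  have H1: "cmod (poly (H N) x - 1) \<le> (7/8) ^ N * (1/4)" if "cmod (x - 1) \<le> 1/4" for N x
  proof (induction N)
    case 0
    then show ?case using that by (simp add: H_def)
  next
    case (Suc N)
    have "(7/8 :: real) ^ N * (1/4) \<le> 1/4" by (simp add: power_le_one)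
    then have "cmod (poly h (1 - poly (H N) x)) \<le> 7/8 * cmod (1 - poly (H N) x)"
      using Suc by (intro contr) (simp add: norm_minus_commute)
    with Suc show ?case
      unfolding step sym by (simp add: norm_minus_commute)
  qed
  have deg: "degree (H N) \<ge> 1" for N
  proof (induction N)
    case (Suc N)
    have "degree (H (Suc N)) = degree h * degree (H N)"
      by (simp add: H_def degree_pcompose)
    moreover have "degree h = 3" by (simp add: h_def)
    ultimately show ?case using Suc by simp
  qed (simp add: H_def)
  obtain N where "(7/8 :: real) ^ N < \<epsilon>"
    using real_arch_pow_inv[OF assms, of "7/8"] by auto
  then have N: "(7/8 :: real) ^ N * (1/4) \<le> \<epsilon>"
    using zero_le_power[of "7/8 :: real" N] by linarith
  show thesis
    using that[of "H N"] deg H0 H1 N order_trans by blast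
qed

lemma polynomial_growth:
  fixes p :: "complex poly"
  assumes "degree p \<ge> 2"
  shows "\<exists>r. \<forall>t. cmod t \<ge> r \<longrightarrow> cmod (poly p t) \<ge> cmod t + M"
proof -
  obtain a q' where p: "p = pCons a q'" by (cases p)
  obtain b q where q': "q' = pCons b q" by (cases q')
  have "q \<noteq> 0"
  proof
    assume "q = 0"
    then have "degree p \<le> 1" by (simp add: p q')
    with assms show False by simp
  qed
  from poly_infinity[OF this, of 2 b]
  obtain r where r: "\<And>z. r \<le> cmod z \<Longrightarrow> 2 \<le> cmod (poly q' z)"
    unfolding q' by blast
  show ?thesis
  proof (intro exI[of _ "max r (M + cmod a)"] allI impI)
    fix t assume t: "max r (M + cmod a) \<le> cmod t"
    have "cmod t * 2 \<le> cmod t * cmod (poly q' t)"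
      using t r by (intro mult_left_mono) auto
    moreover have "cmod (t * poly q' t) - cmod a \<le> cmod (poly p t)"
      using norm_diff_ineq[of "t * poly q' t" a] by (simp add: p add.commute)
    ultimately show "cmod t + M \<le> cmod (poly p t)"
      using t by (simp add: norm_mult)
  qed
qed

lemma polynomial_bounded_on_disc:
  fixes P :: "nat \<Rightarrow> complex poly"
  obtains C where "C > 0" "\<And>l t. l < n \<Longrightarrow> cmod t \<le> R \<Longrightarrow> cmod (e l - poly (P l) t) \<le> C"
proof -
  have "\<exists>C. \<forall>t\<in>cball 0 R. cmod (e l - poly (P l) t) \<le> C" for l
  proof -
    have "continuous_on (cball 0 R) (\<lambda>t. e l - poly (P l) t)"
      by (intro continuous_intros)
    from compact_imp_bounded[OF compact_continuous_image[OF this compact_cball]]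
    show ?thesis unfolding bounded_iff by auto
  qed
  then obtain C where C: "\<And>l t. t \<in> cball 0 R \<Longrightarrow> cmod (e l - poly (P l) t) \<le> C l"
    by metis
  show thesis
  proof (rule that[of "1 + (\<Sum>l<n. \<bar>C l\<bar>)"])
    show "0 < 1 + (\<Sum>l<n. \<bar>C l\<bar>)"
      by (intro add_pos_nonneg sum_nonneg) auto
    fix l t assume l: "l < n" and t: "cmod t \<le> R"
    have "cmod (e l - poly (P l) t) \<le> C l" using C t by simp
    also have "\<dots> \<le> (\<Sum>l<n. \<bar>C l\<bar>)"
      using member_le_sum[of l "{..<n}" "\<lambda>l. \<bar>C l\<bar>"] l by simp
    finally show "cmod (e l - poly (P l) t) \<le> 1 + (\<Sum>l<n. \<bar>C l\<bar>)" by simp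
  qed
qed

text \<open>Passing through one more point \<open>e\<close>. Far out, at \<open>c\<close>, one of the first two coordinates \<open>P s\<close> is
  multiplied by \<open>1 - t/c\<close> (up to a correction making its value at \<open>c\<close> right), so that it stays large except
  on a disc around \<open>c\<close>; there all other coordinates are switched to the values of \<open>e\<close>, one of
  which is large. Choosing \<open>s\<close> to be different from the index of that large coordinate is
  possible since both of the first two coordinates tend to infinity.\<close>

lemma polynomial_curve_hit:
  fixes P :: "nat \<Rightarrow> complex poly" and \<rho> \<epsilon> R Rin :: real
  assumes n: "2 \<le> n" and deg: "degree (P 0) \<ge> 2" "degree (P 1) \<ge> 2"
    and out: "\<And>t. cmod t \<ge> R \<Longrightarrow> \<exists>i<n. cmod (poly (P i) t) > \<rho>"
    and e: "i < n" "cmod (e i) > \<rho>" and \<epsilon>: "\<epsilon> > 0"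
  obtains P' :: "nat \<Rightarrow> complex poly" where "degree (P' 0) \<ge> 2" "degree (P' 1) \<ge> 2"
    "\<And>l. n \<le> l \<Longrightarrow> P' l = P l"
    "\<And>l t. cmod t \<le> Rin \<Longrightarrow> cmod (poly (P' l) t - poly (P l) t) \<le> \<epsilon>"
    "\<And>t. cmod t \<ge> R \<Longrightarrow> \<exists>i<n. cmod (poly (P' i) t) > \<rho> - \<epsilon>"
    "\<exists>t. \<forall>l<n. cmod (poly (P' l) t - e l) \<le> \<epsilon>"
proof -
  define s :: nat where "s = (if i = 0 then 1 else 0)"
  have s: "s < n" "s \<noteq> i" "s = 0 \<or> s = 1" using n by (auto simp: s_def)
  have degs: "degree (P s) \<ge> 2" using s deg by auto
  obtain r0 where r0: "\<And>t. cmod t \<ge> r0 \<Longrightarrow> cmod (poly (P s) t) \<ge> cmod t + (5 * cmod (e s) + 4 * \<bar>\<rho>\<bar> + 1)"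
    using polynomial_growth[OF degs] by blast
  \<comment> \<open>Beyond \<open>R'\<close> the coordinate \<open>P s\<close> survives multiplication by \<open>1 - t/c\<close> where this is at least \<open>1/4\<close>,
      and the correction \<open>e s * (t/c)\<close>, in which \<open>|t/c| \<le> 5 |1 - t/c|\<close>.\<close>
  define R' where "R' = max (max Rin r0) 1"
  have R': "R' \<ge> 1" "Rin \<le> R'" "r0 \<le> R'" by (auto simp: R'_def)
  obtain C1 where C1: "C1 > 0" "\<And>l t. l < n \<Longrightarrow> cmod t \<le> R' \<Longrightarrow> cmod (e l - poly (P l) t) \<le> C1"
    using polynomial_bounded_on_disc[of n R' e P] by metis
  define c where "c = max (4 * R') (R' * C1 / \<epsilon>)"
  have c: "c > 0" "4 * R' \<le> c" "R' * C1 \<le> \<epsilon> * c"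
  proof -
    show "4 * R' \<le> c" by (simp add: c_def)
    with R' show "c > 0" by linarith
    have "R' * C1 / \<epsilon> \<le> c" by (simp add: c_def)
    then show "R' * C1 \<le> \<epsilon> * c" using \<epsilon> by (simp add: divide_le_eq mult.commute)
  qed
  obtain C2 where C2: "C2 > 0" "\<And>l t. l < n \<Longrightarrow> cmod t \<le> 2 * c \<Longrightarrow> cmod (e l - poly (P l) t) \<le> C2"
    using polynomial_bounded_on_disc[of n "2 * c" e P] by metis
  obtain \<kappa> :: "complex poly" where \<kappa>: "degree \<kappa> \<ge> 1"
    "\<And>x. cmod x \<le> 1/4 \<Longrightarrow> cmod (poly \<kappa> x) \<le> \<epsilon> / C2"
    "\<And>x. cmod (x - 1) \<le> 1/4 \<Longrightarrow> cmod (poly \<kappa> x - 1) \<le> \<epsilon> / C2"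
    using polynomial_cutoff[of "\<epsilon> / C2"] \<epsilon> C2(1) by (metis divide_pos_pos)
  define cc where "cc = complex_of_real c"
  have cc: "cc \<noteq> 0" "cmod cc = c" using c by (auto simp: cc_def)
  define X where "X = [:0, 1 / cc:]"
  have X: "poly X t = t / cc" "degree X = 1" for t using cc by (auto simp: X_def)
  define \<chi>' where "\<chi>' = pcompose \<kappa> X"
  have \<chi>': "poly \<chi>' t = poly \<kappa> (t / cc)" "degree \<chi>' \<ge> 1" for t
    using \<kappa>(1) X by (auto simp: \<chi>'_def poly_pcompose degree_pcompose)
  define P' where "P' l = (if l < n then P l + ([:e l:] - P l) * (if l = s then X else \<chi>') else P l)" for l
  have P's: "poly (P' s) t = poly (P s) t * (1 - t / cc) + e s * (t / cc)" for t
    using s by (simp add: P'_def X algebra_simps)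
  have P'l: "poly (P' l) t = poly (P l) t + (e l - poly (P l) t) * poly \<kappa> (t / cc)" if "l < n" "l \<noteq> s" for l t
    using that by (simp add: P'_def \<chi>')
  have P'l': "poly (P' l) t - e l = (e l - poly (P l) t) * (poly \<kappa> (t / cc) - 1)" if "l < n" "l \<noteq> s" for l t
    using P'l[OF that] by (simp add: algebra_simps)
  have near: "cmod (poly (P' l) t - poly (P l) t) \<le> \<epsilon>" if t: "cmod t \<le> R'" for l t
  proof -
    have tc: "cmod (t / cc) \<le> 1/4"
      using t c cc by (simp add: norm_divide divide_le_eq)
    consider "l \<ge> n" | "l = s" | "l < n" "l \<noteq> s" by linarith
    then show ?thesis
    proof cases
      case 1
      then show ?thesis using \<epsilon> by (simp add: P'_def)
    next
      case 2
      have "cmod (poly (P' l) t - poly (P l) t) = cmod (e s - poly (P s) t) * (cmod t / c)"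
        using 2 cc by (simp add: P's norm_mult[symmetric] norm_divide[symmetric] algebra_simps flip: cc(2))
      also have "\<dots> \<le> C1 * (R' / c)"
        using C1(2)[OF s(1) t] C1(1) t c by (intro mult_mono divide_right_mono) auto
      also have "\<dots> \<le> \<epsilon>"
        using c by (simp add: divide_le_eq mult.commute)
      finally show ?thesis .
    next
      case 3
      have "cmod (poly (P' l) t - poly (P l) t) = cmod (e l - poly (P l) t) * cmod (poly \<kappa> (t / cc))"
        using P'l[OF 3] by (simp add: norm_mult)
      also have "\<dots> \<le> C2 * (\<epsilon> / C2)"
        using t c R' C2 3 by (intro mult_mono \<kappa>(2) tc C2(2)) auto
      finally show ?thesis using C2 by simp
    qed
  qed
  have in_disc: "cmod (poly (P' l) t - e l) \<le> \<epsilon>" if t: "cmod (t / cc - 1) \<le> 1/4" and l: "l < n" "l \<noteq> s" for l t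
  proof -
    have "cmod (t / cc) \<le> 5/4"
      using t norm_triangle_ineq[of "t / cc - 1" 1] by simp
    then have t2: "cmod t \<le> 2 * c"
      using c cc by (simp add: norm_divide divide_le_eq)
    have "cmod (poly (P' l) t - e l) = cmod (e l - poly (P l) t) * cmod (poly \<kappa> (t / cc) - 1)"
      using P'l'[OF l] by (simp add: norm_mult)
    also have "\<dots> \<le> C2 * (\<epsilon> / C2)"
      using C2 l by (intro mult_mono \<kappa>(3) t C2(2) t2) auto
    finally show ?thesis using C2 by simp
  qed
  have far: "cmod (poly (P' s) t) > \<rho>" if t: "cmod t \<ge> R'" "cmod (t / cc - 1) > 1/4" for t
  proof -
    define u where "u = cmod (1 - t / cc)"
    have u: "u > 1/4" using t(2) by (simp add: u_def norm_minus_commute)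
    have "cmod (t / cc) \<le> 1 + u"
      using norm_triangle_ineq4[of 1 "1 - t / cc"] by (simp add: u_def)
    then have tu: "cmod (t / cc) \<le> 5 * u" using u by linarith
    have big: "cmod (poly (P s) t) \<ge> 5 * cmod (e s) + 4 * \<bar>\<rho>\<bar> + 1"
      using r0[of t] t(1) R' norm_ge_zero[of t] by linarith
    have "cmod (poly (P s) t * (1 - t / cc)) - cmod (e s * (t / cc)) \<le> cmod (poly (P' s) t)"
      unfolding P's by (rule norm_diff_ineq)
    moreover have "cmod (e s * (t / cc)) \<le> cmod (e s) * (5 * u)"
      unfolding norm_mult using tu by (intro mult_left_mono) auto
    moreover have "(5 * cmod (e s) + 4 * \<bar>\<rho>\<bar> + 1) * u \<le> cmod (poly (P s) t * (1 - t / cc))"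
      unfolding norm_mult u_def using big by (intro mult_right_mono) auto
    ultimately have "(4 * \<bar>\<rho>\<bar> + 1) * u \<le> cmod (poly (P' s) t)"
      by (simp add: algebra_simps)
    moreover have "(4 * \<bar>\<rho>\<bar> + 1) * (1/4) < (4 * \<bar>\<rho>\<bar> + 1) * u"
      using u by (intro mult_strict_left_mono) auto
    moreover have "\<rho> < (4 * \<bar>\<rho>\<bar> + 1) * (1/4)"
      using abs_ge_self[of \<rho>] by simp
    ultimately show ?thesis by (meson less_trans less_le_trans)
  qed
  have degP': "degree (P' l) \<ge> 2" if l: "l < n" "degree (P l) \<ge> 2" for l
  proof -
    define Y where "Y = (if l = s then X else \<chi>')"
    have Y: "degree Y \<ge> 1" using X(2) \<chi>'(2) by (simp add: Y_def)
    have d: "degree ([:e l:] - P l) = degree (P l)"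
      using l(2) by (subst diff_conv_add_uminus, subst degree_add_eq_right) auto
    have "degree (([:e l:] - P l) * Y) = degree (P l) + degree Y"
      using d l(2) Y by (subst degree_mult_eq) auto
    then have "degree (P l) < degree (([:e l:] - P l) * Y)" using Y by simp
    then have "degree (P l + ([:e l:] - P l) * Y) = degree (([:e l:] - P l) * Y)"
      by (rule degree_add_eq_right)
    then show ?thesis
      using l \<open>degree (P l) < _\<close> by (simp add: P'_def Y_def[symmetric])
  qed
  show thesis
  proof (rule that[of P'])
    show "degree (P' 0) \<ge> 2" "degree (P' 1) \<ge> 2" using degP' deg n by auto
    show "P' l = P l" if "n \<le> l" for l using that by (simp add: P'_def)
    show "cmod (poly (P' l) t - poly (P l) t) \<le> \<epsilon>" if "cmod t \<le> Rin" for l t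
      using near that R' by simp
    show "\<exists>t. \<forall>l<n. cmod (poly (P' l) t - e l) \<le> \<epsilon>"
    proof (intro exI[of _ cc] allI impI)
      fix l assume "l < n"
      then show "cmod (poly (P' l) cc - e l) \<le> \<epsilon>"
        using in_disc[of cc l] P's[of cc] cc \<epsilon> by (cases "l = s") auto
    qed
    fix t assume t: "R \<le> cmod t"
    consider "cmod t \<le> R'" | "cmod t \<ge> R'" "cmod (t / cc - 1) > 1/4" | "cmod (t / cc - 1) \<le> 1/4" by linarith
    then show "\<exists>i<n. cmod (poly (P' i) t) > \<rho> - \<epsilon>"
    proof cases
      case 1
      obtain i where i: "i < n" "cmod (poly (P i) t) > \<rho>" using out[OF t] by blast
      then have "cmod (poly (P' i) t) > \<rho> - \<epsilon>"
        using near[OF 1, of i] norm_triangle_ineq2[of "poly (P i) t" "poly (P' i) t"]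
        by (simp add: norm_minus_commute)
      with i show ?thesis by blast
    next
      case 2
      with far[OF 2] s \<epsilon> show ?thesis by (intro exI[of _ s]) auto
    next
      case 3
      have "cmod (poly (P' i) t) > \<rho> - \<epsilon>"
        using in_disc[OF 3 e(1)] s(2) e(2) norm_triangle_ineq2[of "e i" "poly (P' i) t"]
        by (simp add: norm_minus_commute)
      with e show ?thesis by blast
    qed
  qed
qed

text \<open>General position: adding a generic linear map to three entire functions yields an injective
  immersion, because the bad linear maps are the values of a difference quotient or of a derivative,
  hence form the image of a smooth map into \<open>\<complex>\<^sup>3\<close> from a lower dimensional space.\<close>

lemma generic_injective_immersion:
  fixes f :: "nat \<Rightarrow> complex \<Rightarrow> complex"
  assumes f: "\<And>l. f l holomorphic_on UNIV" and \<epsilon>: "\<epsilon> > 0"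
  obtains a :: "nat \<Rightarrow> complex" where "\<And>l. cmod (a l) \<le> \<epsilon>"
    "\<And>s t. s \<noteq> t \<Longrightarrow> \<exists>l<3. f l s + a l * s \<noteq> f l t + a l * t"
    "\<And>t. \<exists>l<3. deriv (f l) t + a l \<noteq> 0"
proof -
  define q where "q l = (\<lambda>p :: complex \<times> complex. - (f l (fst p) - f l (snd p)) / (fst p - snd p))" for l
  define S1 where "S1 = (\<lambda>p. (q 0 p, q 1 p, q 2 p)) ` {p. fst p \<noteq> snd p}"
  define S2 where "S2 = (\<lambda>t. (- deriv (f 0) t, - deriv (f 1) t, - deriv (f 2) t)) ` UNIV"
  have fd: "f l differentiable (at x)" for l x
    by (intro field_differentiable_imp_differentiable holomorphic_on_imp_differentiable_at[OF f open_UNIV]) simp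
  have fd': "deriv (f l) differentiable (at x)" for l x
    by (intro field_differentiable_imp_differentiable
        holomorphic_on_imp_differentiable_at[OF holomorphic_deriv[OF f open_UNIV] open_UNIV]) simp
  have qd: "q l differentiable (at p)" if "fst p \<noteq> snd p" for l p
  proof -
    have "(\<lambda>p. f l (fst p)) differentiable (at p)" "(\<lambda>p. f l (snd p)) differentiable (at p)"
      by (rule differentiable_compose[of "f l"]; simp add: fd bounded_linear_imp_differentiable
          bounded_linear_fst bounded_linear_snd)+
    then show ?thesis
      unfolding q_def using that
      by (intro differentiable_divide differentiable_minus differentiable_diff)
        (auto simp: bounded_linear_imp_differentiable bounded_linear_fst bounded_linear_snd)
  qed
  have "negligible S1"
    unfolding S1_def
  proof (rule negligible_differentiable_image_lowdim)
    show "(\<lambda>p. (q 0 p, q 1 p, q 2 p)) differentiable_on {p. fst p \<noteq> snd p}"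
      by (intro differentiable_at_imp_differentiable_on differentiable_Pair qd) auto
  qed simp
  moreover have "negligible S2"
    unfolding S2_def
  proof (rule negligible_differentiable_image_lowdim)
    show "(\<lambda>t. (- deriv (f 0) t, - deriv (f 1) t, - deriv (f 2) t)) differentiable_on UNIV"
      by (intro differentiable_at_imp_differentiable_on differentiable_Pair differentiable_minus fd')
  qed simp
  ultimately have "negligible (S1 \<union> S2)" by (rule negligible_Un)
  then have "\<not> ball 0 \<epsilon> \<subseteq> S1 \<union> S2"
    using open_not_negligible[of "ball (0 :: complex \<times> complex \<times> complex) \<epsilon>"] \<epsilon>
      negligible_subset[of "S1 \<union> S2" "ball 0 \<epsilon>"] by auto
  then obtain b :: "complex \<times> complex \<times> complex" where b: "norm b < \<epsilon>" "b \<notin> S1" "b \<notin> S2"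
    by (auto simp: subset_iff)
  define a where "a l = (if l = 0 then fst b else if l = 1 then fst (snd b) else if l = 2 then snd (snd b) else 0)" for l :: nat
  have b_eq: "b = (a 0, a 1, a 2)" by (simp add: a_def)
  have less3: "(\<exists>l<3. Q l) \<longleftrightarrow> Q 0 \<or> Q 1 \<or> Q 2" for Q :: "nat \<Rightarrow> bool"
    by (auto simp: numeral_3_eq_3 numeral_2_eq_2 less_Suc_eq)
  show thesis
  proof (rule that[of a])
    have "cmod (fst b) \<le> norm b" "norm (snd b) \<le> norm b"
      "cmod (fst (snd b)) \<le> norm (snd b)" "cmod (snd (snd b)) \<le> norm (snd b)"
      using norm_fst_le[of "fst b" "snd b"] norm_snd_le[of "snd b" "fst b"]
        norm_fst_le[of "fst (snd b)" "snd (snd b)"] norm_snd_le[of "snd (snd b)" "fst (snd b)"] by simp_all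
    then show "cmod (a l) \<le> \<epsilon>" for l
      using b(1) \<epsilon> by (auto simp: a_def)
    show "\<exists>l<3. f l s + a l * s \<noteq> f l t + a l * t" if "s \<noteq> t" for s t
    proof (rule ccontr)
      assume neg: "\<not> ?thesis"
      have "a l = q l (s, t)" if "l < 3" for l
      proof -
        have "f l s + a l * s = f l t + a l * t" using neg that by blast
        then have "a l * (s - t) = - (f l s - f l t)" by (simp add: algebra_simps)
        then show ?thesis using \<open>s \<noteq> t\<close> by (simp add: q_def field_simps)
      qed
      then have "b = (\<lambda>p. (q 0 p, q 1 p, q 2 p)) (s, t)" by (simp add: b_eq)
      with \<open>s \<noteq> t\<close> have "b \<in> S1" unfolding S1_def by (intro image_eqI[of _ _ "(s, t)"]) auto
      with b show False by blast
    qed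
    show "\<exists>l<3. deriv (f l) t + a l \<noteq> 0" for t
    proof (rule ccontr)
      assume neg: "\<not> ?thesis"
      have "a l = - deriv (f l) t" if "l < 3" for l
      proof -
        have "deriv (f l) t + a l = 0" using neg that by blast
        then show ?thesis by (metis add.commute add_eq_0_iff)
      qed
      then have "b \<in> S2" unfolding S2_def by (intro image_eqI[of _ _ t]) (auto simp: b_eq)
      with b show False by blast
    qed
  qed
qed

text \<open>By compactness, being an injective immersion on a disc is a quantitative property, and therefore stable
  under small perturbations.\<close>

lemma separation_on_disc:
  fixes f :: "nat \<Rightarrow> complex \<Rightarrow> complex"
  assumes f: "\<And>l. f l holomorphic_on UNIV"
    and inj: "\<And>s t. s \<noteq> t \<Longrightarrow> \<exists>l<m. f l s \<noteq> f l t" and imm: "\<And>t. \<exists>l<m. deriv (f l) t \<noteq> 0"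
  shows "\<exists>\<eta>>0. \<forall>s\<in>cball 0 R. \<forall>t\<in>cball 0 R. \<eta> * cmod (s - t) \<le> (\<Sum>l<m. cmod (f l s - f l t))"
proof (rule ccontr)
  assume neg: "\<not> ?thesis"
  define \<sigma> where "\<sigma> s t = (\<Sum>l<m. cmod (f l s - f l t))" for s t
  have "\<exists>p. p \<in> cball 0 R \<times> cball 0 R \<and> \<sigma> (fst p) (snd p) < inverse (real (Suc k)) * cmod (fst p - snd p)" for k
  proof -
    have "inverse (real (Suc k)) > 0" by simp
    with neg obtain s t where "s \<in> cball 0 R" "t \<in> cball 0 R"
      "\<not> inverse (real (Suc k)) * cmod (s - t) \<le> (\<Sum>l<m. cmod (f l s - f l t))" by blast
    then show ?thesis
      by (intro exI[of _ "(s, t)"]) (simp add: \<sigma>_def)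
  qed
  then obtain p where p: "\<And>k. p k \<in> cball 0 R \<times> cball 0 R"
    "\<And>k. \<sigma> (fst (p k)) (snd (p k)) < inverse (real (Suc k)) * cmod (fst (p k) - snd (p k))" by metis
  have "compact (cball (0 :: complex) R \<times> cball (0 :: complex) R)"
    by (intro compact_Times compact_cball)
  then obtain q r where q: "q \<in> cball 0 R \<times> cball 0 R" "strict_mono r" "(p \<circ> r) \<longlonglongrightarrow> q"
    using p(1) unfolding compact_def by meson
  have ls: "(\<lambda>k. fst (p (r k))) \<longlonglongrightarrow> fst q" and lt: "(\<lambda>k. snd (p (r k))) \<longlonglongrightarrow> snd q"
    using tendsto_fst[OF q(3)] tendsto_snd[OF q(3)] by (simp_all add: comp_def)
  have \<sigma>_small: "\<sigma> (fst (p (r k))) (snd (p (r k))) < inverse (real (Suc k)) * cmod (fst (p (r k)) - snd (p (r k)))" for k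
  proof -
    have "inverse (real (Suc (r k))) \<le> inverse (real (Suc k))"
      using seq_suble[OF q(2), of k] by (intro le_imp_inverse_le) auto
    then have "inverse (real (Suc (r k))) * cmod (fst (p (r k)) - snd (p (r k)))
        \<le> inverse (real (Suc k)) * cmod (fst (p (r k)) - snd (p (r k)))"
      by (intro mult_right_mono) auto
    with p(2)[of "r k"] show ?thesis by linarith
  qed
  have cont: "isCont (f l) x" for l x
    by (intro field_differentiable_imp_continuous_at holomorphic_on_imp_differentiable_at[OF f open_UNIV]) simp
  show False
  proof (cases "fst q = snd q")
    case False
    then obtain l where l: "l < m" "f l (fst q) \<noteq> f l (snd q)" using inj by blast
    have "(\<lambda>k. \<sigma> (fst (p (r k))) (snd (p (r k)))) \<longlonglongrightarrow> \<sigma> (fst q) (snd q)"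
      unfolding \<sigma>_def by (intro tendsto_sum tendsto_norm tendsto_diff isCont_tendsto_compose[OF cont] ls lt)
    moreover have "(\<lambda>k. inverse (real (Suc k)) * cmod (fst (p (r k)) - snd (p (r k)))) \<longlonglongrightarrow> 0 * cmod (fst q - snd q)"
      by (intro tendsto_mult LIMSEQ_inverse_real_of_nat tendsto_norm tendsto_diff ls lt)
    ultimately have "\<sigma> (fst q) (snd q) \<le> 0 * cmod (fst q - snd q)"
      using \<sigma>_small less_imp_le by (intro LIMSEQ_le) blast+
    moreover have "cmod (f l (fst q) - f l (snd q)) \<le> \<sigma> (fst q) (snd q)"
      unfolding \<sigma>_def using l(1) member_le_sum[of l "{..<m}" "\<lambda>l. cmod (f l (fst q) - f l (snd q))"] by simp
    ultimately have "cmod (f l (fst q) - f l (snd q)) \<le> 0 * cmod (fst q - snd q)"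
      by (meson order_trans)
    then show False using l(2) by simp
  next
    case True
    define x where "x = fst q"
    obtain l where l: "l < m" "deriv (f l) x \<noteq> 0" using imm by blast
    define D where "D = deriv (f l) x"
    have "isCont (deriv (f l)) x"
      by (intro field_differentiable_imp_continuous_at
          holomorphic_on_imp_differentiable_at[OF holomorphic_deriv[OF f open_UNIV] open_UNIV]) simp
    then obtain d where d: "d > 0" "\<And>y. dist y x < d \<Longrightarrow> dist (deriv (f l) y) (deriv (f l) x) < cmod D / 2"
      unfolding continuous_at_eps_delta using l(2) by (metis D_def half_gt_zero zero_less_norm_iff)
    have low: "cmod D / 2 * cmod (s - t) \<le> cmod (f l s - f l t)" if st: "s \<in> ball x d" "t \<in> ball x d" for s t
    proof -
      have "cmod ((f l s - D * s) - (f l t - D * t)) \<le> cmod D / 2 * cmod (s - t)"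
      proof (rule field_differentiable_bound[of "ball x d"])
        fix y assume y: "y \<in> ball x d"
        have "(f l has_field_derivative deriv (f l) y) (at y)"
          using holomorphic_derivI[OF f open_UNIV] by simp
        then have "((\<lambda>y. f l y - D * y) has_field_derivative (deriv (f l) y - D * 1)) (at y)"
          by (intro DERIV_diff DERIV_cmult DERIV_ident)
        then show "((\<lambda>y. f l y - D * y) has_field_derivative (deriv (f l) y - D)) (at y within ball x d)"
          unfolding mult_1_right by (rule has_field_derivative_at_within)
        show "cmod (deriv (f l) y - D) \<le> cmod D / 2"
          using d(2)[of y] y by (simp add: dist_norm D_def norm_minus_commute less_imp_le)
      qed (use st in auto)
      moreover have "cmod (D * (s - t)) - cmod (f l s - f l t) \<le> cmod ((f l s - D * s) - (f l t - D * t))"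
        using norm_triangle_ineq3[of "D * (s - t)" "f l s - f l t"]
        by (simp add: algebra_simps norm_minus_commute)
      ultimately show ?thesis by (simp add: norm_mult)
    qed
    have "\<forall>\<^sub>F k in sequentially. dist (fst (p (r k))) x < d \<and> dist (snd (p (r k))) x < d"
      using tendstoD[OF ls d(1)] tendstoD[OF lt d(1)] True by (simp add: x_def eventually_conj)
    moreover have "\<forall>\<^sub>F k in sequentially. inverse (real (Suc k)) < cmod D / 2"
      using l(2) by (intro order_tendstoD(2)[OF LIMSEQ_inverse_real_of_nat]) (simp add: D_def)
    ultimately have "\<forall>\<^sub>F k in sequentially. (dist (fst (p (r k))) x < d \<and> dist (snd (p (r k))) x < d) \<and>
        inverse (real (Suc k)) < cmod D / 2"
      by (rule eventually_conj)
    then obtain k where k: "dist (fst (p (r k))) x < d" "dist (snd (p (r k))) x < d"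
      "inverse (real (Suc k)) < cmod D / 2"
      unfolding eventually_sequentially by blast
    let ?s = "fst (p (r k))" and ?t = "snd (p (r k))"
    have "cmod D / 2 * cmod (?s - ?t) \<le> cmod (f l ?s - f l ?t)"
      using k by (intro low) (auto simp: dist_commute)
    also have "\<dots> \<le> \<sigma> ?s ?t"
      unfolding \<sigma>_def using l(1) member_le_sum[of l "{..<m}" "\<lambda>l. cmod (f l ?s - f l ?t)"] by simp
    also have "\<dots> < inverse (real (Suc k)) * cmod (?s - ?t)" by (rule \<sigma>_small)
    also have "\<dots> \<le> cmod D / 2 * cmod (?s - ?t)"
      using k(3) by (intro mult_right_mono) auto
    finally show False by simp
  qed
qed


text \<open>The radius \<open>R\<close> is chosen before the perturbation: beyond it \<open>P 0\<close> exceeds \<open>\<rho>\<close> by more than \<open>|t|\<close>, which no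
  linear term with coefficient at most 1 can destroy, and on the disc the perturbation is small.\<close>

lemma polynomial_curve_perturbation:
  fixes P :: "nat \<Rightarrow> complex poly" and R0 \<rho> \<epsilon> :: real
  assumes deg: "degree (P 0) \<ge> 2" "degree (P 1) \<ge> 2" and \<epsilon>: "\<epsilon> > 0"
  obtains P' :: "nat \<Rightarrow> complex poly" and R \<eta> :: real where
    "degree (P' 0) \<ge> 2" "degree (P' 1) \<ge> 2" "R \<ge> R0" "\<eta> > 0"
    "\<And>l. l \<ge> 3 \<Longrightarrow> P' l = P l"
    "\<And>l t. cmod t \<le> R \<Longrightarrow> cmod (poly (P' l) t - poly (P l) t) \<le> \<epsilon>"
    "\<And>t. cmod t \<ge> R \<Longrightarrow> cmod (poly (P' 0) t) > \<rho>"
    "\<And>s t. cmod s \<le> R \<Longrightarrow> cmod t \<le> R \<Longrightarrow>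
       \<eta> * cmod (s - t) \<le> (\<Sum>l<3. cmod (poly (P' l) s - poly (P' l) t))"
proof -
  obtain r where r: "\<And>t. cmod t \<ge> r \<Longrightarrow> cmod (poly (P 0) t) \<ge> cmod t + (\<rho> + 1)"
    using polynomial_growth[OF deg(1)] by blast
  define R where "R = max (max R0 r) 1"
  have R: "R \<ge> R0" "R \<ge> r" "R \<ge> 1" by (auto simp: R_def)
  define \<delta> where "\<delta> = min 1 (\<epsilon> / R)"
  have \<delta>: "\<delta> > 0" "\<delta> \<le> 1" "\<delta> * R \<le> \<epsilon>"
  proof -
    show "\<delta> > 0" "\<delta> \<le> 1" using \<epsilon> R by (auto simp: \<delta>_def)
    have "\<delta> \<le> \<epsilon> / R" by (simp add: \<delta>_def)
    then show "\<delta> * R \<le> \<epsilon>" using R by (simp add: le_divide_eq)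
  qed
  have hol: "(\<lambda>t. poly (P l) t) holomorphic_on UNIV" for l
    by (intro holomorphic_intros)
  obtain a where a: "\<And>l. cmod (a l) \<le> \<delta>"
    "\<And>s t. s \<noteq> t \<Longrightarrow> \<exists>l<3. poly (P l) s + a l * s \<noteq> poly (P l) t + a l * t"
    "\<And>t. \<exists>l<3. deriv (poly (P l)) t + a l \<noteq> 0"
    using generic_injective_immersion[of "\<lambda>l. poly (P l)", OF hol \<delta>(1)] by blast
  define P' where "P' l = (if l < 3 then P l + [:0, a l:] else P l)" for l
  have val: "poly (P' l) t = poly (P l) t + a l * t" if "l < 3" for l t
    using that by (simp add: P'_def)
  have degP': "degree (P' l) \<ge> 2" if "degree (P l) \<ge> 2" for l
  proof (cases "l < 3")
    case True
    have "degree [:0, a l:] < degree (P l)"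
      using that by (intro le_less_trans[OF _ less_le_trans[OF _ that]]) (auto intro: degree_pCons_le order_trans)
    then show ?thesis
      using that True by (simp add: P'_def degree_add_eq_left)
  qed (use that in \<open>simp add: P'_def\<close>)
  have close: "cmod (poly (P' l) t - poly (P l) t) \<le> \<delta> * cmod t" for l t
  proof (cases "l < 3")
    case True
    then show ?thesis
      using a(1)[of l] by (simp add: val norm_mult mult_right_mono)
  qed (use \<delta> in \<open>simp add: P'_def\<close>)
  have hol': "(\<lambda>t. poly (P' l) t) holomorphic_on UNIV" for l
    by (intro holomorphic_intros)
  have der: "deriv (poly (P' l)) t = deriv (poly (P l)) t + a l" if "l < 3" for l t
  proof -
    have "((\<lambda>t. poly (P l) t + a l * t) has_field_derivative (deriv (poly (P l)) t + a l * 1)) (at t)"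
      by (intro DERIV_add DERIV_cmult DERIV_ident holomorphic_derivI[OF hol open_UNIV]) simp
    moreover have "poly (P' l) = (\<lambda>t. poly (P l) t + a l * t)"
      using val[OF that] by blast
    ultimately show ?thesis
      by (simp add: DERIV_imp_deriv)
  qed
  have "\<exists>\<eta>>0. \<forall>s\<in>cball 0 R. \<forall>t\<in>cball 0 R. \<eta> * cmod (s - t) \<le> (\<Sum>l<3. cmod (poly (P' l) s - poly (P' l) t))"
  proof (rule separation_on_disc[of "\<lambda>l. poly (P' l)", OF hol'])
    show "\<exists>l<3. poly (P' l) s \<noteq> poly (P' l) t" if "s \<noteq> t" for s t
      using a(2)[OF that] val by metis
    show "\<exists>l<3. deriv (poly (P' l)) t \<noteq> 0" for t
      using a(3)[of t] der by metis
  qed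
  then obtain \<eta> where \<eta>: "\<eta> > 0"
    "\<forall>s\<in>cball 0 R. \<forall>t\<in>cball 0 R. \<eta> * cmod (s - t) \<le> (\<Sum>l<3. cmod (poly (P' l) s - poly (P' l) t))" by blast
  show thesis
  proof (rule that[of P' R \<eta>])
    show "cmod (poly (P' l) t - poly (P l) t) \<le> \<epsilon>" if "cmod t \<le> R" for l t
    proof -
      have "\<delta> * cmod t \<le> \<delta> * R" using that \<delta> by (intro mult_left_mono) auto
      with close[of l t] \<delta>(3) show ?thesis by linarith
    qed
    show "cmod (poly (P' 0) t) > \<rho>" if "R \<le> cmod t" for t
    proof -
      have "\<delta> * cmod t \<le> 1 * cmod t" using \<delta> by (intro mult_right_mono) auto
      then show ?thesis
        using close[of 0 t] r[of t] that R norm_triangle_ineq2[of "poly (P 0) t" "poly (P' 0) t"]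
        by (simp add: norm_minus_commute)
    qed
    show "P' l = P l" if "3 \<le> l" for l using that by (simp add: P'_def)
    show "\<eta> * cmod (s - t) \<le> (\<Sum>l<3. cmod (poly (P' l) s - poly (P' l) t))"
      if "cmod s \<le> R" "cmod t \<le> R" for s t
      using \<eta>(2) that by simp
  qed (use degP' deg R \<eta> in auto)
qed

text \<open>The approximating polynomial curves, together with the radius \<open>R\<close> of the disc on which they have
  settled and the error \<open>\<epsilon>\<close> that all later steps may still cause there.\<close>

definition curve_stage :: "nat \<Rightarrow> real \<Rightarrow> nat \<Rightarrow> (nat \<Rightarrow> complex poly) \<times> real \<times> real \<Rightarrow> bool" where
  "curve_stage n \<rho> m = (\<lambda>(P, R, \<epsilon>). degree (P 0) \<ge> 2 \<and> degree (P 1) \<ge> 2 \<and> (\<forall>l\<ge>n. P l = 0) \<and>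
     R \<ge> real m \<and> 0 < \<epsilon> \<and> \<epsilon> \<le> 1 \<and> (\<forall>t. cmod t \<ge> R \<longrightarrow> (\<exists>i<n. cmod (poly (P i) t) > \<rho>)) \<and>
     (\<forall>s t. cmod s \<le> R \<longrightarrow> cmod t \<le> R \<longrightarrow>
        12 * \<epsilon> * cmod (s - t) \<le> (\<Sum>l<3. cmod (poly (P l) s - poly (P l) t))))"

text \<open>Halving \<open>\<epsilon>\<close> makes the later errors on the disc of radius \<open>R + 1\<close> sum up to at most \<open>\<epsilon>\<close>; the bound \<open>tol/4\<close>
  keeps the limit curve close to the point that has just been reached.\<close>

definition curve_step :: "nat \<Rightarrow> real \<Rightarrow> (nat \<Rightarrow> complex) \<Rightarrow> real \<Rightarrow>
    (nat \<Rightarrow> complex poly) \<times> real \<times> real \<Rightarrow> (nat \<Rightarrow> complex poly) \<times> real \<times> real \<Rightarrow> bool" where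
  "curve_step n \<rho> e tol = (\<lambda>(P, R, \<epsilon>) (P', R', \<epsilon>').
     (\<forall>l t. cmod t \<le> R + 1 \<longrightarrow> cmod (poly (P' l) t - poly (P l) t) \<le> \<epsilon>/2) \<and>
     \<epsilon>' \<le> \<epsilon>/2 \<and> R' \<ge> R + 1 \<and>
     (\<forall>t. cmod t \<ge> R \<and> cmod t \<le> R' \<longrightarrow> (\<exists>i<n. cmod (poly (P' i) t) > \<rho> - 1)) \<and>
     (\<exists>t. cmod t \<le> R' \<and> (\<forall>l<n. cmod (poly (P' l) t - e l) \<le> tol/2)) \<and> \<epsilon>' \<le> tol/4)"

lemma curve_stage_initial:
  assumes "n \<ge> 3"
  shows "\<exists>s. curve_stage n \<rho> 0 s"
proof -
  define P where "P l = (if l < 2 then [:0, 0, 1:] else (0 :: complex poly))" for l :: nat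
  have deg: "degree (P 0) \<ge> 2" "degree (P 1) \<ge> 2" by (auto simp: P_def)
  obtain P' R \<eta> where P': "degree (P' 0) \<ge> 2" "degree (P' 1) \<ge> 2" "R \<ge> 0" "\<eta> > (0 :: real)"
    "\<And>l. l \<ge> 3 \<Longrightarrow> P' l = P l"
    "\<And>l t. cmod t \<le> R \<Longrightarrow> cmod (poly (P' l) t - poly (P l) t) \<le> 1"
    "\<And>t. cmod t \<ge> R \<Longrightarrow> cmod (poly (P' 0) t) > \<rho>"
    "\<And>s t. cmod s \<le> R \<Longrightarrow> cmod t \<le> R \<Longrightarrow>
       \<eta> * cmod (s - t) \<le> (\<Sum>l<3. cmod (poly (P' l) s - poly (P' l) t))"
    by (rule polynomial_curve_perturbation[OF deg, of 1 0 \<rho>]) auto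
  define \<epsilon> where "\<epsilon> = min (\<eta>/12) 1"
  have \<epsilon>: "\<epsilon> > 0" "\<epsilon> \<le> 1" "12 * \<epsilon> \<le> \<eta>" using P'(4) by (auto simp: \<epsilon>_def)
  have "12 * \<epsilon> * cmod (s - t) \<le> (\<Sum>l<3. cmod (poly (P' l) s - poly (P' l) t))"
    if "cmod s \<le> R" "cmod t \<le> R" for s t
  proof -
    have "12 * \<epsilon> * cmod (s - t) \<le> \<eta> * cmod (s - t)" using \<epsilon> by (intro mult_right_mono) auto
    with P'(8)[OF that] show ?thesis by linarith
  qed
  moreover have "\<exists>i<n. cmod (poly (P' i) t) > \<rho>" if "cmod t \<ge> R" for t
    using P'(7)[OF that] assms by (intro exI[of _ 0]) auto
  moreover have "P' l = 0" if "l \<ge> n" for l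
    using P'(5)[of l] that assms by (simp add: P_def)
  ultimately have "curve_stage n \<rho> 0 (P', R, \<epsilon>)"
    using P' \<epsilon> by (simp add: curve_stage_def)
  then show ?thesis ..
qed

lemma curve_stage_step:
  assumes n: "n \<ge> 3" and st: "curve_stage n \<rho> m s" and e: "\<exists>i<n. cmod (e i) > \<rho>" and tol: "tol > 0"
  shows "\<exists>s'. curve_stage n \<rho>' (Suc m) s' \<and> curve_step n \<rho> e tol s s'"
proof -
  obtain P R \<epsilon> where s: "s = (P, R, \<epsilon>)" by (cases s)
  have P: "degree (P 0) \<ge> 2" "degree (P 1) \<ge> 2" "\<And>l. l \<ge> n \<Longrightarrow> P l = 0"
    "R \<ge> real m" "0 < \<epsilon>" "\<epsilon> \<le> 1" "\<And>t. cmod t \<ge> R \<Longrightarrow> \<exists>i<n. cmod (poly (P i) t) > \<rho>"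
    using st by (auto simp: curve_stage_def s)
  obtain i where i: "i < n" "cmod (e i) > \<rho>" using e by blast
  define \<epsilon>1 where "\<epsilon>1 = min (\<epsilon>/4) (tol/4)"
  have \<epsilon>1: "\<epsilon>1 > 0" "\<epsilon>1 \<le> \<epsilon>/4" "\<epsilon>1 \<le> tol/4" using P tol by (auto simp: \<epsilon>1_def)
  obtain P1 where P1: "degree (P1 0) \<ge> 2" "degree (P1 1) \<ge> 2" "\<And>l. n \<le> l \<Longrightarrow> P1 l = P l"
    "\<And>l t. cmod t \<le> R + 1 \<Longrightarrow> cmod (poly (P1 l) t - poly (P l) t) \<le> \<epsilon>1"
    "\<And>t. cmod t \<ge> R \<Longrightarrow> \<exists>i<n. cmod (poly (P1 i) t) > \<rho> - \<epsilon>1"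
    "\<exists>t. \<forall>l<n. cmod (poly (P1 l) t - e l) \<le> \<epsilon>1"
    by (rule polynomial_curve_hit[where n = n and P = P and R = R and \<rho> = \<rho> and i = i and e = e
          and \<epsilon> = \<epsilon>1 and Rin = "R + 1", OF _ P(1,2) P(7) i \<epsilon>1(1)]) (use n in auto)
  obtain t0 where t0: "\<And>l. l < n \<Longrightarrow> cmod (poly (P1 l) t0 - e l) \<le> \<epsilon>1" using P1(6) by blast
  define R0 where "R0 = max (max (R + 1) (cmod t0)) (real (Suc m))"
  obtain P2 R2 \<eta> where P2: "degree (P2 0) \<ge> 2" "degree (P2 1) \<ge> 2" "R2 \<ge> R0" "\<eta> > (0 :: real)"
    "\<And>l. l \<ge> 3 \<Longrightarrow> P2 l = P1 l"
    "\<And>l t. cmod t \<le> R2 \<Longrightarrow> cmod (poly (P2 l) t - poly (P1 l) t) \<le> \<epsilon>1"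
    "\<And>t. cmod t \<ge> R2 \<Longrightarrow> cmod (poly (P2 0) t) > \<rho>'"
    "\<And>s t. cmod s \<le> R2 \<Longrightarrow> cmod t \<le> R2 \<Longrightarrow>
       \<eta> * cmod (s - t) \<le> (\<Sum>l<3. cmod (poly (P2 l) s - poly (P2 l) t))"
    by (rule polynomial_curve_perturbation[OF P1(1,2) \<epsilon>1(1), of R0 \<rho>']) auto
  have R2: "R2 \<ge> R + 1" "cmod t0 \<le> R2" "R2 \<ge> real (Suc m)" using P2(3) by (auto simp: R0_def)
  define \<epsilon>' where "\<epsilon>' = min (\<eta>/12) (min (\<epsilon>/2) (tol/4))"
  have \<epsilon>': "\<epsilon>' > 0" "\<epsilon>' \<le> \<epsilon>/2" "\<epsilon>' \<le> tol/4" "12 * \<epsilon>' \<le> \<eta>"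
    using P2(4) P(5) tol by (auto simp: \<epsilon>'_def)
  have tri: "cmod (x - z) \<le> \<epsilon>1 + \<epsilon>1" if "cmod (x - y) \<le> \<epsilon>1" "cmod (y - z) \<le> \<epsilon>1" for x y z
    using norm_triangle_ineq[of "x - y" "y - z"] that by simp
  have "curve_stage n \<rho>' (Suc m) (P2, R2, \<epsilon>')"
    unfolding curve_stage_def prod.case
  proof (intro conjI allI impI)
    show "P2 l = 0" if "n \<le> l" for l using P2(5)[of l] P1(3)[of l] P(3)[of l] that n by simp
    show "\<epsilon>' \<le> 1" using \<epsilon>'(2) P(5,6) by linarith
    show "\<exists>i<n. cmod (poly (P2 i) t) > \<rho>'" if "R2 \<le> cmod t" for t
      using P2(7)[OF that] n by (intro exI[of _ 0]) auto
    show "12 * \<epsilon>' * cmod (s - t) \<le> (\<Sum>l<3. cmod (poly (P2 l) s - poly (P2 l) t))"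
      if "cmod s \<le> R2" "cmod t \<le> R2" for s t
    proof -
      have "12 * \<epsilon>' * cmod (s - t) \<le> \<eta> * cmod (s - t)" using \<epsilon>' by (intro mult_right_mono) auto
      with P2(8)[OF that] show ?thesis by linarith
    qed
  qed (use P2 R2 \<epsilon>' in auto)
  moreover have "curve_step n \<rho> e tol s (P2, R2, \<epsilon>')"
    unfolding curve_step_def s prod.case
  proof (intro conjI allI impI)
    show "cmod (poly (P2 l) t - poly (P l) t) \<le> \<epsilon>/2" if "cmod t \<le> R + 1" for l t
      using tri[OF P2(6)[of t l] P1(4)[OF that, of l]] that R2(1) \<epsilon>1(2) by linarith
    show "\<exists>i<n. cmod (poly (P2 i) t) > \<rho> - 1" if c: "R \<le> cmod t \<and> cmod t \<le> R2" for t
    proof -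
      obtain i where i: "i < n" "cmod (poly (P1 i) t) > \<rho> - \<epsilon>1" using P1(5)[OF conjunct1[OF c]] by blast
      have "cmod (poly (P2 i) t) > \<rho> - 1"
        using i(2) P2(6)[of t i] c norm_triangle_ineq2[of "poly (P1 i) t" "poly (P2 i) t"] \<epsilon>1(2) P(6)
        by (simp add: norm_minus_commute)
      with i show ?thesis by blast
    qed
    show "\<exists>t. cmod t \<le> R2 \<and> (\<forall>l<n. cmod (poly (P2 l) t - e l) \<le> tol/2)"
    proof (intro exI[of _ t0] conjI allI impI)
      fix l assume "l < n"
      from tri[OF P2(6)[OF R2(2), of l] t0[OF this]] \<epsilon>1(3)
      show "cmod (poly (P2 l) t0 - e l) \<le> tol/2" by linarith
    qed (rule R2)
  qed (use \<epsilon>' R2 in auto)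
  ultimately show ?thesis by blast
qed

text \<open>The polynomial curves converge locally uniformly. Between the radii of two consecutive stages the limit
  is large, so it is proper; the separation constants of the stages survive the remaining errors, so it is
  an injective immersion.\<close>

theorem proper_curve_near_sequence:
  fixes e :: "nat \<Rightarrow> nat \<Rightarrow> complex" and tol :: "nat \<Rightarrow> real" and x :: "nat \<Rightarrow> nat"
  assumes n: "n \<ge> 3" and tol: "\<And>m. tol m > 0" and e: "\<And>m. \<exists>i<n. cmod (e m i) > real (x m)"
    and x: "filterlim x at_top sequentially"
  obtains \<gamma> :: "complex \<Rightarrow> nat \<Rightarrow> complex" where "\<And>t. \<gamma> t \<in> cspace n"
    "\<And>l. (\<lambda>t. \<gamma> t l) holomorphic_on UNIV" "inj \<gamma>" "\<And>t. \<exists>l. deriv (\<lambda>t. \<gamma> t l) t \<noteq> 0"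
    "\<And>M :: real. \<exists>R. \<forall>t. cmod t \<ge> R \<longrightarrow> (\<exists>i<n. cmod (\<gamma> t i) > M)"
    "\<And>m. \<exists>t. \<forall>i<n. cmod (\<gamma> t i - e m i) < tol m"
proof -
  have "\<exists>f. \<forall>m. curve_stage n (real (x m)) m (f m) \<and> curve_step n (real (x m)) (e m) (tol m) (f m) (f (Suc m))"
  proof (rule dependent_nat_choice)
    show "\<exists>s. curve_stage n (real (x 0)) 0 s" by (rule curve_stage_initial[OF n])
    show "\<exists>s'. curve_stage n (real (x (Suc m))) (Suc m) s' \<and> curve_step n (real (x m)) (e m) (tol m) s s'"
      if "curve_stage n (real (x m)) m s" for s m
      by (rule curve_stage_step[OF n that e tol])
  qed
  then obtain f where f: "\<And>m. curve_stage n (real (x m)) m (f m)"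
    "\<And>m. curve_step n (real (x m)) (e m) (tol m) (f m) (f (Suc m))" by blast
  define P where "P m = fst (f m)" for m
  define R where "R m = fst (snd (f m))" for m
  define \<epsilon> where "\<epsilon> m = snd (snd (f m))" for m
  have fm: "f m = (P m, R m, \<epsilon> m)" for m by (simp add: P_def R_def \<epsilon>_def)
  have st: "P m l = 0" if "l \<ge> n" for m l
    using f(1)[of m] that by (simp add: fm curve_stage_def)
  have R: "R m \<ge> real m" and \<epsilon>: "0 < \<epsilon> m" "\<epsilon> m \<le> 1" for m
    using f(1)[of m] by (simp_all add: fm curve_stage_def)
  have sep: "12 * \<epsilon> m * cmod (s - t) \<le> (\<Sum>l<3. cmod (poly (P m l) s - poly (P m l) t))"
    if "cmod s \<le> R m" "cmod t \<le> R m" for m s t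
    using f(1)[of m] that by (simp add: fm curve_stage_def)
  have step: "cmod t \<le> R m + 1 \<Longrightarrow> cmod (poly (P (Suc m) l) t - poly (P m l) t) \<le> \<epsilon> m / 2"
    and \<epsilon>S: "\<epsilon> (Suc m) \<le> \<epsilon> m / 2" "\<epsilon> (Suc m) \<le> tol m / 4" and RS: "R (Suc m) \<ge> R m + 1"
    and large: "R m \<le> cmod t \<Longrightarrow> cmod t \<le> R (Suc m) \<Longrightarrow> \<exists>i<n. cmod (poly (P (Suc m) i) t) > real (x m) - 1"
    and hit: "\<exists>t. cmod t \<le> R (Suc m) \<and> (\<forall>l<n. cmod (poly (P (Suc m) l) t - e m l) \<le> tol m / 2)" for m t l
    using f(2)[of m] by (simp_all add: fm curve_step_def)
  have Rmono: "R m \<le> R (m + j)" for m j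
  proof (induction j)
    case (Suc j)
    then show ?case using RS[of "m + j"] by simp
  qed simp
  have tail: "cmod t \<le> R m + 1 \<Longrightarrow> cmod (poly (P (m + j) l) t - poly (P m l) t) \<le> \<epsilon> m" for j m t l
  proof (induction j arbitrary: m)
    case 0
    then show ?case using \<epsilon>(1)[of m] by simp
  next
    case (Suc j)
    have "cmod t \<le> R (Suc m) + 1" using Suc.prems RS[of m] by linarith
    then have "cmod (poly (P (Suc m + j) l) t - poly (P (Suc m) l) t) \<le> \<epsilon> (Suc m)" by (rule Suc.IH)
    moreover have "cmod (poly (P (Suc m) l) t - poly (P m l) t) \<le> \<epsilon> m / 2" by (rule step[OF Suc.prems])
    ultimately show ?case
      using \<epsilon>S(1)[of m] norm_triangle_ineq[of "poly (P (Suc m + j) l) t - poly (P (Suc m) l) t"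
          "poly (P (Suc m) l) t - poly (P m l) t"] by simp
  qed
  have \<epsilon>pow: "\<epsilon> m \<le> (1/2) ^ m" for m
  proof (induction m)
    case (Suc m)
    then show ?case using \<epsilon>S(1)[of m] by simp
  qed (use \<epsilon> in simp)
  have small: "\<exists>M. \<forall>m\<ge>M. \<epsilon> m < d" if d: "d > 0" for d
  proof -
    obtain M where "(1/2 :: real) ^ M < d" using real_arch_pow_inv[OF d, of "1/2"] by auto
    moreover have "\<epsilon> m \<le> (1/2) ^ M" if "m \<ge> M" for m
      using \<epsilon>pow[of m] power_decreasing[OF that, of "1/2 :: real"] by linarith
    ultimately show ?thesis by (meson le_less_trans)
  qed
  have inR: "cmod t \<le> R m + 1" if "m \<ge> nat \<lceil>cmod t\<rceil>" for t m
  proof -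
    have "cmod t \<le> real (nat \<lceil>cmod t\<rceil>)" by (rule real_nat_ceiling_ge)
    with that R[of m] show ?thesis by linarith
  qed
  define \<gamma> where "\<gamma> t l = lim (\<lambda>m. poly (P m l) t)" for t l
  have lim: "(\<lambda>m. poly (P m l) t) \<longlonglongrightarrow> \<gamma> t l" for t l
  proof -
    have "Cauchy (\<lambda>m. poly (P m l) t)"
    proof (rule metric_CauchyI)
      fix d :: real assume "d > 0"
      then obtain M where M: "\<And>m. m \<ge> M \<Longrightarrow> \<epsilon> m < d/2" using small[of "d/2"] by auto
      define M' where "M' = max M (nat \<lceil>cmod t\<rceil>)"
      have est: "cmod (poly (P m l) t - poly (P M' l) t) < d/2" if "m \<ge> M'" for m
        using tail[OF inR[of t M'], of "m - M'" l] M[of M'] that by (simp add: M'_def)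
      have "dist (poly (P m l) t) (poly (P k l) t) < d" if "m \<ge> M'" "k \<ge> M'" for m k
        using est[OF that(1)] est[OF that(2)]
          norm_triangle_ineq4[of "poly (P m l) t - poly (P M' l) t" "poly (P k l) t - poly (P M' l) t"]
        by (simp add: dist_norm)
      then show "\<exists>M. \<forall>m\<ge>M. \<forall>k\<ge>M. dist (poly (P m l) t) (poly (P k l) t) < d" by blast
    qed
    then show ?thesis
      unfolding \<gamma>_def using Cauchy_convergent convergent_LIMSEQ_iff by blast
  qed
  have close: "cmod (\<gamma> t l - poly (P m l) t) \<le> \<epsilon> m" if "cmod t \<le> R m + 1" for t l m
  proof (rule LIMSEQ_le_const2)
    show "(\<lambda>k. cmod (poly (P k l) t - poly (P m l) t)) \<longlonglongrightarrow> cmod (\<gamma> t l - poly (P m l) t)"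
      by (intro tendsto_norm tendsto_diff lim tendsto_const)
    show "\<exists>N. \<forall>k\<ge>N. cmod (poly (P k l) t - poly (P m l) t) \<le> \<epsilon> m"
      using tail[OF that, of _ l] by (metis le_add_diff_inverse)
  qed
  have hol: "(\<lambda>t. \<gamma> t l) holomorphic_on UNIV" for l
  proof (rule holomorphic_uniform_sequence[OF open_UNIV, where f = "\<lambda>m t. poly (P m l) t"])
    show "(\<lambda>t. poly (P m l) t) holomorphic_on UNIV" for m by (intro holomorphic_intros)
    fix z :: complex
    have "uniform_limit (cball z 1) (\<lambda>m t. poly (P m l) t) (\<lambda>t. \<gamma> t l) sequentially"
    proof (rule uniform_limitI)
      fix d :: real assume "d > 0"
      then obtain M where M: "\<And>m. m \<ge> M \<Longrightarrow> \<epsilon> m < d" using small by blast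
      have "dist (poly (P m l) t) (\<gamma> t l) < d" if m: "m \<ge> max M (nat \<lceil>cmod z\<rceil>)" and t: "t \<in> cball z 1" for m t
      proof -
        have "cmod t \<le> cmod z + 1"
          using t norm_triangle_ineq2[of t z] by (simp add: dist_norm norm_minus_commute)
        moreover have "cmod z \<le> real m"
          using m real_nat_ceiling_ge[of "cmod z"] by linarith
        ultimately have "cmod t \<le> R m + 1" using R[of m] by linarith
        then show ?thesis using close[of t m l] M[of m] m by (simp add: dist_norm norm_minus_commute)
      qed
      then show "\<forall>\<^sub>F m in sequentially. \<forall>t\<in>cball z 1. dist (poly (P m l) t) (\<gamma> t l) < d"
        unfolding eventually_sequentially by blast
    qed
    then show "\<exists>d>0. cball z d \<subseteq> UNIV \<and> uniform_limit (cball z d) (\<lambda>m t. poly (P m l) t) (\<lambda>t. \<gamma> t l) sequentially"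
      by (intro exI[of _ 1]) auto
  qed
  \<comment> \<open>Each of the three coordinates loses at most \<open>\<epsilon>\<close> by Cauchy's estimate on unit discs.\<close>
  have sep\<gamma>: "9 * \<epsilon> m * cmod (s - t) \<le> (\<Sum>l<3. cmod (\<gamma> s l - \<gamma> t l))"
    if st: "cmod s \<le> R m" "cmod t \<le> R m" for m s t
  proof -
    define u where "u l t = \<gamma> t l - poly (P m l) t" for l t
    have hu: "u l holomorphic_on UNIV" for l
      unfolding u_def by (intro holomorphic_intros hol)
    have lip: "cmod (u l s - u l t) \<le> \<epsilon> m * cmod (s - t)" for l
    proof (rule field_differentiable_bound[of "cball 0 (R m)"])
      fix y :: complex assume y: "y \<in> cball 0 (R m)"
      show "(u l has_field_derivative deriv (u l) y) (at y within cball 0 (R m))"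
        by (rule has_field_derivative_at_within[OF holomorphic_derivI[OF hu open_UNIV UNIV_I]])
      have "cmod ((deriv ^^ 1) (u l) y) \<le> fact 1 * \<epsilon> m / 1 ^ 1"
      proof (rule Cauchy_inequality)
        show "u l holomorphic_on ball y 1" using hu by (rule holomorphic_on_subset) simp
        show "continuous_on (cball y 1) (u l)"
          by (rule continuous_on_subset[OF holomorphic_on_imp_continuous_on[OF hu]]) simp
        show "cmod (u l z) \<le> \<epsilon> m" if "cmod (y - z) = 1" for z
        proof -
          have "cmod z \<le> cmod y + cmod (y - z)"
            using norm_triangle_ineq4[of y "y - z"] by simp
          then show ?thesis unfolding u_def using y that by (intro close) simp
        qed
      qed simp
      then show "cmod (deriv (u l) y) \<le> \<epsilon> m" by simp
    qed (use st in auto)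
    have "12 * \<epsilon> m * cmod (s - t) \<le> (\<Sum>l<3. cmod (poly (P m l) s - poly (P m l) t))"
      by (rule sep[OF st])
    also have "\<dots> \<le> (\<Sum>l<3. cmod (\<gamma> s l - \<gamma> t l) + \<epsilon> m * cmod (s - t))"
    proof (rule sum_mono)
      fix l :: nat
      have "poly (P m l) s - poly (P m l) t = (\<gamma> s l - \<gamma> t l) - (u l s - u l t)" by (simp add: u_def)
      then have "cmod (poly (P m l) s - poly (P m l) t) \<le> cmod (\<gamma> s l - \<gamma> t l) + cmod (u l s - u l t)"
        by (simp only: norm_triangle_ineq4)
      with lip[of l] show "cmod (poly (P m l) s - poly (P m l) t) \<le> cmod (\<gamma> s l - \<gamma> t l) + \<epsilon> m * cmod (s - t)"
        by linarith
    qed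
    also have "\<dots> = (\<Sum>l<3. cmod (\<gamma> s l - \<gamma> t l)) + 3 * (\<epsilon> m * cmod (s - t))"
      by (simp add: sum.distrib)
    finally show ?thesis by (simp add: algebra_simps)
  qed
  show thesis
  proof (rule that[of \<gamma>])
    show "\<gamma> t \<in> cspace n" for t
    proof -
      have "\<gamma> t l = 0" if "l \<ge> n" for l
        using lim[of l t] st[OF that] by (simp add: LIMSEQ_unique)
      then show ?thesis by (simp add: cspace_def)
    qed
    show "(\<lambda>t. \<gamma> t l) holomorphic_on UNIV" for l by (rule hol)
    have inS: "cmod t \<le> R m" if "m \<ge> nat \<lceil>cmod t\<rceil>" for t m
      using that R[of m] real_nat_ceiling_ge[of "cmod t"] by linarith
    show "inj \<gamma>"
    proof (rule injI)
      fix s t assume eq: "\<gamma> s = \<gamma> t"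
      define m where "m = max (nat \<lceil>cmod s\<rceil>) (nat \<lceil>cmod t\<rceil>)"
      have "9 * \<epsilon> m * cmod (s - t) \<le> 0"
        using sep\<gamma>[OF inS[of s m] inS[of t m]] eq by (simp add: m_def)
      then show "s = t" using \<epsilon>(1)[of m] by (simp add: mult_le_0_iff)
    qed
    show "\<exists>l. deriv (\<lambda>t. \<gamma> t l) t \<noteq> 0" for t
    proof (rule ccontr)
      assume neg: "\<not> ?thesis"
      define m where "m = Suc (nat \<lceil>cmod t\<rceil>)"
      have tm: "cmod t + 1 \<le> R m"
        using R[of m] real_nat_ceiling_ge[of "cmod t"] unfolding m_def of_nat_Suc by linarith
      have "((\<lambda>s. (\<gamma> s l - \<gamma> t l) / (s - t)) \<longlongrightarrow> 0) (at t)" for l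
      proof -
        have "((\<lambda>s. \<gamma> s l) has_field_derivative deriv (\<lambda>t. \<gamma> t l) t) (at t)"
          by (rule holomorphic_derivI[OF hol open_UNIV]) simp
        with neg show ?thesis by (simp add: has_field_derivative_iff)
      qed
      then have "((\<lambda>s. \<Sum>l<3. cmod ((\<gamma> s l - \<gamma> t l) / (s - t))) \<longlongrightarrow> (\<Sum>l<(3::nat). cmod 0)) (at t)"
        by (intro tendsto_sum tendsto_norm)
      then have "\<forall>\<^sub>F s in at t. (\<Sum>l<3. cmod ((\<gamma> s l - \<gamma> t l) / (s - t))) < \<epsilon> m"
        using \<epsilon>(1)[of m] by (intro order_tendstoD(2)) auto
      moreover have "\<forall>\<^sub>F s in at t. s \<noteq> t \<and> cmod (s - t) < 1"
        unfolding eventually_at by (intro exI[of _ 1]) (simp add: dist_norm)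
      ultimately have "\<forall>\<^sub>F s in at t. False"
      proof eventually_elim
        case (elim s)
        have "cmod s \<le> R m"
          using elim tm norm_triangle_ineq2[of s t] by linarith
        then have "9 * \<epsilon> m * cmod (s - t) \<le> (\<Sum>l<3. cmod (\<gamma> s l - \<gamma> t l))"
          using tm by (intro sep\<gamma>) auto
        moreover have "(\<Sum>l<3. cmod ((\<gamma> s l - \<gamma> t l) / (s - t))) = (\<Sum>l<3. cmod (\<gamma> s l - \<gamma> t l)) / cmod (s - t)"
          by (simp add: norm_divide sum_divide_distrib)
        ultimately have "9 * \<epsilon> m \<le> (\<Sum>l<3. cmod ((\<gamma> s l - \<gamma> t l) / (s - t)))"
          using elim by (simp add: le_divide_eq)
        with elim \<epsilon>(1)[of m] show False by linarith
      qed
      then show False by simp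
    qed
    show "\<exists>R. \<forall>t. cmod t \<ge> R \<longrightarrow> (\<exists>i<n. cmod (\<gamma> t i) > M)" for M :: real
    proof -
      obtain K :: nat where K: "M + 2 < real K" using reals_Archimedean2 by blast
      have "\<forall>\<^sub>F m in sequentially. K \<le> x m"
        using x by (simp add: filterlim_at_top)
      then obtain N where N: "\<And>m. m \<ge> N \<Longrightarrow> K \<le> x m"
        unfolding eventually_sequentially by blast
      have "\<exists>i<n. cmod (\<gamma> t i) > M" if t: "cmod t \<ge> R N" for t
      proof -
        define k where "k = (LEAST m. cmod t \<le> R (Suc m) \<and> m \<ge> N)"
        have ex: "\<exists>m. cmod t \<le> R (Suc m) \<and> m \<ge> N"
          by (intro exI[of _ "max N (nat \<lceil>cmod t\<rceil>)"] conjI inS le_SucI max.cobounded1 max.cobounded2)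
        have k: "cmod t \<le> R (Suc k)" "k \<ge> N"
          using LeastI_ex[OF ex] unfolding k_def by blast+
        have "R k \<le> cmod t"
        proof (cases "k = N")
          case False
          with k(2) obtain j where j: "k = Suc j" "j \<ge> N"
            by (metis Suc_le_D le_eq_less_or_eq less_Suc_eq_le not_less_eq)
          have "\<not> (cmod t \<le> R (Suc j) \<and> j \<ge> N)"
            using not_less_Least[of j "\<lambda>m. cmod t \<le> R (Suc m) \<and> m \<ge> N"] j(1) unfolding k_def by simp
          with j show ?thesis by simp
        qed (use t in simp)
        from large[OF this k(1)] obtain i where i: "i < n" "cmod (poly (P (Suc k) i) t) > real (x k) - 1" by blast
        have "cmod (\<gamma> t i - poly (P (Suc k) i) t) \<le> \<epsilon> (Suc k)"
          using k(1) by (intro close) simp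
        moreover have "real K \<le> real (x k)" using N[OF k(2)] by simp
        ultimately have "cmod (\<gamma> t i) > M"
          using i(2) K \<epsilon>(2)[of "Suc k"] norm_triangle_ineq2[of "poly (P (Suc k) i) t" "\<gamma> t i"]
          by (simp add: norm_minus_commute)
        with i show ?thesis by blast
      qed
      then show ?thesis by blast
    qed
    show "\<exists>t. \<forall>i<n. cmod (\<gamma> t i - e m i) < tol m" for m
    proof -
      obtain t where t: "cmod t \<le> R (Suc m)" "\<And>l. l < n \<Longrightarrow> cmod (poly (P (Suc m) l) t - e m l) \<le> tol m / 2"
        using hit[of m] by blast
      have "cmod (\<gamma> t i - e m i) < tol m" if "i < n" for i
      proof -
        have "cmod (\<gamma> t i - poly (P (Suc m) i) t) \<le> \<epsilon> (Suc m)"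
          using t(1) by (intro close) simp
        then show ?thesis
          using t(2)[OF that] \<epsilon>S(2)[of m] tol[of m]
            norm_triangle_ineq[of "\<gamma> t i - poly (P (Suc m) i) t" "poly (P (Suc m) i) t - e m i"] by simp
      qed
      then show ?thesis by blast
    qed
  qed
qed


section \<open>Properly embedded curves\<close>

locale proper_embedded_curve =
  fixes n :: nat and \<gamma> :: "complex \<Rightarrow> nat \<Rightarrow> complex"
  assumes in_cspace: "\<gamma> t \<in> cspace n"
    and hol: "(\<lambda>t. \<gamma> t l) holomorphic_on UNIV"
    and inj: "inj \<gamma>"
    and immersion: "\<exists>l. deriv (\<lambda>t. \<gamma> t l) t \<noteq> 0"
    and escapes: "\<exists>R. \<forall>t. cmod t \<ge> R \<longrightarrow> (\<exists>i<n. cmod (\<gamma> t i) > M)"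
begin

lemma continuous_coord: "continuous_on S (\<lambda>t. \<gamma> t l)"
  using holomorphic_on_imp_continuous_on[OF hol] by (rule continuous_on_subset) simp

lemma continuous: "continuous_on S \<gamma>"
  by (rule continuous_on_coordinatewise_then_product) (rule continuous_coord)

lemma compact_preimage:
  assumes K: "compact K"
  shows "compact (\<gamma> -` K)"
proof -
  have "continuous_on K (\<lambda>z. \<Sum>i<n. cmod (z i))"
    by (intro continuous_on_sum continuous_on_norm)
      (rule continuous_on_product_then_coordinatewise[OF continuous_on_id])
  from compact_imp_bounded[OF compact_continuous_image[OF this K]]
  obtain M where M: "\<forall>y\<in>(\<lambda>z. \<Sum>i<n. cmod (z i)) ` K. norm y \<le> M"
    unfolding bounded_iff by (elim exE) (rule that)
  obtain R where R: "\<And>t. cmod t \<ge> R \<Longrightarrow> \<exists>i<n. cmod (\<gamma> t i) > M"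
    using escapes by blast
  have "\<gamma> -` K \<subseteq> cball 0 R"
  proof
    fix t assume t: "t \<in> \<gamma> -` K"
    then have "norm (\<Sum>i<n. cmod (\<gamma> t i)) \<le> M"
      using M by blast
    then have sum: "(\<Sum>i<n. cmod (\<gamma> t i)) \<le> M"
      by (simp only: real_norm_def)
    have "\<not> cmod t \<ge> R"
    proof
      assume "cmod t \<ge> R"
      then obtain i where i: "i < n" "cmod (\<gamma> t i) > M" using R by blast
      then have "cmod (\<gamma> t i) \<le> (\<Sum>i<n. cmod (\<gamma> t i))"
        by (intro member_le_sum) auto
      with i sum show False by linarith
    qed
    then show "t \<in> cball 0 R" by simp
  qed
  then have "bounded (\<gamma> -` K)"
    by (rule bounded_subset[OF bounded_cball])
  moreover have "closed (\<gamma> -` K)"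
    using continuous_closed_vimage[OF compact_imp_closed[OF K], of \<gamma>] continuous[of UNIV]
    by (simp add: continuous_on_eq_continuous_at)
  ultimately show ?thesis
    by (simp add: compact_eq_bounded_closed)
qed

text \<open>Points of the curve near a given point come from a compact set of parameters, on which the distance
  to the given point is bounded below unless it is attained.\<close>

lemma avoids_polydisc:
  assumes n: "0 < n" and z: "z \<in> cspace n" and C: "closed C" and nz: "z \<notin> \<gamma> ` C"
  shows "\<exists>r>0. \<forall>t\<in>C. \<gamma> t \<notin> polydisc n z r"
proof -
  define K where "K = C \<inter> \<gamma> -` cpolydisc n z 1"
  have K: "compact K"
    unfolding K_def by (intro closed_Int_compact C compact_preimage compact_cpolydisc)
  define h where "h t = (\<Sum>i<n. cmod (\<gamma> t i - z i))" for t
  have hc: "continuous_on K h"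
    unfolding h_def by (intro continuous_on_sum continuous_on_norm continuous_on_diff continuous_coord continuous_on_const)
  have "\<exists>m>0. \<forall>t\<in>K. h t \<ge> m"
  proof (cases "K = {}")
    case False
    obtain t0 where t0: "t0 \<in> K" "\<And>t. t \<in> K \<Longrightarrow> h t0 \<le> h t"
      using continuous_attains_inf[OF K False hc] by blast
    have "h t0 \<noteq> 0"
    proof
      assume "h t0 = 0"
      then have "\<gamma> t0 i = z i" if "i < n" for i
        using that by (simp add: h_def sum_nonneg_eq_0_iff)
      then have "\<gamma> t0 = z"
        by (rule cspace_eqI[OF in_cspace z])
      with t0(1) nz show False by (auto simp: K_def)
    qed
    moreover have "h t0 \<ge> 0" by (simp add: h_def sum_nonneg)
    ultimately show ?thesis using t0(2) by (intro exI[of _ "h t0"]) auto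
  qed (auto intro: exI[of _ 1])
  then obtain m where m: "m > 0" "\<And>t. t \<in> K \<Longrightarrow> h t \<ge> m" by blast
  define r where "r = min 1 (m / real n)"
  have r: "r > 0" "r \<le> 1" "real n * r \<le> m"
  proof -
    show "r > 0" "r \<le> 1" using m n by (auto simp: r_def)
    have "r \<le> m / real n" by (simp add: r_def)
    then show "real n * r \<le> m" using n by (simp add: le_divide_eq mult.commute)
  qed
  have "\<gamma> t \<notin> polydisc n z r" if t: "t \<in> C" for t
  proof
    assume p: "\<gamma> t \<in> polydisc n z r"
    have "t \<in> K"
      using p t r(2) by (force simp: K_def polydisc_def cpolydisc_def)
    have "h t < (\<Sum>i<n. r)"
      unfolding h_def using p n by (intro sum_strict_mono) (auto simp: polydisc_def)
    then have "h t < real n * r" by simp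
    with m(2)[OF \<open>t \<in> K\<close>] r(3) show False by linarith
  qed
  with r(1) show ?thesis by blast
qed

lemma closed_image:
  assumes n: "0 < n" and C: "closed C"
  shows "closedin (cspace_top n) (\<gamma> ` C)"
proof -
  have "openin (cspace_top n) (cspace n - \<gamma> ` C)"
    unfolding openin_cspace_iff
  proof (intro conjI ballI)
    fix z assume "z \<in> cspace n - \<gamma> ` C"
    then obtain r where r: "r > 0" "\<And>t. t \<in> C \<Longrightarrow> \<gamma> t \<notin> polydisc n z r"
      using avoids_polydisc[OF n _ C] by blast
    then show "\<exists>r>0. polydisc n z r \<subseteq> cspace n - \<gamma> ` C"
      using polydisc_subset_cspace by (intro exI[of _ r]) blast
  qed blast
  moreover have "\<gamma> ` C \<subseteq> cspace n" using in_cspace by blast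
  ultimately show ?thesis
    unfolding closedin_def by (simp add: cspace_top_def)
qed

lemma continuous_map: "continuous_map euclidean (cspace_top n) \<gamma>"
  unfolding cspace_top_def using continuous[of UNIV] in_cspace by (auto simp: continuous_map_in_subtopology)

lemma embedding:
  assumes n: "0 < n"
  shows "holomorphic_embedding n \<gamma>"
  unfolding holomorphic_embedding_def
proof (intro conjI allI)
  show "range \<gamma> \<subseteq> cspace n" using in_cspace by blast
  show "(\<lambda>t. \<gamma> t i) holomorphic_on UNIV" for i by (rule hol)
  show "\<exists>i. deriv (\<lambda>s. \<gamma> s i) t \<noteq> 0" for t by (rule immersion)
  show "embedding_map euclidean (cspace_top n) \<gamma>"
  proof (rule injective_closed_imp_embedding_map[OF continuous_map])
    show "closed_map euclidean (cspace_top n) \<gamma>"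
      unfolding closed_map_def using closed_image[OF n] by simp
    show "inj_on \<gamma> (topspace euclidean)" unfolding topspace_euclidean by (rule inj)
  qed
qed

lemma proper: "proper_into_cspace n \<gamma>"
  unfolding proper_into_cspace_def using continuous_map compact_preimage by blast

lemma connected_curve: "connected (range \<gamma>)"
  by (rule connected_continuous_image[OF continuous connected_UNIV])

end

lemma local_coordinatesI:
  assumes U: "openin (cspace_top n) U" and \<phi>: "\<And>i. holo_on n U (\<lambda>z. \<phi> z i)"
    and \<Omega>: "openin (cspace_top n) \<Omega>" and \<theta>: "\<And>i. holo_on n \<Omega> (\<lambda>w. \<theta> w i)"
    and \<phi>\<Omega>: "\<And>z. z \<in> U \<Longrightarrow> \<phi> z \<in> \<Omega>" and \<theta>c: "\<And>w. w \<in> \<Omega> \<Longrightarrow> \<theta> w \<in> cspace n"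
    and inv: "\<And>z. z \<in> U \<Longrightarrow> \<theta> (\<phi> z) = z" "\<And>w. w \<in> \<Omega> \<Longrightarrow> \<theta> w \<in> U \<Longrightarrow> \<phi> (\<theta> w) = w"
  shows "local_coordinates n U \<phi>"
proof -
  have im: "\<phi> ` U = {w \<in> \<Omega>. \<theta> w \<in> U}"
  proof (intro subset_antisym subsetI)
    fix w assume "w \<in> \<phi> ` U"
    then show "w \<in> {w \<in> \<Omega>. \<theta> w \<in> U}" using \<phi>\<Omega> inv(1) by auto
  next
    fix w assume "w \<in> {w \<in> \<Omega>. \<theta> w \<in> U}"
    then show "w \<in> \<phi> ` U" using inv(2) by (metis (no_types, lifting) imageI mem_Collect_eq)
  qed
  have inj: "inj_on \<phi> U"
    by (rule inj_on_inverseI[of U \<theta>]) (rule inv(1))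
  show ?thesis
    unfolding local_coordinates_def
  proof (intro conjI allI)
    show "openin (cspace_top n) (\<phi> ` U)"
      unfolding im by (rule openin_preimage_cspace[OF \<Omega> \<theta> \<theta>c U])
    show "holo_on n (\<phi> ` U) (\<lambda>w. inv_into U \<phi> w i)" for i
    proof (rule holo_on_cong)
      show "holo_on n (\<phi> ` U) (\<lambda>w. \<theta> w i)"
        by (rule holo_on_subset[OF \<theta>]) (auto simp: im)
      show "\<theta> w i = inv_into U \<phi> w i" if "w \<in> \<phi> ` U" for w
        using that inv(1) inv_into_f_f[OF inj] by force
    qed
  qed (rule U inj \<phi>)+
qed

context proper_embedded_curve
begin

text \<open>Near a point where \<open>\<gamma>\<^sub>m' \<noteq> 0\<close> the curve is a graph over the \<open>m\<close>-th coordinate axis; the deviations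
  from this graph, with that axis moved to the last position, are adapted coordinates.\<close>

lemma adapted_at:
  assumes n: "0 < n"
  obtains U \<phi> where "\<gamma> t0 \<in> U" "adapted n (range \<gamma>) (n - 1) U \<phi>"
proof -
  obtain m where m0: "deriv (\<lambda>t. \<gamma> t m) t0 \<noteq> 0" using immersion by blast
  have m: "m < n"
  proof (rule ccontr)
    assume "\<not> m < n"
    then have "(\<lambda>t. \<gamma> t m) = (\<lambda>t. 0)" using in_cspace by (auto simp: cspace_def)
    with m0 show False by simp
  qed
  obtain \<epsilon> where \<epsilon>: "\<epsilon> > 0" "inj_on (\<lambda>t. \<gamma> t m) (ball t0 \<epsilon>)"
    using has_complex_derivative_locally_injective[OF hol UNIV_I open_UNIV m0] by blast
  define B where "B = ball t0 \<epsilon>"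
  define V where "V = (\<lambda>t. \<gamma> t m) ` B"
  have holB: "(\<lambda>t. \<gamma> t m) holomorphic_on B" by (rule holomorphic_on_subset[OF hol]) simp
  have injB: "inj_on (\<lambda>t. \<gamma> t m) B" using \<epsilon> by (simp add: B_def)
  have opB: "open B" by (simp add: B_def)
  have V: "open V" unfolding V_def by (rule open_mapping_thm3[OF holB opB injB])
  obtain g where g: "g holomorphic_on V" "\<And>t. t \<in> B \<Longrightarrow> g (\<gamma> t m) = t"
    using holomorphic_has_inverse[OF holB opB injB] unfolding V_def by metis
  have gV: "\<gamma> (g s) m = s" "g s \<in> B" if "s \<in> V" for s
    using that g(2) unfolding V_def by auto
  have holg: "(\<lambda>s. \<gamma> (g s) l) holomorphic_on V" for l
    using holomorphic_on_compose_gen[OF g(1) hol[of l]] by (simp add: comp_def)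
  define a where "a = \<gamma> t0"
  have "a \<notin> \<gamma> ` (- B)"
  proof
    assume "a \<in> \<gamma> ` (- B)"
    then obtain t where t: "t \<notin> B" "\<gamma> t0 = \<gamma> t" by (auto simp: a_def)
    then have "t0 = t" using injD[OF inj] by blast
    with t(1) \<epsilon>(1) show False by (simp add: B_def)
  qed
  then obtain r where r: "r > 0" "\<And>t. t \<in> - B \<Longrightarrow> \<gamma> t \<notin> polydisc n a r"
    using avoids_polydisc[OF n in_cspace[of t0], of "- B"] opB unfolding a_def by (auto simp: closed_def)
  define U where "U = {z \<in> polydisc n a r. z m \<in> V}"
  have opU: "openin (cspace_top n) U"
  proof -
    have "openin (top_of_set (polydisc n a r)) (polydisc n a r \<inter> (\<lambda>z. z m) -` V)"
      by (rule continuous_openin_preimage_gen[OF holo_on_continuous[OF holo_on_coord] V])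
    then have "openin (cspace_top n) (polydisc n a r \<inter> (\<lambda>z. z m) -` V)"
      using openin_polydisc[of n a r] openin_trans unfolding cspace_top_def by metis
    moreover have "polydisc n a r \<inter> (\<lambda>z. z m) -` V = U" by (auto simp: U_def)
    ultimately show ?thesis by simp
  qed
  have Uc: "U \<subseteq> cspace n" using openin_cspace_subset[OF opU] .
  have aU: "a \<in> U"
    using r(1) \<epsilon>(1) in_cspace[of t0] by (auto simp: U_def a_def V_def B_def polydisc_def)
  define p where "p i = (if i = m then n - 1 else if i = n - 1 then m else i)" for i :: nat
  have p: "p (p i) = i" "i < n \<Longrightarrow> p i < n" "p i = m \<longleftrightarrow> i = n - 1" "p i = n - 1 \<longleftrightarrow> i = m" for i
    using m n by (auto simp: p_def)
  define \<phi> where "\<phi> z = (\<lambda>i. if i < n - 1 then z (p i) - \<gamma> (g (z m)) (p i) else if i = n - 1 then z m else 0)"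
    for z :: "nat \<Rightarrow> complex"
  define \<Omega> where "\<Omega> = {w \<in> cspace n. w (n - 1) \<in> V}"
  define \<theta> where "\<theta> w = (\<lambda>l. if n \<le> l then 0 else if l = m then w (n - 1) else w (p l) + \<gamma> (g (w (n - 1))) l)"
    for w :: "nat \<Rightarrow> complex"
  have op\<Omega>: "openin (cspace_top n) \<Omega>"
  proof -
    have "openin (top_of_set (cspace n)) (cspace n \<inter> (\<lambda>w. w (n - 1)) -` V)"
      by (rule continuous_openin_preimage_gen[OF holo_on_continuous[OF holo_on_coord] V])
    moreover have "cspace n \<inter> (\<lambda>w. w (n - 1)) -` V = \<Omega>" by (auto simp: \<Omega>_def)
    ultimately show ?thesis by (simp add: cspace_top_def)
  qed
  have graph: "holo_on n U (\<lambda>z. \<gamma> (g (z m)) l)" "holo_on n \<Omega> (\<lambda>w. \<gamma> (g (w (n - 1))) l)" for l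
    by (rule holo_on_compose_one_variable[OF holg holo_on_coord]; simp add: U_def \<Omega>_def)+
  have lc: "local_coordinates n U \<phi>"
  proof (rule local_coordinatesI[OF opU _ op\<Omega>, where \<theta> = \<theta>])
    show "holo_on n U (\<lambda>z. \<phi> z i)" for i
    proof -
      consider "i < n - 1" | "i = n - 1" | "i > n - 1" by linarith
      then show ?thesis
        using holo_on_diff[OF holo_on_coord[of n U "p i"] graph(1)[of "p i"]]
          holo_on_coord[of n U m] holo_on_const[of n U 0]
        by cases (simp_all add: \<phi>_def)
    qed
    show "holo_on n \<Omega> (\<lambda>w. \<theta> w l)" for l
    proof -
      consider "l \<ge> n" | "l < n" "l = m" | "l < n" "l \<noteq> m" by linarith
      then show ?thesis
        using holo_on_add[OF holo_on_coord[of n \<Omega> "p l"] graph(2)[of l]]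
          holo_on_coord[of n \<Omega> "n - 1"] holo_on_const[of n \<Omega> 0]
        by cases (simp_all add: \<theta>_def)
    qed
    show "\<phi> z \<in> \<Omega>" if "z \<in> U" for z
      using that n by (auto simp: \<Omega>_def \<phi>_def U_def cspace_def)
    show "\<theta> w \<in> cspace n" for w by (simp add: \<theta>_def cspace_def)
    show "\<theta> (\<phi> z) = z" if z: "z \<in> U" for z
    proof (rule cspace_eqI[of _ n])
      show "z \<in> cspace n" using z Uc by blast
      fix l assume l: "l < n"
      have last: "\<phi> z (n - 1) = z m" using n by (simp add: \<phi>_def)
      show "\<theta> (\<phi> z) l = z l"
      proof (cases "l = m")
        case False
        then have "p l < n - 1" using p(2)[OF l] p(4)[of l] by linarith
        then have "\<phi> z (p l) = z l - \<gamma> (g (z m)) l" by (simp add: \<phi>_def p(1))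
        with False l last show ?thesis by (simp add: \<theta>_def)
      qed (use l last in \<open>simp add: \<theta>_def\<close>)
    qed (simp add: \<theta>_def cspace_def)
    show "\<phi> (\<theta> w) = w" if w: "w \<in> \<Omega>" "\<theta> w \<in> U" for w
    proof (rule cspace_eqI[of _ n])
      show "w \<in> cspace n" using w by (simp add: \<Omega>_def)
      fix i assume i: "i < n"
      have mm: "\<theta> w m = w (n - 1)" using m by (simp add: \<theta>_def)
      show "\<phi> (\<theta> w) i = w i"
      proof (cases "i = n - 1")
        case False
        then have i': "i < n - 1" using i by simp
        have "p i \<noteq> m" using p(3) False by blast
        then have "\<theta> w (p i) = w i + \<gamma> (g (w (n - 1))) (p i)"
          using p(2)[OF i] by (simp add: \<theta>_def p(1))
        with i' mm show ?thesis by (simp add: \<phi>_def)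
      qed (use n mm in \<open>simp add: \<phi>_def\<close>)
    qed (use n in \<open>auto simp: \<phi>_def cspace_def\<close>)
  qed
  have "range \<gamma> \<inter> U = {z \<in> U. \<forall>i<n-1. \<phi> z i = 0}"
  proof (intro subset_antisym subsetI)
    fix z assume z: "z \<in> range \<gamma> \<inter> U"
    then obtain t where t: "z = \<gamma> t" by blast
    have "t \<in> B" using r(2)[of t] z t by (auto simp: U_def)
    then have "g (z m) = t" using g(2) t by simp
    with z t show "z \<in> {z \<in> U. \<forall>i<n-1. \<phi> z i = 0}" by (simp add: \<phi>_def)
  next
    fix z assume z: "z \<in> {z \<in> U. \<forall>i<n-1. \<phi> z i = 0}"
    have "\<gamma> (g (z m)) = z"
    proof (rule cspace_eqI[OF in_cspace])
      show "z \<in> cspace n" using z Uc by blast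
      fix l assume l: "l < n"
      show "\<gamma> (g (z m)) l = z l"
      proof (cases "l = m")
        case True
        then show ?thesis using gV(1)[of "z m"] z by (simp add: U_def)
      next
        case False
        then have "p l < n - 1" using p(2)[OF l] p(4)[of l] by linarith
        then have "\<phi> z (p l) = 0" "\<phi> z (p l) = z l - \<gamma> (g (z m)) l" using z by (auto simp: \<phi>_def p(1))
        then show ?thesis by simp
      qed
    qed
    then have "z \<in> range \<gamma>" by (metis rangeI)
    with z show "z \<in> range \<gamma> \<inter> U" by blast
  qed
  with lc have "adapted n (range \<gamma>) (n - 1) U \<phi>"
    by (simp add: adapted_def)
  with aU show thesis using that by (simp add: a_def)
qed

lemma submanifold:
  assumes n: "0 < n"
  shows "closed_submanifold n 1 (range \<gamma>)"
  unfolding closed_submanifold_def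
proof (intro conjI ballI)
  show "closedin (cspace_top n) (range \<gamma>)" by (rule closed_image[OF n closed_UNIV])
  show "1 \<le> n" using n by simp
  fix a assume "a \<in> range \<gamma>"
  then obtain t where t: "a = \<gamma> t" by blast
  obtain U \<phi> where "\<gamma> t \<in> U" "adapted n (range \<gamma>) (n - 1) U \<phi>" using adapted_at[OF n] by blast
  then show "\<exists>U \<phi>. a \<in> U \<and> adapted n (range \<gamma>) (n - 1) U \<phi>" unfolding t by blast
qed

end


section \<open>Volume hyperbolic blow-ups are not Oka\<close>

lemma closed_submanifold_proper:
  assumes A: "closed_submanifold n m A" and m: "m < n"
  obtains w where "w \<in> cspace n" "w \<notin> A"
proof (cases "A = {}")
  case True
  then show thesis using that[of "\<lambda>_. 0"] by (simp add: cspace_def)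
next
  case False
  then obtain a where a: "a \<in> A" by blast
  then obtain U \<phi> where U: "a \<in> U" "adapted n A (n - m) U \<phi>"
    using A unfolding closed_submanifold_def by blast
  interpret adapted_chart n A "n - m" U \<phi>
    using U(2) closed_submanifold_subset[OF A] by (simp add: adapted_chart_def)
  define u :: "nat \<Rightarrow> complex" where "u = (\<lambda>i. if i = 0 then 1 else 0)"
  have u: "u \<in> cspace n" using m by (simp add: u_def cspace_def)
  obtain r where r: "r > 0" "\<And>t. cmod t < r \<Longrightarrow> (\<lambda>i. \<phi> a i + t * u i) \<in> \<phi> ` U"
    using line_in_open[OF image_open imageI[OF U(1)] u] by blast
  define t where "t = complex_of_real (r/2)"
  have t: "cmod t < r" "t \<noteq> 0" using r(1) by (simp_all add: t_def)
  obtain z where z: "z \<in> U" "(\<lambda>i. \<phi> a i + t * u i) = \<phi> z" using r(2)[OF t(1)] by blast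
  have "\<phi> a 0 = 0" using A_iff[OF U(1)] a m by simp
  then have "\<phi> z 0 = t" using fun_cong[OF z(2), of 0] by (simp add: u_def)
  then have "z \<notin> A" using A_iff[OF z(1)] m t(2) by auto
  with z(1) U_sub show thesis using that by blast
qed

lemma det_near_identity:
  fixes M :: "nat \<Rightarrow> nat \<Rightarrow> complex"
  assumes near: "\<And>i j. i < n \<Longrightarrow> j < n \<Longrightarrow> cmod (M j i - (if j = i then 1 else 0)) \<le> 1 / (2 * real n)"
  shows "det (Matrix.mat n n (\<lambda>(j, i). M j i)) \<noteq> 0"
proof (rule det_nonzero_columns_independent)
  fix \<xi> assume \<xi>: "\<And>j. j < n \<Longrightarrow> (\<Sum>i<n. M j i * \<xi> i) = 0"
  define S where "S = (\<Sum>i<n. cmod (\<xi> i))"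
  have "cmod (\<xi> j) \<le> 1 / (2 * real n) * S" if j: "j < n" for j
  proof -
    have "(\<Sum>i<n. (M j i - (if j = i then 1 else 0)) * \<xi> i) = (\<Sum>i<n. M j i * \<xi> i) - (\<Sum>i<n. (if j = i then 1 else 0) * \<xi> i)"
      by (simp add: left_diff_distrib sum_subtractf)
    also have "(\<Sum>i<n. (if j = i then 1 else 0) * \<xi> i) = \<xi> j"
      using j by (subst sum.remove[of _ j]) auto
    finally have "cmod (\<xi> j) = cmod (\<Sum>i<n. (M j i - (if j = i then 1 else 0)) * \<xi> i)"
      using \<xi>[OF j] by simp
    also have "\<dots> \<le> (\<Sum>i<n. 1 / (2 * real n) * cmod (\<xi> i))"
    proof (rule sum_norm_le)
      show "cmod ((M j i - (if j = i then 1 else 0)) * \<xi> i) \<le> 1 / (2 * real n) * cmod (\<xi> i)" if "i \<in> {..<n}" for i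
        unfolding norm_mult using near[of i j] that j by (intro mult_right_mono) auto
    qed
    finally show ?thesis by (simp add: S_def sum_distrib_left)
  qed
  then have "S \<le> (\<Sum>j<n. 1 / (2 * real n) * S)"
    unfolding S_def by (intro sum_mono) auto
  also have "\<dots> \<le> S / 2"
    by (cases "n = 0") (auto simp: S_def)
  finally have "S \<le> 0" by simp
  then have "S = 0" by (simp add: S_def sum_nonneg order_antisym)
  then show "\<forall>i<n. \<xi> i = 0" by (simp add: S_def sum_nonneg_eq_0_iff)
qed

lemma holo_map_inclusion:
  assumes A: "A \<subseteq> cspace n" and U: "openin (cspace_top n) U" and D: "(D, \<Phi>) \<in> blowup n A" "Inl ` U \<subseteq> D"
  shows "holo_map n U (blowup n A) Inl"
proof -
  have main: "openin (cspace_top n) (U \<inter> Inl -` W) \<and> (\<forall>i. holo_on n (U \<inter> Inl -` W) (\<lambda>z. \<Psi> (Inl z) i))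
      \<and> (\<forall>z\<in>U \<inter> Inl -` W. \<Psi> (Inl z) \<in> cspace n)"
    if W: "(W, \<Psi>) \<in> blowup n A" for W \<Psi>
  proof -
    obtain k V \<psi> j where P: "blowup_chart n A k V \<psi> j" "W = blowup_domain n A V \<psi> j" "\<Psi> = blowup_coord n k \<psi> j"
      using blowup_member[OF W A] by blast
    interpret blowup_chart n A k V \<psi> j by (rule P(1))
    have notA: "z \<notin> A" if "z \<in> U" for z
    proof
      assume "z \<in> A"
      moreover obtain k' V' \<psi>' j' where Q: "blowup_chart n A k' V' \<psi>' j'" "D = blowup_domain n A V' \<psi>' j'"
        by (rule blowup_member[OF D(1) A])
      ultimately show False
        using D(2) that blowup_chart.Inl_in_D[OF Q(1), of z] by blast
    qed
    have eq: "U \<inter> Inl -` W = {z \<in> U \<inter> V. \<psi> z j \<noteq> 0}"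
      using notA by (auto simp: P(2) Inl_in_D)
    have op: "openin (cspace_top n) (U \<inter> V)" using U U_open by (rule openin_Int)
    have hol: "holo_on n (U \<inter> V) (\<lambda>z. \<psi> z i)" for i
      by (rule holo_on_subset[OF coord_holo]) blast
    have hol': "holo_on n {z \<in> U \<inter> V. \<psi> z j \<noteq> 0} (\<lambda>z. \<psi> z i)" for i
      by (rule holo_on_subset[OF hol]) blast
    have "holo_on n {z \<in> U \<inter> V. \<psi> z j \<noteq> 0} (\<lambda>z. \<Psi> (Inl z) i)" for i
    proof (cases "i < k \<and> i \<noteq> j")
      case True
      have "holo_on n {z \<in> U \<inter> V. \<psi> z j \<noteq> 0} (\<lambda>z. \<psi> z i / \<psi> z j)"
        by (rule holo_on_divide[OF hol' hol']) blast
      with True show ?thesis by (simp add: P(3) coord_Inl)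
    next
      case False
      then show ?thesis unfolding P(3) coord_Inl using hol'[of i] by (simp only: if_False)
    qed
    moreover have "openin (cspace_top n) {z \<in> U \<inter> V. \<psi> z j \<noteq> 0}"
      by (rule openin_nonzero[OF op hol])
    moreover have "\<forall>z\<in>U \<inter> Inl -` W. \<Psi> (Inl z) \<in> cspace n"
      using coord_in_cspace P(2,3) by blast
    ultimately show ?thesis unfolding eq by blast
  qed
  show ?thesis
    unfolding holo_map_def
  proof (intro conjI ballI, unfold split_beta, safe)
    show "continuous_map (top_of_set U) (mfd_top (blowup n A)) Inl"
      unfolding mfd_top_def continuous_on_generated_topo_iff
    proof (intro conjI allI impI)
      fix G assume "G \<in> {{p \<in> U. \<phi> p \<in> W} |U \<phi> W. (U, \<phi>) \<in> blowup n A \<and> open W}"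
      then obtain W \<Psi> O' where G: "G = {p \<in> W. \<Psi> p \<in> O'}" "(W, \<Psi>) \<in> blowup n A" "open O'" by blast
      note m = main[OF G(2)]
      have "openin (cspace_top n) {z \<in> U \<inter> Inl -` W. \<Psi> (Inl z) \<in> cspace n \<inter> O'}"
        using m G(3) by (intro openin_preimage_cspace[of n _ n]) (auto simp: cspace_top_def)
      moreover have "{z \<in> U \<inter> Inl -` W. \<Psi> (Inl z) \<in> cspace n \<inter> O'} = Inl -` G \<inter> topspace (top_of_set U)"
        using m by (auto simp: G(1))
      ultimately have "openin (top_of_set (cspace n)) (Inl -` G \<inter> topspace (top_of_set U))"
        by (simp add: cspace_top_def)
      then show "openin (top_of_set U) (Inl -` G \<inter> topspace (top_of_set U))"
        by (rule openin_subset_trans) (use openin_cspace_subset[OF U] in auto)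
    next
      have "D \<subseteq> topspace (mfd_top (blowup n A))"
        using openin_subset[OF openin_chart_domain[OF D(1)]] .
      then show "Inl ` topspace (top_of_set U) \<subseteq> \<Union>{{p \<in> U. \<phi> p \<in> W} |U \<phi> W. (U, \<phi>) \<in> blowup n A \<and> open W}"
        using D(2) unfolding mfd_top_def topology_generated_by_topspace by auto
    qed
    show "holo_on n (U \<inter> Inl -` fst (W, \<Psi>)) (\<lambda>z. snd (W, \<Psi>) (Inl z) i)" if "(W, \<Psi>) \<in> blowup n A" for W \<Psi> i
      using main[OF that] by simp
  qed
qed

text \<open>By compactness: points of a sequence of counterexamples would accumulate where the chart is continuous.\<close>

lemma uniform_in_chart:
  assumes d: "mtopology_of d = mfd_top Y" and D: "(D, \<Phi>) \<in> Y" and U: "U \<subseteq> cspace n"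
    and f: "continuous_map (top_of_set U) (mfd_top Y) f" "f ` U \<subseteq> D" and K: "compact K" "K \<subseteq> U" and \<eta>: "\<eta> > 0"
  shows "\<exists>e>0. \<forall>z\<in>K. \<forall>q\<in>mspace d. mdist d q (f z) < e \<longrightarrow> q \<in> D \<and> (\<forall>i<n. cmod (\<Phi> q i - \<Phi> (f z) i) < \<eta>)"
proof (rule ccontr)
  assume neg: "\<not> ?thesis"
  have "\<exists>z q. z \<in> K \<and> q \<in> mspace d \<and> mdist d q (f z) < inverse (real (Suc k)) \<and>
      \<not> (q \<in> D \<and> (\<forall>i<n. cmod (\<Phi> q i - \<Phi> (f z) i) < \<eta>))" for k
  proof -
    have "inverse (real (Suc k)) > 0" by simp
    with neg show ?thesis by blast
  qed
  then obtain z q where z: "\<And>k. z k \<in> K" and q: "\<And>k. q k \<in> mspace d"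
    "\<And>k. mdist d (q k) (f (z k)) < inverse (real (Suc k))"
    "\<And>k. \<not> (q k \<in> D \<and> (\<forall>i<n. cmod (\<Phi> (q k) i - \<Phi> (f (z k)) i) < \<eta>))" by metis
  obtain y r where y: "y \<in> K" "strict_mono r" "(z \<circ> r) \<longlonglongrightarrow> y"
    using K(1) z unfolding compact_def by meson
  have sp: "f u \<in> mspace d" if "u \<in> U" for u
    using continuous_map_image_subset_topspace[OF f(1)] that topspace_mtopology_of[of d] d by auto
  define W where "W = {w. \<forall>i<n. cmod (w i - \<Phi> (f y) i) < \<eta>/2}"
  have "open W"
  proof -
    have "open (\<Inter>i<n. {w :: nat \<Rightarrow> complex. cmod (w i - \<Phi> (f y) i) < \<eta>/2})"
      by (intro open_INT ballI open_Collect_less continuous_intros continuous_on_product_then_coordinatewise) auto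
    moreover have "W = (\<Inter>i<n. {w. cmod (w i - \<Phi> (f y) i) < \<eta>/2})" by (auto simp: W_def)
    ultimately show ?thesis by simp
  qed
  define G where "G = {p \<in> D. \<Phi> p \<in> W}"
  have "openin (mtopology_of d) G"
    unfolding d G_def by (rule openin_chart_vimage[OF D \<open>open W\<close>])
  moreover have fyG: "f y \<in> G"
    using f(2) y(1) K(2) \<eta> by (auto simp: G_def W_def)
  ultimately obtain e where e: "e > 0" "Metric_space.mball (mspace d) (mdist d) (f y) e \<subseteq> G"
    unfolding mtopology_of_def Metric_space.openin_mtopology[OF Metric_space_mspace_mdist] by blast
  have yU: "y \<in> U" using y(1) K(2) by blast
  have inG: "p \<in> G" if "p \<in> mspace d" "mdist d (f y) p < e" for p
    using e(2) that sp[OF yU] by (auto simp: Metric_space.in_mball[OF Metric_space_mspace_mdist])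
  let ?H = "Metric_space.mball (mspace d) (mdist d) (f y) (e/2)"
  have "openin (mfd_top Y) ?H"
    unfolding d[symmetric] mtopology_of_def by (rule Metric_space.openin_mball[OF Metric_space_mspace_mdist])
  then have "openin (top_of_set U) {u \<in> topspace (top_of_set U). f u \<in> ?H}"
    by (rule openin_continuous_map_preimage[OF f(1)])
  then obtain O' where O: "open O'" "{u \<in> U. f u \<in> ?H} = U \<inter> O'"
    unfolding openin_open by auto
  have "f y \<in> ?H"
  proof -
    have "mdist d (f y) (f y) = 0" by (simp add: sp[OF yU])
    then have "mdist d (f y) (f y) < e/2" using e(1) by linarith
    with sp[OF yU] show ?thesis by (simp only: Metric_space.in_mball[OF Metric_space_mspace_mdist])
  qed
  then have "y \<in> O'"
    using O(2) yU by blast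
  then have "\<forall>\<^sub>F k in sequentially. (z \<circ> r) k \<in> O'"
    by (rule topological_tendstoD[OF y(3) O(1)])
  moreover have "\<forall>\<^sub>F k in sequentially. inverse (real (Suc k)) < e/2"
    using e(1) by (intro order_tendstoD(2)[OF LIMSEQ_inverse_real_of_nat]) simp
  ultimately have "\<forall>\<^sub>F k in sequentially. (z \<circ> r) k \<in> O' \<and> inverse (real (Suc k)) < e/2"
    by (rule eventually_conj)
  then obtain k where k: "z (r k) \<in> O'" "inverse (real (Suc k)) < e/2"
    unfolding eventually_sequentially by auto
  have zU: "z (r k) \<in> U" using z K(2) by blast
  have fz: "mdist d (f y) (f (z (r k))) < e/2"
  proof -
    have "f (z (r k)) \<in> ?H" using O(2) k(1) zU by blast
    then show ?thesis by (simp add: Metric_space.in_mball[OF Metric_space_mspace_mdist])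
  qed
  have "inverse (real (Suc (r k))) \<le> inverse (real (Suc k))"
    using seq_suble[OF y(2), of k] by (intro le_imp_inverse_le) auto
  then have qz: "mdist d (f (z (r k))) (q (r k)) < e/2"
    using q(2)[of "r k"] k(2) unfolding mdist_commute[of d "f (z (r k))"] by linarith
  have "mdist d (f y) (q (r k)) < e"
    using mdist_triangle[OF sp[OF yU] sp[OF zU] q(1)[of "r k"]] fz qz by linarith
  then have qG: "q (r k) \<in> G" by (rule inG[OF q(1)])
  have zG: "f (z (r k)) \<in> G" using fz e(1) by (intro inG sp zU) linarith
  have "cmod (\<Phi> (q (r k)) i - \<Phi> (f (z (r k))) i) < \<eta>" if "i < n" for i
  proof -
    have "cmod (\<Phi> (q (r k)) i - \<Phi> (f y) i) < \<eta>/2" "cmod (\<Phi> (f (z (r k))) i - \<Phi> (f y) i) < \<eta>/2"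
      using qG zG that by (auto simp: G_def W_def)
    then show ?thesis
      using norm_triangle_ineq4[of "\<Phi> (q (r k)) i - \<Phi> (f y) i" "\<Phi> (f (z (r k))) i - \<Phi> (f y) i"] by simp
  qed
  with q(3)[of "r k"] qG show False by (auto simp: G_def)
qed

lemma cconvex_cpolydisc: "a \<in> cspace n \<Longrightarrow> cconvex (cpolydisc n a r)"
  unfolding cconvex_def
proof (intro ballI allI impI, elim conjE)
  fix x y and t :: real
  assume x: "x \<in> cpolydisc n a r" and y: "y \<in> cpolydisc n a r" and t: "0 \<le> t" "t \<le> 1"
  have "cmod (of_real (1 - t) * x i + of_real t * y i - a i) \<le> r" if i: "i < n" for i
  proof -
    have "of_real (1 - t) * x i + of_real t * y i - a i = of_real (1 - t) * (x i - a i) + of_real t * (y i - a i)"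
      by (simp add: algebra_simps)
    also have "cmod \<dots> \<le> cmod (of_real (1 - t) * (x i - a i)) + cmod (of_real t * (y i - a i))"
      by (rule norm_triangle_ineq)
    also have "\<dots> = (1 - t) * cmod (x i - a i) + t * cmod (y i - a i)"
      unfolding norm_mult norm_of_real using t by simp
    also have "\<dots> \<le> (1 - t) * r + t * r"
      using x y i t by (intro add_mono mult_left_mono) (auto simp: cpolydisc_def)
    finally show ?thesis by (simp add: algebra_simps)
  qed
  then show "(\<lambda>i. of_real (1 - t) * x i + of_real t * y i) \<in> cpolydisc n a r"
    using x y by (auto simp: cpolydisc_def cspace_def)
qed

text \<open>The Oka property would approximate the inclusion of a small polydisc off the centre by entire maps.
  By Cauchy's estimate their derivatives approximate the identity, so that they are nondegenerate.\<close>

theorem volume_hyperbolic_blowup_not_oka: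
  assumes A: "closed_submanifold n m A" and m: "m < n" and hyp: "brody_volume_hyperbolic n (blowup n A)"
  shows "\<not> oka (blowup n A)"
proof
  assume "oka (blowup n A)"
  then obtain d where d: "mtopology_of d = mfd_top (blowup n A)"
    and approx: "\<forall>M\<ge>1. \<forall>K f. K \<subseteq> cspace M \<and> K \<noteq> {} \<and> compact K \<and> cconvex K \<and>
        holo_map_on_compact M K (blowup n A) f \<longrightarrow>
        (\<exists>F. (\<forall>j::nat. holo_map M (cspace M) (blowup n A) (F j)) \<and>
             (\<forall>e>0. \<exists>N. \<forall>j\<ge>N. \<forall>z\<in>K. mdist d (F j z) (f z) < e))"
    unfolding oka_def by (elim exE conjE) (rule that)
  have n: "0 < n" using m by simp
  note As = closed_submanifold_subset[OF A]
  have cl: "closedin (cspace_top n) A" using A unfolding closed_submanifold_def by blast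
  obtain a where a: "a \<in> cspace n" "a \<notin> A" using closed_submanifold_proper[OF A m] by blast
  define U where "U = {z \<in> polydisc n a 1. z \<notin> A}"
  define \<phi> where "\<phi> = (\<lambda>z :: nat \<Rightarrow> complex. z(0 := z 0 + (1 - a 0)))"
  note ch = chart_off_submanifold[OF cl n a, folded U_def \<phi>_def]
  interpret blowup_chart n A 1 U \<phi> 0
    using ch(1) As by (simp add: blowup_chart_def blowup_chart_axioms_def adapted_chart_def)
  have InlD: "Inl ` U \<subseteq> D" 
  proof clarify
    fix z assume z: "z \<in> U"
    then have "z \<notin> A" using ch(3) by blast
    moreover have "\<phi> z 0 \<noteq> 0"
      using ch(4)[OF z] by (simp add: \<phi>_def)
    ultimately show "Inl z \<in> D"
      unfolding Inl_in_D using z by blast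
  qed
  have \<Phi>: "\<Phi> (Inl z) = \<phi> z" for z
    unfolding coord_Inl by (rule ext) auto
  have inc: "holo_map n U (blowup n A) Inl"
    by (rule holo_map_inclusion[OF As U_open chart_in_blowup InlD])
  obtain r0 where r0: "r0 > 0" "polydisc n a r0 \<subseteq> U" using U_open ch(2) openin_cspace_iff by blast
  define r where "r = r0/2"
  have r: "r > 0" using r0 by (simp add: r_def)
  define K where "K = cpolydisc n a r"
  have KU: "K \<subseteq> U"
    using r0 by (force simp: K_def cpolydisc_def polydisc_def r_def)
  have aK: "a \<in> K" using a r by (simp add: K_def cpolydisc_def)
  have "K \<subseteq> cspace n \<and> K \<noteq> {} \<and> compact K \<and> cconvex K \<and> holo_map_on_compact n K (blowup n A) Inl"
  proof (intro conjI)
    show "holo_map_on_compact n K (blowup n A) Inl"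
      unfolding holo_map_on_compact_def using U_open KU inc by blast
    show "K \<subseteq> cspace n" using KU U_sub by blast
    show "compact K" unfolding K_def by (rule compact_cpolydisc)
    show "cconvex K" unfolding K_def by (rule cconvex_cpolydisc[OF a(1)])
  qed (use aK in blast)
  moreover have "1 \<le> n" using n by simp
  ultimately have "\<exists>F. (\<forall>j::nat. holo_map n (cspace n) (blowup n A) (F j)) \<and>
      (\<forall>e>0. \<exists>N. \<forall>j\<ge>N. \<forall>z\<in>K. mdist d (F j z) (Inl z) < e)"
    using approx by blast
  then obtain F where F: "\<And>j::nat. holo_map n (cspace n) (blowup n A) (F j)"
    "\<And>e. e > 0 \<Longrightarrow> \<exists>N. \<forall>j\<ge>N. \<forall>z\<in>K. mdist d (F j z) (Inl z) < e" by blast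
  define \<eta> where "\<eta> = r / (4 * real n)"
  have \<eta>: "\<eta> > 0" "2 * \<eta> / r = 1 / (2 * real n)" using r n by (auto simp: \<eta>_def)
  have "continuous_map (top_of_set U) (mfd_top (blowup n A)) Inl"
    using inc unfolding holo_map_def by blast
  from uniform_in_chart[OF d chart_in_blowup U_sub this InlD _ KU \<eta>(1)] compact_cpolydisc[of n a r]
  obtain e where e: "e > 0" "\<And>z q. z \<in> K \<Longrightarrow> q \<in> mspace d \<Longrightarrow> mdist d q (Inl z) < e \<Longrightarrow>
      q \<in> D \<and> (\<forall>i<n. cmod (\<Phi> q i - \<Phi> (Inl z) i) < \<eta>)"
    unfolding K_def by blast
  obtain N where N: "\<And>z. z \<in> K \<Longrightarrow> mdist d (F N z) (Inl z) < e" using F(2)[OF e(1)] by blast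
  have sp: "F N z \<in> mspace d" if "z \<in> cspace n" for z
    using holo_map_in_topspace[OF F(1) that] topspace_mtopology_of[of d] d by simp
  have FN: "F N z \<in> D" "i < n \<Longrightarrow> cmod (\<Phi> (F N z) i - \<phi> z i) < \<eta>" if "z \<in> K" for z i
  proof -
    have "z \<in> cspace n" using that KU U_sub by blast
    from e(2)[OF that sp[OF this] N[OF that]]
    show "F N z \<in> D" "i < n \<Longrightarrow> cmod (\<Phi> (F N z) i - \<phi> z i) < \<eta>" unfolding \<Phi> by blast+
  qed
  let ?P = "polydisc n a r"
  have PK: "?P \<subseteq> K" by (auto simp: K_def polydisc_def cpolydisc_def less_imp_le)
  have aP: "a \<in> ?P" by (rule centre_in_polydisc[OF a(1) r])
  have hF: "holo_on n ?P (\<lambda>z. \<Phi> (F N z) i)" for i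
    by (rule holo_on_subset[OF holo_map_coord[OF F(1) chart_in_blowup]])
      (use PK FN(1) polydisc_subset_cspace in blast)
  have h\<phi>: "holo_on n ?P (\<lambda>z. \<phi> z i)" for i
    by (rule holo_on_subset[OF coord_holo]) (use PK KU in blast)
  have "det (Matrix.mat n n (\<lambda>(j, i). pderiv_at i (\<lambda>z. \<Phi> (F N z) j) a)) \<noteq> 0"
  proof (rule det_near_identity)
    fix i j assume ij: "i < n" "j < n"
    have der\<phi>: "((\<lambda>s. \<phi> (a(i := s)) j) has_field_derivative (if j = i then 1 else 0)) (at (a i))"
      unfolding \<phi>_def by (cases "j = i"; cases "j = 0") (auto intro!: derivative_eq_intros)
    have derF: "((\<lambda>s. \<Phi> (F N (a(i := s))) j) has_field_derivative pderiv_at i (\<lambda>z. \<Phi> (F N z) j) a) (at (a i))"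
      using holo_on_has_derivative[OF openin_polydisc hF ij(1), of a "a i"] aP by simp
    have "pderiv_at i (\<lambda>z. \<Phi> (F N z) j - \<phi> z j) a = pderiv_at i (\<lambda>z. \<Phi> (F N z) j) a - (if j = i then 1 else 0)"
      by (rule pderiv_at_eqI) (rule DERIV_diff[OF derF der\<phi>])
    moreover have "cmod (pderiv_at i (\<lambda>z. \<Phi> (F N z) j - \<phi> z j) a) \<le> 2 * \<eta> / r"
    proof (rule pderiv_bound[OF openin_polydisc holo_on_diff[OF hF h\<phi>] order_refl _ a(1) r ij(1)])
      show "cmod (\<Phi> (F N z) j - \<phi> z j) \<le> \<eta>" if "z \<in> ?P" for z
        using FN(2)[of z j] PK that ij less_imp_le by blast
    qed
    ultimately show "cmod (pderiv_at i (\<lambda>z. \<Phi> (F N z) j) a - (if j = i then 1 else 0)) \<le> 1 / (2 * real n)"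
      by (simp add: \<eta>(2))
  qed
  then have "vec_space.rank n (jacobian n (\<Phi> \<circ> F N) a) = n"
    using rank_full_iff_det[of "jacobian n (\<Phi> \<circ> F N) a" n] by (simp add: jacobian_def)
  then have "nondegenerate n (blowup n A) (F N)"
    unfolding nondegenerate_def using a(1) chart_in_blowup FN(1)[OF aK] by blast
  with F(1) hyp show False
    unfolding brody_volume_hyperbolic_def by blast
qed


section \<open>Blow-ups of affine space along a curve that are volume hyperbolic\<close>

text \<open>A nondegenerate map to the blow-up would blow down to an entire map which meets the curve at a point
  where it is locally invertible, but such a map has no lift as the curve has codimension at least two.\<close>

lemma (in proper_embedded_curve) volume_hyperbolic_blowup:
  assumes n: "3 \<le> n"
    and unavoidable: "\<And>F z0. entire_self_map n F \<Longrightarrow> z0 \<in> cspace n \<Longrightarrow> det (jacobian n F z0) \<noteq> 0 \<Longrightarrow>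
       \<exists>z\<in>cspace n. F z \<in> range \<gamma> \<and> det (jacobian n F z) \<noteq> 0"
  shows "brody_volume_hyperbolic n (blowup n (range \<gamma>))"
proof -
  let ?A = "range \<gamma>"
  have A: "?A \<subseteq> cspace n" using in_cspace by blast
  have "\<not> (holo_map n (cspace n) (blowup n ?A) f \<and> nondegenerate n (blowup n ?A) f)" for f
  proof
    assume f: "holo_map n (cspace n) (blowup n ?A) f \<and> nondegenerate n (blowup n ?A) f"
    define F where "F = (\<lambda>z. blowdown (f z))"
    have "F z \<in> cspace n" if "z \<in> cspace n" for z
      using continuous_map_image_subset_topspace[OF continuous_map_blowdown[OF A]]
        holo_map_in_topspace[OF conjunct1[OF f] that]
      by (auto simp: F_def cspace_top_def)
    then have F: "entire_self_map n F"
      using holo_on_blowdown_map[OF A openin_cspace_whole conjunct1[OF f]]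
      by (simp add: entire_self_map_def F_def)
    obtain z0 where "z0 \<in> cspace n" "det (jacobian n F z0) \<noteq> 0"
      using nondegenerate_blowdown[OF A conjunct1[OF f] conjunct2[OF f]] unfolding F_def by blast
    then obtain z where z: "z \<in> cspace n" "F z \<in> ?A" "det (jacobian n F z) \<noteq> 0"
      using unavoidable[OF F] by blast
    obtain t where t: "F z = \<gamma> t" using z(2) by blast
    obtain U \<phi> where U: "\<gamma> t \<in> U" "adapted n ?A (n - 1) U \<phi>"
      using adapted_at[of t] n by auto
    interpret adapted_chart n ?A "n - 1" U \<phi>
      using U(2) A by (simp add: adapted_chart_def)
    have "det (jacobian n (\<lambda>z. blowdown (f z)) z) = 0"
      by (rule lift_degenerate_over_centre[OF openin_cspace_whole conjunct1[OF f] _ z(1)])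
        (use n z(2) U(1) t in \<open>auto simp: F_def\<close>)
    with z(3) show False by (simp add: F_def)
  qed
  moreover have "complex_manifold n (blowup n ?A)"
    using complex_manifold_blowup[OF A] .
  ultimately show ?thesis
    by (simp add: brody_volume_hyperbolic_def)
qed

theorem theorem1p6:
  fixes n :: nat
  assumes "n \<ge> 3"
  shows "\<exists>\<gamma> :: complex \<Rightarrow> nat \<Rightarrow> complex.
           holomorphic_embedding n \<gamma> \<and> proper_into_cspace n \<gamma> \<and>
           closed_submanifold n 1 (range \<gamma>) \<and> connected (range \<gamma>) \<and>
           brody_volume_hyperbolic n (blowup n (range \<gamma>)) \<and>
           \<not> oka (blowup n (range \<gamma>))"
proof -
  have n: "0 < n" "1 < n" using assms by simp_all
  show ?thesis
  proof (rule unavoidable_sequence[OF n(1)])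
    fix e :: "nat \<Rightarrow> nat \<Rightarrow> complex" and tol :: "nat \<Rightarrow> real" and x :: "nat \<Rightarrow> nat"
    assume e: "\<And>m. tol m > 0" "\<And>m. \<exists>i<n. cmod (e m i) > real (x m)" "filterlim x at_top sequentially"
      and unavoidable: "\<And>F z0 e'. entire_self_map n F \<Longrightarrow> z0 \<in> cspace n \<Longrightarrow> det (jacobian n F z0) \<noteq> 0 \<Longrightarrow>
         (\<And>m. e' m \<in> cspace n) \<Longrightarrow> (\<And>m i. i < n \<Longrightarrow> cmod (e' m i - e m i) < tol m) \<Longrightarrow>
         \<exists>m. \<exists>z\<in>cspace n. F z = e' m \<and> det (jacobian n F z) \<noteq> 0"
    show ?thesis
    proof (rule proper_curve_near_sequence[OF assms e])
      fix \<gamma> :: "complex \<Rightarrow> nat \<Rightarrow> complex"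
      assume \<gamma>: "\<And>t. \<gamma> t \<in> cspace n" "\<And>l. (\<lambda>t. \<gamma> t l) holomorphic_on UNIV" "inj \<gamma>"
        "\<And>t. \<exists>l. deriv (\<lambda>t. \<gamma> t l) t \<noteq> 0"
        "\<And>M :: real. \<exists>R. \<forall>t. cmod t \<ge> R \<longrightarrow> (\<exists>i<n. cmod (\<gamma> t i) > M)"
        and near: "\<And>m. \<exists>t. \<forall>i<n. cmod (\<gamma> t i - e m i) < tol m"
      interpret proper_embedded_curve n \<gamma>
        by (rule proper_embedded_curve.intro) (rule \<gamma>)+
      obtain t where t: "\<And>m. \<forall>i<n. cmod (\<gamma> (t m) i - e m i) < tol m"
        using choice[of "\<lambda>m t. \<forall>i<n. cmod (\<gamma> t i - e m i) < tol m"] near by blast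
      have hyp: "brody_volume_hyperbolic n (blowup n (range \<gamma>))"
      proof (rule volume_hyperbolic_blowup[OF assms])
        fix F z0 assume F: "entire_self_map n F" "z0 \<in> cspace n" "det (jacobian n F z0) \<noteq> 0"
        have "\<exists>m. \<exists>z\<in>cspace n. F z = \<gamma> (t m) \<and> det (jacobian n F z) \<noteq> 0"
          by (rule unavoidable[OF F]) (use \<gamma>(1) t in blast)+
        then show "\<exists>z\<in>cspace n. F z \<in> range \<gamma> \<and> det (jacobian n F z) \<noteq> 0"
          by (elim exE bexE conjE) (intro bexI conjI; simp)
      qed
      have sub: "closed_submanifold n 1 (range \<gamma>)"
        by (rule submanifold[OF n(1)])
      show ?thesis
        by (intro exI[of _ \<gamma>] conjI embedding n proper sub connected_curve hyp
            volume_hyperbolic_blowup_not_oka[OF sub n(2) hyp])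
    qed
  qed
qed

end
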